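(* Let $X$ be a connected, finite CW complex with combinatorial homology basis $\mathfrak{h}$, spanning tree data $\{T^k\}_{k\ge0}$ and homology truncation data $\{V^k\}_{k\ge0}$ (with $V^k$ subordinate to $T^k$). Then $$\tau^2(X;\mathfrak{h})=\prod_{k\ge0}\left(\frac{\theta_{T^k}^2\,t(q_k)^2}{\theta_{V^k}^2\,\chi_k}\right)^{(-1)^k}.$$
   Context: Notation. $X_k$ is the set of $k$-cells of $X$, $X^{(k)}$ its $k$-skeleton, $C_k(X;A)$ the cellular chain group (free $A$-module on $X_k$), $\partial$ the cellular boundary, $Z_k$, $B_k$ the cycles and boundaries; all homology is cellular, $\beta_k$ is the $k$-th Betti number. Combinatorial basis. $H_k(X;\mathbb{Z})_0$ is the image of $H_k(X;\mathbb{Z})\to H_k(X;\mathbb{R})$. A combinatorial basis $\mathfrak{h}=\{\mathfrak{h}_k\}$ consists of a $\mathbb{Z}$-basis $\mathfrak{h}_k$ of $H_k(X;\mathbb{Z})_0$ for each $k\ge0$. Reidemeister torsion. Write $C_k,Z_k,B_k,H_k$ for the real chains, cycles, boundaries and homology of $X$. Choose splittings $s_{k-1}\colon B_{k-1}\to C_k$ of $\partial\colon C_k\to B_{k-1}$ and $t_k\colon H_k\to Z_k$ of $Z_k\to H_k$, and a basis $\mathfrak{b}_k$ of each $B_k$. Then $\mathfrak{b}_k$, $t_k(\mathfrak{h}_k)$, $s_{k-1}(\mathfrak{b}_{k-1})$ together form a basis of $C_k$; let $[\mathfrak{b}_k\mathfrak{h}_k\mathfrak{b}_{k-1}/\mathfrak{c}_k]$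 be the matrix expressing it in the basis $\mathfrak{c}_k$ of $C_k$ given by the $k$-cells. The torsion is $\tau(X;\mathfrak{h})=\prod_{k\ge0}\det[\mathfrak{b}_k\mathfrak{h}_k\mathfrak{b}_{k-1}/\mathfrak{c}_k]^{(-1)^k}$; it is independent of the choice of the $\mathfrak{b}_k$ and the splittings (and its square does not depend on orderings of bases). $\tau^2(X;\mathfrak{h})$ is its square. Spanning tree data. For each $k\ge1$, $T^k$ is a spanning tree of $X^{(k)}$, i.e. a subcomplex $T^k\subset X^{(k)}$ with $H_k(T^k;\mathbb{Z})=0$, $\beta_{k-1}(T^k)=\beta_{k-1}(X^{(k)})$, $X^{(k-1)}\subset T^k$. By convention $T^0=\emptyset$. Homology truncation data. For each $k\ge 0$, $V^k$ is a homology truncation of $X$ in degree $k$ subordinate to $T^k$: a subcomplex $i\colon V^k\subset X^{(k)}$ with $T^k\subset V^k$ such that $i_*\colon H_j(V^k;\mathbb{R})\to H_j(X;\mathbb{R})$ is an isomorphism for all $j\le k$. (So $V^0$ is a single vertex.) Constants. For $Y=T^k$ or $Y=V^k$, $\theta_Y$ is the order of the torsion subgroup of $H_{k-1}(Y;\mathbb{Z})$ (so equal to $1$ when $k=0$). $\chi_k\in\mathbb{N}$ is the square of the determinant of $i_*\colon H_k(V^k;\mathbb{R})\to H_k(X;\mathbb{R})$, computed with respect to a $\mathbb{Z}$-basis of the free abelian group $H_k(V^k;\mathbb{Z})$ and the basis $\mathfrak{h}_k$; that is, the square of the covolume of the lattice $i_*(H_k(V^k;\mathbb{Z}))\subset H_k(X;\mathbb{R})$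 when $\mathfrak{h}_k$ is orthonormal. The homomorphism $q_k\colon B_k(T^{k+1};\mathbb{Z})\to C_k(X/V^k;\mathbb{Z})$ is induced by the quotient map $T^{k+1}\to X/V^k$, where $C_k(X/V^k;\mathbb{Z})$ is the free abelian group on the $k$-cells of $X$ not in $V^k$ (for $k=0$ it is replaced by the relative chain group $C_0(X,V^0;\mathbb{Z})$). It becomes an isomorphism after tensoring with $\mathbb{R}$, and $t(q_k)$ denotes the order of its (finite) cokernel. *)

theory Defs
  imports "HOL-Homology.Homology" "Jordan_Normal_Form.Determinant"
begin

section \<open>Finite CW complexes\<close>

text \<open>The closed unit disc $D^k$, the open disc and the sphere $S^{k-1}$, inside the library's
  model of $\mathbb{R}^k$ (real sequences vanishing from index $k$ on).
  For $k = 0$ the disc is a point and the sphere is empty.\<close>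

definition disc :: "nat \<Rightarrow> (nat \<Rightarrow> real) topology" where
  "disc k = subtopology (Euclidean_space k) {x. (\<Sum>i<k. (x i)\<^sup>2) \<le> 1}"

definition open_disc :: "nat \<Rightarrow> (nat \<Rightarrow> real) set" where
  "open_disc k = {x \<in> topspace (Euclidean_space k). (\<Sum>i<k. (x i)\<^sup>2) < 1}"

definition disc_sphere :: "nat \<Rightarrow> (nat \<Rightarrow> real) set" where
  "disc_sphere k = {x \<in> topspace (Euclidean_space k). (\<Sum>i<k. (x i)\<^sup>2) = 1}"

text \<open>A space, labels for the cells of each dimension, and a characteristic map
  $D^k \to X$ for each $k$-cell.\<close>

record ('a, 'c) cw =
  cw_space :: "'a topology"
  cw_cells :: "nat \<Rightarrow> 'c set"
  cw_map :: "nat \<Rightarrow> 'c \<Rightarrow> (nat \<Rightarrow> real) \<Rightarrow> 'a"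

definition open_cell :: "('a, 'c) cw \<Rightarrow> nat \<Rightarrow> 'c \<Rightarrow> 'a set" where
  "open_cell X k e = cw_map X k e ` open_disc k"

definition cells_union :: "('a, 'c) cw \<Rightarrow> 'a set" where
  "cells_union X = (\<Union>k. \<Union>e\<in>cw_cells X k. open_cell X k e)"

text \<open>The point set of the skeleton $X^{(k-1)}$, with $X^{(-1)} = \emptyset$.\<close>

definition below :: "('a, 'c) cw \<Rightarrow> nat \<Rightarrow> 'a set" where
  "below X k = (\<Union>j<k. \<Union>e\<in>cw_cells X j. open_cell X j e)"

text \<open>Closure finiteness and the weak topology are automatic, there being only finitely many
  cells.\<close>

definition finite_cw_complex :: "('a, 'c) cw \<Rightarrow> bool" where
  "finite_cw_complex X \<longleftrightarrow>
     Hausdorff_space (cw_space X) \<and>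
     finite (SIGMA k:UNIV. cw_cells X k) \<and>
     (\<forall>k. \<forall>e\<in>cw_cells X k.
        continuous_map (disc k) (cw_space X) (cw_map X k e) \<and>
        inj_on (cw_map X k e) (open_disc k) \<and>
        cw_map X k e ` disc_sphere k \<subseteq> below X k) \<and>
     (\<forall>k l. \<forall>e\<in>cw_cells X k. \<forall>f\<in>cw_cells X l.
        (k, e) \<noteq> (l, f) \<longrightarrow> open_cell X k e \<inter> open_cell X l f = {}) \<and>
     topspace (cw_space X) = cells_union X"

definition subcomplex :: "('a, 'c) cw \<Rightarrow> ('a, 'c) cw \<Rightarrow> bool" where
  "subcomplex Y X \<longleftrightarrow>
     (\<forall>k. cw_cells Y k \<subseteq> cw_cells X k) \<and>
     cw_map Y = cw_map X \<and>
     cw_space Y = subtopology (cw_space X) (cells_union Y) \<and>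
     closedin (cw_space X) (cells_union Y)"

definition skeleton :: "('a, 'c) cw \<Rightarrow> nat \<Rightarrow> ('a, 'c) cw" where
  "skeleton X k =
     \<lparr>cw_space = subtopology (cw_space X) (below X (Suc k)),
      cw_cells = (\<lambda>j. if j \<le> k then cw_cells X j else {}),
      cw_map = cw_map X\<rparr>"

section \<open>Modules\<close>

text \<open>All modules below are over a coefficient ring given by a type (in practice the integers or
  the reals) and are stored in the library record for modules, whose ring multiplication
  and unit play no role.\<close>

definition restrict_module :: "('r, 'm) module \<Rightarrow> 'm set \<Rightarrow> ('r, 'm) module" where
  "restrict_module M N = M\<lparr>carrier := N\<rparr>"

definition quotient_module :: "('r, 'm) module \<Rightarrow> 'm set \<Rightarrow> ('r, 'm set) module" where
  "quotient_module M N =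
     \<lparr>carrier = a_rcosets\<^bsub>M\<^esub> N, monoid.mult = undefined, one = undefined, zero = N, add = set_add M,
      module.smult = (\<lambda>r S. \<Union>s\<in>S. N +>\<^bsub>M\<^esub> (r \<odot>\<^bsub>M\<^esub> s))\<rparr>"

definition linear_map :: "('r, 'm) module \<Rightarrow> ('r, 'n) module \<Rightarrow> ('m \<Rightarrow> 'n) \<Rightarrow> bool" where
  "linear_map M N f \<longleftrightarrow>
     f \<in> carrier M \<rightarrow> carrier N \<and>
     (\<forall>x\<in>carrier M. \<forall>y\<in>carrier M. f (x \<oplus>\<^bsub>M\<^esub> y) = f x \<oplus>\<^bsub>N\<^esub> f y) \<and>
     (\<forall>r. \<forall>x\<in>carrier M. f (r \<odot>\<^bsub>M\<^esub> x) = r \<odot>\<^bsub>N\<^esub> f x)"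

definition linear_iso :: "('r, 'm) module \<Rightarrow> ('r, 'n) module \<Rightarrow> ('m \<Rightarrow> 'n) \<Rightarrow> bool" where
  "linear_iso M N f \<longleftrightarrow> linear_map M N f \<and> bij_betw f (carrier M) (carrier N)"

definition lin_comb :: "('r, 'm) module \<Rightarrow> 'm list \<Rightarrow> (nat \<Rightarrow> 'r) \<Rightarrow> 'm" where
  "lin_comb M bs a = (\<Oplus>\<^bsub>M\<^esub>i\<in>{..<length bs}. a i \<odot>\<^bsub>M\<^esub> (bs ! i))"

definition coords_of :: "('r::zero, 'm) module \<Rightarrow> 'm list \<Rightarrow> 'm \<Rightarrow> (nat \<Rightarrow> 'r) \<Rightarrow> bool" where
  "coords_of M bs x a \<longleftrightarrow> (\<forall>i\<ge>length bs. a i = 0) \<and> x = lin_comb M bs a"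

definition module_basis :: "('r::zero, 'm) module \<Rightarrow> 'm list \<Rightarrow> bool" where
  "module_basis M bs \<longleftrightarrow>
     set bs \<subseteq> carrier M \<and> (\<forall>x\<in>carrier M. \<exists>!a. coords_of M bs x a)"

definition coords :: "('r::zero, 'm) module \<Rightarrow> 'm list \<Rightarrow> 'm \<Rightarrow> nat \<Rightarrow> 'r" where
  "coords M bs x = (THE a. coords_of M bs x a)"

text \<open>The matrix whose columns express the entries of \<open>vs\<close> in the basis \<open>bs\<close>.\<close>

definition basis_matrix :: "('r::zero, 'm) module \<Rightarrow> 'm list \<Rightarrow> 'm list \<Rightarrow> 'r Matrix.mat" where
  "basis_matrix M bs vs =
     Matrix.mat (length bs) (length vs) (\<lambda>(i, j). coords M bs (vs ! j) i)"

definition module_rank :: "('r::zero, 'm) module \<Rightarrow> nat" where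
  "module_rank M = (THE n. \<exists>bs. module_basis M bs \<and> length bs = n)"

definition torsion_elements :: "(int, 'm) module \<Rightarrow> 'm set" where
  "torsion_elements M = {x \<in> carrier M. \<exists>n. n \<noteq> 0 \<and> n \<odot>\<^bsub>M\<^esub> x = \<zero>\<^bsub>M\<^esub>}"

definition free_module :: "'c set \<Rightarrow> ('r::comm_ring_1, 'c \<Rightarrow> 'r) module" where
  "free_module E =
     \<lparr>carrier = {c. \<forall>e. e \<notin> E \<longrightarrow> c e = 0}, monoid.mult = undefined, one = undefined,
      zero = (\<lambda>_. 0), add = (\<lambda>c d e. c e + d e), module.smult = (\<lambda>r c e. r * c e)\<rparr>"

section \<open>Cellular chains and homology\<close>

text \<open>A generator of $H_k(D^k, S^{k-1}) \cong \mathbb{Z}$, the same one for all $k$-cells.\<close>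

definition disc_class :: "nat \<Rightarrow> (nat \<Rightarrow> real) chain set" where
  "disc_class k = (SOME a.
     a \<in> carrier (relative_homology_group (int k) (disc k) (disc_sphere k)) \<and>
     subgroup_generated (relative_homology_group (int k) (disc k) (disc_sphere k)) {a}
       = relative_homology_group (int k) (disc k) (disc_sphere k))"

text \<open>$H_k(X^{(k)}, X^{(k-1)})$ in singular homology; it is free abelian on the classes of the
  $k$-cells.\<close>

definition skel_top :: "('a, 'c) cw \<Rightarrow> nat \<Rightarrow> 'a topology" where
  "skel_top X k = subtopology (cw_space X) (below X (Suc k))"

definition skel_group :: "('a, 'c) cw \<Rightarrow> nat \<Rightarrow> 'a chain set monoid" where
  "skel_group X k = relative_homology_group (int k) (skel_top X k) (below X k)"

definition cell_class :: "('a, 'c) cw \<Rightarrow> nat \<Rightarrow> 'c \<Rightarrow> 'a chain set" where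
  "cell_class X k e =
     hom_induced (int k) (disc k) (disc_sphere k) (skel_top X k) (below X k) (cw_map X k e)
       (disc_class k)"

text \<open>The connecting map
  $H_{k+1}(X^{(k+1)}, X^{(k)}) \to H_k(X^{(k)}) \to H_k(X^{(k)}, X^{(k-1)})$ of the triple.\<close>

definition skel_boundary :: "('a, 'c) cw \<Rightarrow> nat \<Rightarrow> 'a chain set \<Rightarrow> 'a chain set" where
  "skel_boundary X k z =
     hom_induced (int k) (skel_top X k) {} (skel_top X k) (below X k) id
       (hom_boundary (int (Suc k)) (skel_top X (Suc k)) (below X (Suc k)) z)"

text \<open>\<open>incidence X k e f\<close> is the coefficient of the \<open>k\<close>-cell \<open>f\<close> in the cellular boundary of the
  \<open>(k+1)\<close>-cell \<open>e\<close>. The homology groups are written multiplicatively in the library.\<close>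

definition incidence :: "('a, 'c) cw \<Rightarrow> nat \<Rightarrow> 'c \<Rightarrow> 'c \<Rightarrow> int" where
  "incidence X k e = (THE n.
     (\<forall>f. f \<notin> cw_cells X k \<longrightarrow> n f = 0) \<and>
     skel_boundary X k (cell_class X (Suc k) e) =
       (\<Otimes>\<^bsub>skel_group X k\<^esub>f\<in>cw_cells X k. cell_class X k f [^]\<^bsub>skel_group X k\<^esub> n f))"

definition cw_chains :: "('a, 'c) cw \<Rightarrow> nat \<Rightarrow> ('r::comm_ring_1, 'c \<Rightarrow> 'r) module" where
  "cw_chains X k = free_module (cw_cells X k)"

text \<open>$\partial \colon C_k \to C_{k-1}$, where $C_{-1} = 0$.\<close>

fun cw_boundary :: "('a, 'c) cw \<Rightarrow> nat \<Rightarrow> ('c \<Rightarrow> 'r::comm_ring_1) \<Rightarrow> 'c \<Rightarrow> 'r" where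
  "cw_boundary X 0 c = (\<lambda>_. 0)"
| "cw_boundary X (Suc k) c = (\<lambda>f. \<Sum>e\<in>cw_cells X (Suc k). of_int (incidence X k e f) * c e)"

definition cw_cycles :: "('a, 'c) cw \<Rightarrow> nat \<Rightarrow> ('r::comm_ring_1, 'c \<Rightarrow> 'r) module" where
  "cw_cycles X k =
     restrict_module (cw_chains X k) {c \<in> carrier (cw_chains X k). cw_boundary X k c = (\<lambda>_. 0)}"

definition cw_boundaries :: "('a, 'c) cw \<Rightarrow> nat \<Rightarrow> ('r::comm_ring_1, 'c \<Rightarrow> 'r) module" where
  "cw_boundaries X k =
     restrict_module (cw_chains X k) (cw_boundary X (Suc k) ` carrier (cw_chains X (Suc k)))"

definition cw_homology :: "('a, 'c) cw \<Rightarrow> nat \<Rightarrow> ('r::comm_ring_1, ('c \<Rightarrow> 'r) set) module" where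
  "cw_homology X k = quotient_module (cw_cycles X k) (carrier (cw_boundaries X k))"

definition betti :: "('a, 'c) cw \<Rightarrow> nat \<Rightarrow> nat" where
  "betti X k = module_rank (cw_homology X k :: (real, ('c \<Rightarrow> real) set) module)"

text \<open>The map into $H_k(X; A)$ induced on homology classes by a map \<open>f\<close> of cycles. It is used for
  the inclusion of a subcomplex (\<open>f = id\<close>), for the change of coefficients from the integers
  to the reals (\<open>f = real_chain\<close>), and for their composite.\<close>

definition homology_map ::
  "('a, 'c) cw \<Rightarrow> nat \<Rightarrow> ('m \<Rightarrow> 'c \<Rightarrow> 'r::comm_ring_1) \<Rightarrow> 'm set \<Rightarrow> ('c \<Rightarrow> 'r) set" where
  "homology_map X k f S =
     (\<Union>z\<in>S. carrier (cw_boundaries X k) +>\<^bsub>cw_chains X k :: ('r, 'c \<Rightarrow> 'r) module\<^esub> f z)"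

definition real_chain :: "('c \<Rightarrow> int) \<Rightarrow> 'c \<Rightarrow> real" where
  "real_chain c = (\<lambda>e. real_of_int (c e))"

text \<open>$H_k(X; \mathbb{Z})_0$, as a $\mathbb{Z}$-module.\<close>

definition homology_lattice :: "('a, 'c) cw \<Rightarrow> nat \<Rightarrow> (int, ('c \<Rightarrow> real) set) module" where
  "homology_lattice X k =
     (let H = cw_homology X k :: (real, ('c \<Rightarrow> real) set) module in
      \<lparr>carrier = homology_map X k real_chain `
                  carrier (cw_homology X k :: (int, ('c \<Rightarrow> int) set) module),
       monoid.mult = undefined, one = undefined, zero = \<zero>\<^bsub>H\<^esub>, add = (\<oplus>\<^bsub>H\<^esub>),
       module.smult = (\<lambda>n x. real_of_int n \<odot>\<^bsub>H\<^esub> x)\<rparr>)"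

definition combinatorial_basis :: "('a, 'c) cw \<Rightarrow> (nat \<Rightarrow> ('c \<Rightarrow> real) set list) \<Rightarrow> bool" where
  "combinatorial_basis X h \<longleftrightarrow> (\<forall>k. module_basis (homology_lattice X k) (h k))"

section \<open>Reidemeister torsion\<close>

text \<open>The choices entering the torsion: an ordering \<open>c k\<close> of the \<open>k\<close>-cells, a basis \<open>b k\<close> of
  $B_k$, and splittings \<open>s k\<close> of $\partial \colon C_{k+1} \to B_k$ and \<open>t k\<close> of $Z_k \to H_k$.\<close>

definition torsion_choices ::
  "('a, 'c) cw \<Rightarrow> (nat \<Rightarrow> 'c list) \<Rightarrow> (nat \<Rightarrow> ('c \<Rightarrow> real) list) \<Rightarrow>
   (nat \<Rightarrow> ('c \<Rightarrow> real) \<Rightarrow> 'c \<Rightarrow> real) \<Rightarrow> (nat \<Rightarrow> ('c \<Rightarrow> real) set \<Rightarrow> 'c \<Rightarrow> real) \<Rightarrow> bool" where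
  "torsion_choices X c b s t \<longleftrightarrow> (\<forall>k.
     distinct (c k) \<and> set (c k) = cw_cells X k \<and>
     module_basis (cw_boundaries X k) (b k) \<and>
     linear_map (cw_boundaries X k) (cw_chains X (Suc k)) (s k) \<and>
     (\<forall>x \<in> carrier (cw_boundaries X k). cw_boundary X (Suc k) (s k x) = x) \<and>
     linear_map (cw_homology X k) (cw_cycles X k) (t k) \<and>
     (\<forall>y \<in> carrier (cw_homology X k).
        carrier (cw_boundaries X k) +>\<^bsub>cw_cycles X k\<^esub> t k y = y))"

definition unit_chain :: "'c \<Rightarrow> 'c \<Rightarrow> real" where
  "unit_chain e = (\<lambda>f. if f = e then 1 else 0)"

text \<open>$[\mathfrak{b}_k \mathfrak{h}_k \mathfrak{b}_{k-1} / \mathfrak{c}_k]$, where $B_{-1} = 0$.\<close>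

definition torsion_matrix ::
  "('a, 'c) cw \<Rightarrow> (nat \<Rightarrow> ('c \<Rightarrow> real) set list) \<Rightarrow>
   (nat \<Rightarrow> 'c list) \<Rightarrow> (nat \<Rightarrow> ('c \<Rightarrow> real) list) \<Rightarrow>
   (nat \<Rightarrow> ('c \<Rightarrow> real) \<Rightarrow> 'c \<Rightarrow> real) \<Rightarrow> (nat \<Rightarrow> ('c \<Rightarrow> real) set \<Rightarrow> 'c \<Rightarrow> real) \<Rightarrow> nat \<Rightarrow> real Matrix.mat"
  where
  "torsion_matrix X h c b s t k =
     basis_matrix (cw_chains X k) (map unit_chain (c k))
       (b k @ map (t k) (h k) @ (case k of 0 \<Rightarrow> [] | Suc j \<Rightarrow> map (s j) (b j)))"

text \<open>All but finitely many of these matrices are empty, with determinant 1.\<close>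

definition torsion_for ::
  "('a, 'c) cw \<Rightarrow> (nat \<Rightarrow> ('c \<Rightarrow> real) set list) \<Rightarrow>
   (nat \<Rightarrow> 'c list) \<Rightarrow> (nat \<Rightarrow> ('c \<Rightarrow> real) list) \<Rightarrow>
   (nat \<Rightarrow> ('c \<Rightarrow> real) \<Rightarrow> 'c \<Rightarrow> real) \<Rightarrow> (nat \<Rightarrow> ('c \<Rightarrow> real) set \<Rightarrow> 'c \<Rightarrow> real) \<Rightarrow> real"
  where
  "torsion_for X h c b s t =
     Prod_any (\<lambda>k. Determinant.det (torsion_matrix X h c b s t k) powi ((-1) ^ k))"

text \<open>The square of the torsion; the definite description reflects that it does not depend on
  the choices.\<close>

definition reidemeister_torsion_sq ::
  "('a, 'c) cw \<Rightarrow> (nat \<Rightarrow> ('c \<Rightarrow> real) set list) \<Rightarrow> real" where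
  "reidemeister_torsion_sq X h =
     (THE x. \<exists>c b s t. torsion_choices X c b s t \<and> x = (torsion_for X h c b s t)\<^sup>2)"

section \<open>Spanning trees and homology truncations\<close>

definition spanning_tree :: "('a, 'c) cw \<Rightarrow> nat \<Rightarrow> ('a, 'c) cw \<Rightarrow> bool" where
  "spanning_tree X k T \<longleftrightarrow>
     subcomplex T (skeleton X k) \<and>
     carrier (cw_homology T k :: (int, ('c \<Rightarrow> int) set) module)
       = {\<zero>\<^bsub>cw_homology T k :: (int, ('c \<Rightarrow> int) set) module\<^esub>} \<and>
     betti T (k - 1) = betti (skeleton X k) (k - 1) \<and>
     subcomplex (skeleton X (k - 1)) T"

definition spanning_tree_data :: "('a, 'c) cw \<Rightarrow> (nat \<Rightarrow> ('a, 'c) cw) \<Rightarrow> bool" where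
  "spanning_tree_data X T \<longleftrightarrow>
     (\<forall>k\<ge>1. spanning_tree X k (T k)) \<and>
     subcomplex (T 0) X \<and> (\<forall>j. cw_cells (T 0) j = {})"

definition homology_truncation ::
  "('a, 'c) cw \<Rightarrow> nat \<Rightarrow> ('a, 'c) cw \<Rightarrow> ('a, 'c) cw \<Rightarrow> bool" where
  "homology_truncation X k T V \<longleftrightarrow>
     subcomplex V (skeleton X k) \<and> subcomplex T V \<and>
     (\<forall>j\<le>k. linear_iso (cw_homology V j :: (real, ('c \<Rightarrow> real) set) module)
              (cw_homology X j) (homology_map X j id))"

definition homology_truncation_data ::
  "('a, 'c) cw \<Rightarrow> (nat \<Rightarrow> ('a, 'c) cw) \<Rightarrow> (nat \<Rightarrow> ('a, 'c) cw) \<Rightarrow> bool" where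
  "homology_truncation_data X T V \<longleftrightarrow> (\<forall>k. homology_truncation X k (T k) (V k))"

section \<open>The constants\<close>

definition theta :: "('a, 'c) cw \<Rightarrow> nat \<Rightarrow> nat" where
  "theta Y k = (case k of 0 \<Rightarrow> 1
     | Suc j \<Rightarrow> card (torsion_elements (cw_homology Y j :: (int, ('c \<Rightarrow> int) set) module)))"

definition chi :: "('a, 'c) cw \<Rightarrow> (nat \<Rightarrow> ('c \<Rightarrow> real) set list) \<Rightarrow> ('a, 'c) cw \<Rightarrow> nat \<Rightarrow> real" where
  "chi X h V k = (THE x. \<exists>vs.
     module_basis (cw_homology V k :: (int, ('c \<Rightarrow> int) set) module) vs \<and>
     x = (Determinant.det (basis_matrix (cw_homology X k) (h k)
            (map (homology_map X k real_chain) vs)))\<^sup>2)"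

text \<open>$C_k(X/V; \mathbb{Z})$, for $k = 0$ read as $C_0(X, V; \mathbb{Z})$, and
  \<open>q_map X V k\<close> on $C_k(X; \mathbb{Z})$.\<close>

definition quotient_chains :: "('a, 'c) cw \<Rightarrow> ('a, 'c) cw \<Rightarrow> nat \<Rightarrow> (int, 'c \<Rightarrow> int) module" where
  "quotient_chains X V k = free_module (cw_cells X k - cw_cells V k)"

definition q_map :: "('a, 'c) cw \<Rightarrow> ('a, 'c) cw \<Rightarrow> nat \<Rightarrow> ('c \<Rightarrow> int) \<Rightarrow> 'c \<Rightarrow> int" where
  "q_map X V k c = (\<lambda>e. if e \<in> cw_cells X k - cw_cells V k then c e else 0)"

text \<open>$t(q_k)$ for $q_k \colon B_k(T; \mathbb{Z}) \to C_k(X/V; \mathbb{Z})$, where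
  $T = T^{k+1}$ and $V = V^k$.\<close>

definition coker_order :: "('a, 'c) cw \<Rightarrow> ('a, 'c) cw \<Rightarrow> ('a, 'c) cw \<Rightarrow> nat \<Rightarrow> nat" where
  "coker_order X T V k =
     card (carrier (quotient_module (quotient_chains X V k)
                     (q_map X V k ` carrier (cw_boundaries T k))))"

end

theory Submission
  imports Defs "HOL-Library.Function_Algebras"
begin

text \<open>
Fix a degree \<open>k\<close> and compute the determinant entering the torsion for the choices that the
trees and truncations offer: as a basis of $B_k$ take the boundaries of the cells of $T^{k+1}$, lift
a boundary to the unique chain of $T^k$ bounding it, and represent a homology class by the unique
cycle of $V^k$ in it. Replacing the basis $\mathfrak{h}_k$ by a $\mathbb{Z}$-basis of
$Z_k(V^k;\mathbb{Z}) = H_k(V^k;\mathbb{Z})$ multiplies the square of the determinant by $\chi_k$, and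
afterwards every column is an integral chain: the boundaries of the cells of $T^{k+1}$, a basis of
the cycles of $V^k$, and the cells of $T^k$ (\<open>adapted\<close>). So the determinant is, up to sign, the
index of the lattice $L$ that these columns span in $C_k(X;\mathbb{Z})$ (\<open>det_eq_index\<close>).

The index is found by pushing $L$ through two homomorphisms, since an index is the product of the
indices in the image and in the kernel (\<open>sub_index_hom\<close>). Projecting to $C_k(X/V^k)$ kills the
cycles of $V^k$ and the cells of $T^k$ and gives the factor $t(q_k)$; what remains is the index of
$Z_k(V^k) + C_k(T^k)$ in $C_k(V^k)$. Applying $\partial$ there turns it into the index of
$\partial C_k(T^k)$ in $\partial C_k(V^k)$, both inside $Z_{k-1}(X)$. These two lattices have the same
rank, hence the same saturation, and comparing them with it gives
$\theta_{T^k} / \theta_{V^k}$ (\<open>torsion_order_tree\<close>). Altogether the square of the determinant,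
multiplied by $\chi_k$, is $(t(q_k) \theta_{T^k} / \theta_{V^k})^2$ (\<open>adapted_det_sq\<close>).

The torsion is defined by a description over all choices, so its independence of them is part
of the claim. Another choice multiplies the square of the determinant in degree \<open>k\<close> by
$g_k g_{k-1}$, where $g_k$ compares the two bases of $B_k$, and the alternating product of these
factors telescopes to 1 (\<open>torsion_sq_unique\<close>).

Two further ingredients are needed. Topology enters through the cellular boundary, whose
coefficients are meaningful only because $H_k(X^{(k)}, X^{(k-1)})$ is free on the cells; this is
proved by excision, one cell at a time (\<open>characteristic_map_iso\<close>, \<open>cells_generate\<close>,
\<open>word_cells_inj\<close>), and gives $\partial\partial = 0$ and the compatibility of the incidence
numbers with subcomplexes. The passage between integral and real coefficients rests on
\<open>real_indep_if_int_indep\<close>: integral vectors that are independent over $\mathbb{Z}$ are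
independent over $\mathbb{R}$.
\<close>

section \<open>Discs and the radial stretching\<close>

definition radius :: "nat \<Rightarrow> (nat \<Rightarrow> real) \<Rightarrow> real" where
  "radius k x = sqrt (\<Sum>i<k. (x i)\<^sup>2)"

definition disc_points :: "nat \<Rightarrow> (nat \<Rightarrow> real) set" where
  "disc_points k = {x. (\<forall>i\<ge>k. x i = 0) \<and> radius k x \<le> 1}"

lemma Euclidean_space_eq_top_of_set: "Euclidean_space k = top_of_set {x. \<forall>i\<ge>k. x i = 0}"
  by (simp add: Euclidean_space_def euclidean_product_topology)

lemma disc_eq: "disc k = top_of_set (disc_points k)"
  unfolding disc_def Euclidean_space_eq_top_of_set subtopology_subtopology disc_points_def radius_def
  by (rule arg_cong[where f=top_of_set]) auto

lemma topspace_disc [simp]: "topspace (disc k) = disc_points k"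
  by (simp add: disc_eq)

lemma disc_sphere_eq: "disc_sphere k = {x \<in> disc_points k. radius k x = 1}"
  by (auto simp: disc_sphere_def disc_points_def radius_def topspace_Euclidean_space)

lemma open_disc_eq: "open_disc k = {x \<in> disc_points k. radius k x < 1}"
  by (auto simp: open_disc_def disc_points_def radius_def topspace_Euclidean_space)

lemma radius_nonneg [simp]: "0 \<le> radius k x"
  by (simp add: radius_def sum_nonneg)

lemma radius_scale: "radius k (\<lambda>i. x i / c) = radius k x / \<bar>c\<bar>"
  by (simp add: radius_def power_divide real_sqrt_divide flip: sum_divide_distrib)

lemma radius_scale': "radius k (\<lambda>i. c * x i) = \<bar>c\<bar> * radius k x"
  by (simp add: radius_def power_mult_distrib real_sqrt_mult flip: sum_distrib_left)

lemma continuous_on_radius [continuous_intros]: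
  assumes "continuous_on S f" shows "continuous_on S (\<lambda>x. radius k (f x))"
  unfolding radius_def
  by (intro continuous_intros continuous_on_product_then_coordinatewise[OF assms])

lemma compact_disc: "compact_space (disc k)"
proof -
  have "compactin (powertop_real UNIV) (PiE UNIV (\<lambda>_. {-1..1::real}))"
    by (subst compactin_PiE) simp
  then have "compact (PiE UNIV (\<lambda>_. {-1..1::real}) :: (nat \<Rightarrow> real) set)"
    by (simp add: euclidean_product_topology)
  moreover have "closed (disc_points k)"
  proof -
    have "disc_points k = (\<Inter>i\<in>{k..}. {x. x i = 0}) \<inter> {x. radius k x \<le> 1}"
      by (auto simp: disc_points_def)
    also have "closed \<dots>"
      by (intro closed_Int closed_INT ballI closed_Collect_eq closed_Collect_le continuous_intros) auto
    finally show ?thesis .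
  qed
  moreover have "disc_points k \<subseteq> PiE UNIV (\<lambda>_. {-1..1::real})"
  proof
    fix x assume x: "x \<in> disc_points k"
    have "\<bar>x i\<bar> \<le> 1" for i
    proof (cases "i < k")
      case True
      have "(x i)\<^sup>2 \<le> (\<Sum>i<k. (x i)\<^sup>2)"
        by (rule member_le_sum) (use True in auto)
      also have "\<dots> \<le> 1" using x by (auto simp: disc_points_def radius_def)
      finally show ?thesis by (simp add: abs_square_le_1)
    next
      case False
      then show ?thesis using x by (auto simp: disc_points_def)
    qed
    then show "x \<in> PiE UNIV (\<lambda>_. {-1..1::real})" by (auto simp: abs_le_iff minus_le_iff)
  qed
  ultimately have "compact (disc_points k)"
    by (metis compact_Int_closed inf.absorb2)
  then show ?thesis by (simp add: disc_eq compact_space_subtopology)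
qed

lemma contractible_disc: "contractible_space (disc k)"
proof -
  have "homotopic_with (\<lambda>x. True) (disc k) (disc k) id (\<lambda>x. (\<lambda>i. 0))"
    unfolding homotopic_with_def
  proof (intro exI conjI allI ballI)
    let ?h = "\<lambda>(t, x) i. (1 - t) * x i :: real"
    show "continuous_map (prod_topology (top_of_set {0..1}) (disc k)) (disc k) ?h"
      unfolding disc_eq
      apply (simp add: case_prod_unfold)
      apply (intro conjI continuous_on_coordinatewise_then_product continuous_intros)
       apply (rule continuous_on_product_then_coordinatewise)
       apply (intro continuous_intros)
      apply (auto simp: disc_points_def radius_scale' intro!: mult_le_one)
      done
  qed auto
  then show ?thesis unfolding contractible_space_def by blast
qed

text \<open>At time \<open>t\<close> the disc of radius \<open>1 - t / 2\<close> is scaled up to the whole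
disc, and everything outside it is pushed radially to the sphere. The sphere stays fixed, so the
deformation survives in a space to which the disc is attached along its sphere.\<close>

definition stretch :: "nat \<Rightarrow> real \<Rightarrow> (nat \<Rightarrow> real) \<Rightarrow> nat \<Rightarrow> real" where
  "stretch k t x = (\<lambda>i. x i / max (radius k x) (1 - t / 2))"

lemma radius_stretch: "radius k (stretch k t x) = radius k x / \<bar>max (radius k x) (1 - t / 2)\<bar>"
  by (simp add: stretch_def radius_scale)

lemma stretch_in_disc:
  assumes "x \<in> disc_points k" "t \<in> {0..1}" shows "stretch k t x \<in> disc_points k"
proof -
  have "radius k x / \<bar>max (radius k x) (1 - t / 2)\<bar> \<le> 1"
    using assms(2) by (auto simp: divide_le_eq)
  then show ?thesis using assms by (auto simp: disc_points_def radius_stretch) (auto simp: stretch_def)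
qed

lemma continuous_stretch:
  "continuous_map (prod_topology (top_of_set {0..1}) (disc k)) (disc k) (\<lambda>(t, x). stretch k t x)"
proof -
  have snd: "continuous_on ({0..1::real} \<times> disc_points k) (\<lambda>p. snd p i)" for i
    by (rule continuous_on_product_then_coordinatewise) (intro continuous_intros)
  have "continuous_on ({0..1} \<times> disc_points k) (\<lambda>p. stretch k (fst p) (snd p))"
    unfolding stretch_def
    by (intro continuous_on_coordinatewise_then_product continuous_intros snd) (auto simp: max_def)
  then show ?thesis
    unfolding disc_eq using stretch_in_disc by (auto simp: case_prod_unfold)
qed

lemma stretch_0: "x \<in> disc_points k \<Longrightarrow> stretch k 0 x = x"
  by (auto simp: stretch_def disc_points_def max_def)

lemma stretch_sphere: "x \<in> disc_sphere k \<Longrightarrow> t \<in> {0..1} \<Longrightarrow> stretch k t x = x"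
  by (auto simp: stretch_def disc_sphere_eq max_def)

text \<open>The open neighbourhood of the sphere that is pushed onto the sphere at time 1; this is why the
radius is \<open>1 / 2\<close>.\<close>

definition collar :: "nat \<Rightarrow> (nat \<Rightarrow> real) set" where
  "collar k = {x \<in> disc_points k. radius k x > 1 / 2}"

lemma disc_sphere_collar: "disc_sphere k \<subseteq> collar k"
  by (auto simp: disc_sphere_eq collar_def)

lemma stretch_collar:
  assumes "x \<in> collar k" "t \<in> {0..1}" shows "stretch k t x \<in> collar k"
proof -
  have "radius k x / \<bar>max (radius k x) (1 - t / 2)\<bar> > 1/2"
    using assms by (auto simp: collar_def disc_points_def max_def field_simps)
  then show ?thesis using assms stretch_in_disc by (auto simp: collar_def radius_stretch)
qed

lemma stretch_collar_1:
  assumes "x \<in> collar k" shows "stretch k 1 x \<in> disc_sphere k"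
proof -
  have "radius k x / \<bar>max (radius k x) (1 - 1 / 2)\<bar> = 1"
    using assms by (auto simp: collar_def max_def)
  then show ?thesis using assms stretch_in_disc[of x k 1] by (auto simp: disc_sphere_eq collar_def radius_stretch)
qed

lemma openin_collar: "openin (disc k) (collar k)"
proof -
  have "collar k = disc_points k \<inter> {x. radius k x > 1/2}" by (auto simp: collar_def)
  also have "openin (top_of_set (disc_points k)) \<dots>"
    by (intro openin_open_Int open_Collect_less continuous_intros) auto
  finally show ?thesis by (simp add: disc_eq)
qed

lemma closedin_disc_sphere: "closedin (disc k) (disc_sphere k)"
proof -
  have "disc_sphere k = disc_points k \<inter> {x. radius k x = 1}" by (auto simp: disc_sphere_eq)
  also have "closedin (top_of_set (disc_points k)) \<dots>"
    by (intro closedin_closed_Int closed_Collect_eq continuous_intros) auto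
  finally show ?thesis by (simp add: disc_eq)
qed

lemma disc_points_Un: "disc_points k = open_disc k \<union> disc_sphere k"
  by (auto simp: open_disc_eq disc_sphere_eq disc_points_def)

lemma open_disc_Int_sphere: "open_disc k \<inter> disc_sphere k = {}"
  by (auto simp: open_disc_eq disc_sphere_eq)

lemma disc_sphere_0: "disc_sphere 0 = {}" by (auto simp: disc_sphere_eq radius_def)

lemma disc_sphere_Suc: "subtopology (disc (Suc n)) (disc_sphere (Suc n)) = nsphere n"
proof -
  have "disc_points (Suc n) \<inter> disc_sphere (Suc n) = {x. (\<Sum>i\<le>n. (x i)\<^sup>2) = 1 \<and> (\<forall>i>n. x i = 0)}"
    by (auto simp: disc_sphere_eq disc_points_def radius_def lessThan_Suc_atMost)
  then show ?thesis
    by (simp add: nsphere disc_eq subtopology_subtopology euclidean_product_topology)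
qed

text \<open>The disc is contractible, so the exact sequence of the pair reduces the claim to the reduced
homology of the sphere. In dimension 0 the sphere is empty and the disc is a point.\<close>

lemma relative_homology_disc: "relative_homology_group (int k) (disc k) (disc_sphere k) \<cong> integer_group"
proof (cases k)
  case 0
  have "topspace (disc 0) = {\<lambda>_. 0}" by (auto simp: disc_points_def radius_def)
  then have "homology_group 0 (disc 0) \<cong> integer_group" by (rule homology_coefficients)
  then show ?thesis using 0 by (simp add: disc_sphere_0)
next
  case (Suc n)
  have "(\<lambda>i. if i = 0 then 1 else 0) \<in> topspace (disc k) \<inter> disc_sphere k"
    by (auto simp: disc_sphere_eq disc_points_def radius_def Suc if_distrib[of "\<lambda>x. x\<^sup>2"] cong: if_cong)
  then have "relative_homology_group (int k) (disc k) (disc_sphere k) \<cong>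
      reduced_homology_group (int k - 1) (subtopology (disc k) (disc_sphere k))"
    by (intro isomorphic_group_relative_homology_of_contractible contractible_disc) auto
  also have "\<dots> \<cong> integer_group"
    using reduced_homology_group_nsphere(1)[of n] by (simp add: Suc disc_sphere_Suc)
  finally show ?thesis by simp
qed

abbreviation disc_group where "disc_group k \<equiv> relative_homology_group (int k) (disc k) (disc_sphere k)"

lemma disc_group_generator:
  obtains h where "h \<in> iso integer_group (disc_group k)" "carrier (disc_group k) = range h"
    "\<And>n::int. h n = h 1 [^]\<^bsub>disc_group k\<^esub> n"
proof -
  obtain h where h: "h \<in> iso integer_group (disc_group k)"
    using relative_homology_disc[of k] group.iso_sym[of "disc_group k" integer_group]
    by (auto simp: is_iso_def)
  interpret h: group_hom integer_group "disc_group k" h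
    using h by (simp add: group_hom_def group_hom_axioms_def iso_def)
  have "h n = h 1 [^]\<^bsub>disc_group k\<^esub> n" for n
    using h.hom_int_pow[of 1 n] by simp
  moreover have "carrier (disc_group k) = range h"
    using h by (auto simp: iso_def bij_betw_def)
  ultimately show ?thesis using that h by blast
qed

lemma disc_class_generates:
  "disc_class k \<in> carrier (disc_group k)"
  "subgroup_generated (disc_group k) {disc_class k} = disc_group k"
proof -
  interpret G: group "disc_group k" by simp
  obtain h where car: "carrier (disc_group k) = range h" and hp: "\<And>n::int. h n = h 1 [^]\<^bsub>disc_group k\<^esub> n"
    by (rule disc_group_generator[of k]) (rule that)
  have "\<exists>a. a \<in> carrier (disc_group k) \<and> subgroup_generated (disc_group k) {a} = disc_group k"
  proof (intro exI conjI)
    show "h 1 \<in> carrier (disc_group k)" by (simp add: car)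
    then have "carrier (subgroup_generated (disc_group k) {h 1}) = carrier (disc_group k)"
      unfolding G.carrier_subgroup_generated_by_singleton[OF \<open>h 1 \<in> _\<close>] car
      by (auto simp flip: hp)
    then show "subgroup_generated (disc_group k) {h 1} = disc_group k"
      by (simp add: subgroup_generated_def)
  qed
  then show "disc_class k \<in> carrier (disc_group k)"
    "subgroup_generated (disc_group k) {disc_class k} = disc_group k"
    unfolding disc_class_def by (smt (verit, best) someI_ex)+
qed

text \<open>If \<open>disc_class k\<close> has exponent \<open>u\<close> with respect to some generator, then
\<open>u\<close> is a unit, because the class generates as well; so its powers run through the
group without repetition.\<close>

lemma pow_disc_class_iso: "(\<lambda>n::int. disc_class k [^]\<^bsub>disc_group k\<^esub> n) \<in> iso integer_group (disc_group k)"
proof -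
  note a = disc_class_generates[of k]
  interpret G: group "disc_group k" by simp
  obtain h where h: "h \<in> iso integer_group (disc_group k)" and car: "carrier (disc_group k) = range h"
    and hp: "\<And>n::int. h n = h 1 [^]\<^bsub>disc_group k\<^esub> n"
    by (rule disc_group_generator[of k]) (rule that)
  have surj: "range (\<lambda>n::int. disc_class k [^]\<^bsub>disc_group k\<^esub> n) = carrier (disc_group k)"
    using G.carrier_subgroup_generated_by_singleton[OF a(1)] a(2) by auto
  obtain u where u: "disc_class k = h u" using a(1) car by auto
  have dp: "disc_class k [^]\<^bsub>disc_group k\<^esub> n = h (u * n)" for n :: int
    unfolding u hp[of u] hp[of "u * n"] using G.int_pow_pow[of "h 1"] car by simp
  have "h 1 \<in> range (\<lambda>n::int. disc_class k [^]\<^bsub>disc_group k\<^esub> n)" unfolding surj car by simp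
  then obtain v :: int where "disc_class k [^]\<^bsub>disc_group k\<^esub> v = h 1" by auto
  then have "h (u * v) = h 1" by (simp add: dp)
  then have uv: "u * v = 1" using h by (auto simp: iso_def bij_betw_def inj_on_def)
  have u0: "u \<noteq> 0" using uv by auto
  have "inj (\<lambda>n::int. disc_class k [^]\<^bsub>disc_group k\<^esub> n)"
    unfolding dp using h u0 by (auto simp: iso_def bij_betw_def inj_on_def) (metis mult_cancel_left)
  moreover have "(\<lambda>n::int. disc_class k [^]\<^bsub>disc_group k\<^esub> n) \<in> hom integer_group (disc_group k)"
    using a(1) G.int_pow_mult by (auto simp: hom_def)
  ultimately show ?thesis using surj by (simp add: iso_def bij_betw_def)
qed

section \<open>Attaching one cell\<close>

text \<open>A space \<open>Y\<close> obtained from its closed subset \<open>A\<close> by attaching one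
\<open>k\<close>-cell. That \<open>Y\<close> carries the quotient topology follows from the
Hausdorff property and the compactness of the disc, which make the characteristic map closed.\<close>

locale cell_attachment =
  fixes Y :: "'a topology" and A :: "'a set" and k :: nat and \<phi> :: "(nat \<Rightarrow> real) \<Rightarrow> 'a"
  assumes Hausdorff: "Hausdorff_space Y"
    and closed_A: "closedin Y A"
    and cont: "continuous_map (disc k) Y \<phi>"
    and inj: "inj_on \<phi> (open_disc k)"
    and sphere: "\<phi> ` disc_sphere k \<subseteq> A"
    and disjoint: "\<phi> ` open_disc k \<inter> A = {}"
    and cover: "topspace Y = A \<union> \<phi> ` open_disc k"
begin

lemma mem_A_iff: "x \<in> disc_points k \<Longrightarrow> \<phi> x \<in> A \<longleftrightarrow> x \<in> disc_sphere k"
  using sphere disjoint by (auto simp: disc_points_Un)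

lemma closed_map: "closed_map (disc k) Y \<phi>"
  by (rule continuous_imp_closed_map[OF cont compact_disc Hausdorff])

lemma image_in_space: "x \<in> disc_points k \<Longrightarrow> \<phi> x \<in> topspace Y"
  using cont by (auto simp: continuous_map_def)

text \<open>The stretching of the disc, carried over to \<open>Y\<close>. It is at rest on \<open>A\<close>,
in agreement with the formula on the cell, since the stretching fixes the sphere.\<close>

definition flow :: "real \<times> 'a \<Rightarrow> 'a" where
  "flow p = (if snd p \<in> A then snd p else \<phi> (stretch k (fst p) (inv_into (open_disc k) \<phi> (snd p))))"

lemma flow_A: "y \<in> A \<Longrightarrow> flow (t, y) = y"
  by (simp add: flow_def)

lemma flow_cell:
  assumes "x \<in> disc_points k" "t \<in> {0..1}" shows "flow (t, \<phi> x) = \<phi> (stretch k t x)"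
proof (cases "x \<in> disc_sphere k")
  case True
  then show ?thesis using assms by (simp add: flow_def mem_A_iff stretch_sphere)
next
  case False
  then have "x \<in> open_disc k" using assms by (simp add: disc_points_Un)
  then show ?thesis using False assms by (simp add: flow_def mem_A_iff inv_into_f_f[OF inj])
qed

lemma point_cases: "y \<in> topspace Y \<Longrightarrow> (y \<in> A \<Longrightarrow> P) \<Longrightarrow> (\<And>x. x \<in> disc_points k \<Longrightarrow> y = \<phi> x \<Longrightarrow> P) \<Longrightarrow> P"
  using cover by (auto simp: disc_points_Un)

abbreviation "I01 \<equiv> top_of_set {0..1::real}"

text \<open>The space \<open>Y\<close> is the union of the closed sets \<open>A\<close> and the closed cell.
On the latter, continuity is checked after pulling back to $[0,1] \times D^k$, which is a quotient
map onto its image as a continuous map from a compact to a Hausdorff space.\<close>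

lemma continuous_flow: "continuous_map (prod_topology I01 Y) Y flow"
proof -
  let ?P = "prod_topology I01 Y"
  let ?C = "\<phi> ` disc_points k"
  have clC: "closedin Y ?C"
    using closed_map closedin_topspace[of "disc k"] unfolding closed_map_def by simp
  have hA: "continuous_map (subtopology ?P ({0..1} \<times> A)) Y flow"
  proof (rule continuous_map_eq)
    show "continuous_map (subtopology ?P ({0..1} \<times> A)) Y snd"
      by (intro continuous_map_from_subtopology continuous_map_snd)
  qed (auto simp: flow_def)
  have hC: "continuous_map (subtopology ?P ({0..1} \<times> ?C)) Y flow"
  proof -
    let ?q = "\<lambda>(t, x). (t, \<phi> x)"
    have cq: "continuous_map (prod_topology I01 (disc k)) ?P ?q"
      using cont by (simp add: continuous_map_prod_top)
    then have cq': "continuous_map (prod_topology I01 (disc k)) (subtopology ?P ({0..1} \<times> ?C)) ?q"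
      by (auto simp: continuous_map_in_subtopology)
    have "quotient_map (prod_topology I01 (disc k)) (subtopology ?P ({0..1} \<times> ?C)) ?q"
    proof (rule continuous_closed_imp_quotient_map[OF cq'])
      show "closed_map (prod_topology I01 (disc k)) (subtopology ?P ({0..1} \<times> ?C)) ?q"
      proof (rule continuous_imp_closed_map[OF cq'])
        show "compact_space (prod_topology I01 (disc k))"
          by (simp add: compact_space_prod_topology compact_disc compact_space_subtopology)
        show "Hausdorff_space (subtopology ?P ({0..1} \<times> ?C))"
          by (simp add: Hausdorff_space_subtopology Hausdorff_space_prod_topology Hausdorff Hausdorff_space_euclidean)
      qed
      show "?q ` topspace (prod_topology I01 (disc k)) = topspace (subtopology ?P ({0..1} \<times> ?C))"
        using image_in_space by force
    qed
    moreover have "continuous_map (prod_topology I01 (disc k)) Y (flow \<circ> ?q)"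
    proof (rule continuous_map_eq)
      show "continuous_map (prod_topology I01 (disc k)) Y (\<phi> \<circ> (\<lambda>(t, x). stretch k t x))"
        by (rule continuous_map_compose[OF continuous_stretch cont])
    qed (auto simp: flow_cell)
    ultimately show ?thesis by (rule continuous_compose_quotient_map)
  qed
  show ?thesis
  proof (rule pasting_lemma_closed[where I=UNIV and f="\<lambda>_. flow" and T="\<lambda>b. {0..1} \<times> (if b then A else ?C)"])
    fix b :: bool
    show "closedin ?P ({0..1} \<times> (if b then A else ?C))"
      using clC closed_A closedin_topspace[of I01] by (auto simp: closedin_prod_Times_iff)
    show "continuous_map (subtopology ?P ({0..1} \<times> (if b then A else ?C))) Y flow"
      using hA hC by auto
  next
    fix p assume "p \<in> topspace ?P"
    then have p: "fst p \<in> {0..1}" "snd p \<in> topspace Y" by auto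
    then have "snd p \<in> A \<or> snd p \<in> ?C" using cover by (auto simp: disc_points_Un)
    then show "\<exists>j. j \<in> UNIV \<and> p \<in> {0..1} \<times> (if j then A else ?C) \<and> flow p = flow p"
      using p(1) by (intro exI[of _ "snd p \<in> A"]) (auto simp: mem_Times_iff)
  qed auto
qed

definition "nbhd = A \<union> \<phi> ` collar k"

lemma flow_0: "y \<in> topspace Y \<Longrightarrow> flow (0, y) = y"
  by (erule point_cases) (auto simp: flow_A flow_cell stretch_0)

lemma nbhd_subset: "nbhd \<subseteq> topspace Y"
  using closedin_subset[OF closed_A] image_in_space by (auto simp: nbhd_def collar_def)

lemma collar_point: "x \<in> collar k \<Longrightarrow> x \<in> disc_points k"
  by (simp add: collar_def)

lemma flow_nbhd: "t \<in> {0..1} \<Longrightarrow> y \<in> nbhd \<Longrightarrow> flow (t, y) \<in> nbhd"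
  by (auto simp: nbhd_def flow_A flow_cell stretch_collar collar_point)

lemma flow_nbhd_1: "y \<in> nbhd \<Longrightarrow> flow (1, y) \<in> A"
  using sphere stretch_collar_1 by (auto simp: nbhd_def flow_A flow_cell collar_point)

text \<open>The flow runs from the identity to its value at time 1, and it does so as a map of pairs for every
set that it preserves.\<close>

lemma homotopic_flow:
  assumes "\<And>t y. t \<in> {0..1} \<Longrightarrow> y \<in> S \<Longrightarrow> flow (t, y) \<in> S" and S: "S \<subseteq> topspace Y"
  shows "homotopic_with (\<lambda>h. h \<in> S \<rightarrow> S) Y Y (\<lambda>y. flow (1, y)) id"
proof -
  have "homotopic_with (\<lambda>h. h \<in> S \<rightarrow> S) Y Y id (\<lambda>y. flow (1, y))"
  proof (subst homotopic_with)
    show "\<exists>h. continuous_map (prod_topology I01 Y) Y h \<and>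
        (\<forall>x\<in>topspace Y. h (0, x) = id x) \<and> (\<forall>x\<in>topspace Y. h (1, x) = flow (1, x)) \<and>
        (\<forall>t\<in>{0..1}. (\<lambda>x. h (t, x)) \<in> S \<rightarrow> S)"
      using continuous_flow flow_0 assms by (intro exI[of _ flow]) auto
    show "(h \<in> S \<rightarrow> S) = (k \<in> S \<rightarrow> S)" if "\<And>x. x \<in> topspace Y \<Longrightarrow> h x = k x" for h k
      using that S by (auto simp: Pi_iff subset_iff)
  qed
  then show ?thesis by (rule homotopic_with_symD)
qed

lemma continuous_flow_1: "continuous_map Y Y (\<lambda>y. flow (1, y))"
proof -
  have "continuous_map Y (prod_topology I01 Y) (\<lambda>y. (1, y))"
    by (auto simp: continuous_map_pairedI)
  from continuous_map_compose[OF this continuous_flow] show ?thesis by (simp add: o_def)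
qed

text \<open>Flowing to time 1 is a homotopy inverse of the inclusion of pairs.\<close>

lemma iso_nbhd: "hom_induced p Y A Y nbhd id \<in> iso (relative_homology_group p Y A) (relative_homology_group p Y nbhd)"
proof (rule homotopy_equivalence_relative_homology_group_isomorphism)
  show "homotopic_with (\<lambda>h. h \<in> A \<rightarrow> A) Y Y ((\<lambda>y. flow (1, y)) \<circ> id) id"
    using homotopic_flow[of A] closedin_subset[OF closed_A] by (simp add: flow_A)
  show "homotopic_with (\<lambda>h. h \<in> nbhd \<rightarrow> nbhd) Y Y (id \<circ> (\<lambda>y. flow (1, y))) id"
    using homotopic_flow[of nbhd] nbhd_subset by (simp add: flow_nbhd)
qed (use continuous_flow_1 flow_nbhd_1 in \<open>auto simp: nbhd_def\<close>)

lemma openin_nbhd: "openin Y nbhd"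
proof -
  have "topspace Y - nbhd = \<phi> ` (disc_points k - collar k)"
  proof
    show "topspace Y - nbhd \<subseteq> \<phi> ` (disc_points k - collar k)"
      using cover by (auto simp: nbhd_def disc_points_Un)
    have "\<phi> x \<notin> nbhd" if x: "x \<in> disc_points k - collar k" for x
    proof
      assume "\<phi> x \<in> nbhd"
      then consider "\<phi> x \<in> A" | y where "y \<in> collar k" "\<phi> x = \<phi> y" by (auto simp: nbhd_def)
      then show False
      proof cases
        case 1
        then show ?thesis using x disc_sphere_collar by (auto simp: mem_A_iff)
      next
        case 2
        have "x \<in> open_disc k" using x disc_sphere_collar by (auto simp: disc_points_Un)
        moreover have "y \<in> open_disc k"
        proof (rule ccontr)
          assume "y \<notin> open_disc k"
          then have "\<phi> y \<in> A" using collar_point[OF 2(1)] mem_A_iff[of y] by (simp add: disc_points_Un)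
          then have "x \<in> disc_sphere k" using 2(2) x mem_A_iff[of x] by simp
          then show False using x disc_sphere_collar by auto
        qed
        ultimately have "x = y" using inj 2(2) by (simp add: inj_on_def)
        then show ?thesis using 2 x by simp
      qed
    qed
    then show "\<phi> ` (disc_points k - collar k) \<subseteq> topspace Y - nbhd" using image_in_space by auto
  qed
  moreover have "closedin Y (\<phi> ` (disc_points k - collar k))"
    using closed_map openin_collar unfolding closed_map_def
    by (metis closedin_diff closedin_topspace topspace_disc)
  ultimately show ?thesis using nbhd_subset by (simp add: openin_closedin)
qed

abbreviation "cut_disc \<equiv> subtopology (disc k) (topspace (disc k) - disc_sphere k)"
abbreviation "cut_space \<equiv> subtopology Y (topspace Y - A)"

lemma topspace_cut: "topspace cut_disc = open_disc k" "topspace cut_space = \<phi> ` open_disc k"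
  using cover disjoint open_disc_Int_sphere by (auto simp: disc_points_Un)

text \<open>What is left after cutting out \<open>A\<close> is the open cell, and the closed map
\<open>\<phi>\<close> restricts to a homeomorphism from the open disc onto it.\<close>

lemma homeomorphic_cell: "homeomorphic_map cut_disc cut_space \<phi>"
proof -
  have "{x \<in> topspace (disc k). \<phi> x \<in> topspace Y - A} = topspace (disc k) - disc_sphere k"
    using image_in_space by (auto simp: mem_A_iff)
  then have "closed_map cut_disc cut_space \<phi>"
    using closed_map_restriction[OF closed_map] by blast
  moreover have "continuous_map cut_disc cut_space \<phi>"
    using cont image_in_space mem_A_iff
    by (auto simp: continuous_map_in_subtopology continuous_map_from_subtopology)
  ultimately show ?thesis
    using inj by (intro bijective_closed_imp_homeomorphic_map) (simp_all only: topspace_cut)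
qed

lemma iso_cut_disc:
  "hom_induced p cut_disc (collar k - disc_sphere k) (disc k) (collar k) id
     \<in> iso (relative_homology_group p cut_disc (collar k - disc_sphere k)) (relative_homology_group p (disc k) (collar k))"
proof -
  have "disc k closure_of disc_sphere k \<subseteq> disc k interior_of collar k"
    using disc_sphere_collar closedin_disc_sphere openin_collar by (simp add: closure_of_closedin interior_of_openin)
  moreover have "collar k \<subseteq> topspace (disc k)" by (auto simp: collar_def)
  ultimately show ?thesis using homology_excision_axiom[of "disc k" "disc_sphere k" "collar k" "topspace (disc k)" p]
    by (simp only: subtopology_topspace)
qed

lemma iso_cut_space:
  "hom_induced p cut_space (nbhd - A) Y nbhd id
     \<in> iso (relative_homology_group p cut_space (nbhd - A)) (relative_homology_group p Y nbhd)"
proof -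
  have "Y closure_of A \<subseteq> Y interior_of nbhd"
    using closed_A openin_nbhd by (simp add: closure_of_closedin interior_of_openin nbhd_def)
  then show ?thesis using homology_excision_axiom[of Y A nbhd "topspace Y" p] nbhd_subset
    by (simp only: subtopology_topspace)
qed

end

text \<open>The disc itself arises from its sphere by attaching a cell; so what has been shown for
\<open>Y\<close> also applies to the source of the characteristic map.\<close>

lemma disc_attachment: "cell_attachment (disc k) (disc_sphere k) k id"
proof
  show "Hausdorff_space (disc k)"
    by (simp add: disc_eq Hausdorff_space_euclidean Hausdorff_space_subtopology)
qed (use open_disc_Int_sphere disc_points_Un closedin_disc_sphere in auto)

lemma iso_collar: "hom_induced p (disc k) (disc_sphere k) (disc k) (collar k) id
    \<in> iso (relative_homology_group p (disc k) (disc_sphere k)) (relative_homology_group p (disc k) (collar k))"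
proof -
  interpret D: cell_attachment "disc k" "disc_sphere k" k id by (rule disc_attachment)
  have "D.nbhd = collar k" using disc_sphere_collar by (auto simp: D.nbhd_def)
  then show ?thesis using D.iso_nbhd by simp
qed

lemma iso_if_comp_iso:
  assumes "group G" "group H" "group K"
    and f: "f \<in> hom G H" and g: "g \<in> iso H K" and gf: "\<And>x. x \<in> carrier G \<Longrightarrow> g (f x) = e x" and e: "e \<in> iso G K"
  shows "f \<in> iso G H"
proof -
  have "bij_betw f (carrier G) (carrier H)"
  proof (rule bij_betwI')
    fix x y assume "x \<in> carrier G" "y \<in> carrier G"
    moreover have "inj_on e (carrier G)" using e by (auto simp: iso_def bij_betw_def)
    ultimately show "(f x = f y) = (x = y)" using gf by (metis inj_onD)
  next
    fix x assume "x \<in> carrier G" then show "f x \<in> carrier H" using f by (auto simp: hom_def)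
  next
    fix y assume y: "y \<in> carrier H"
    then have "g y \<in> e ` carrier G" using e g by (auto simp: iso_def bij_betw_def)
    then obtain x where x: "x \<in> carrier G" "g y = e x" by auto
    then have "g y = g (f x)" "f x \<in> carrier H" using gf f by (auto simp: hom_def)
    then show "\<exists>x\<in>carrier G. y = f x" using x(1) y g by (auto simp: iso_def bij_betw_def inj_on_def)
  qed
  then show ?thesis using f by (simp add: iso_def)
qed

lemma iso_of_comp_iso:
  assumes f: "f \<in> hom H K" and g: "g \<in> iso G H" and gf: "\<And>x. x \<in> carrier G \<Longrightarrow> f (g x) = e x" and e: "e \<in> iso G K"
  shows "f \<in> iso H K"
proof -
  have g': "g ` carrier G = carrier H" "inj_on g (carrier G)" using g by (auto simp: iso_def bij_betw_def)
  have e': "e ` carrier G = carrier K" "inj_on e (carrier G)" using e by (auto simp: iso_def bij_betw_def)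
  have "inj_on f (carrier H)"
    unfolding g'(1)[symmetric] using gf e'(2) by (auto simp: inj_on_def)
  moreover have "f ` carrier H = carrier K"
    unfolding g'(1)[symmetric] e'(1)[symmetric] using gf by (force simp: image_iff)
  ultimately show ?thesis using f by (simp add: iso_def bij_betw_def)
qed

text \<open>Both pairs are replaced by pairs with an open collar and then the closed subset is excised. On
what remains, the open disc relative to its collar, the characteristic map is a homeomorphism.\<close>

theorem (in cell_attachment) characteristic_map_iso:
  "hom_induced p (disc k) (disc_sphere k) Y A \<phi>
     \<in> iso (relative_homology_group p (disc k) (disc_sphere k)) (relative_homology_group p Y A)"
proof -
  have im: "\<phi> \<in> disc_sphere k \<rightarrow> A" "\<phi> \<in> collar k \<rightarrow> nbhd" "\<phi> \<in> collar k - disc_sphere k \<rightarrow> nbhd - A"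
    using sphere by (auto simp: nbhd_def mem_A_iff collar_point)
  have "\<phi> ` (collar k - disc_sphere k) = nbhd - A"
    using sphere by (auto simp: nbhd_def mem_A_iff collar_point)
  then have hom: "hom_induced p cut_disc (collar k - disc_sphere k) cut_space (nbhd - A) \<phi>
      \<in> iso (relative_homology_group p cut_disc (collar k - disc_sphere k)) (relative_homology_group p cut_space (nbhd - A))"
    by (intro homeomorphic_map_relative_homology_iso homeomorphic_cell) (auto simp: collar_point)
  have cut: "continuous_map cut_disc cut_space \<phi>"
    using homeomorphic_cell by (simp add: homeomorphic_imp_continuous_map)
  \<comment> \<open>the square of excisions on the two sides\<close>
  have mid: "hom_induced p (disc k) (collar k) Y nbhd \<phi>
      \<in> iso (relative_homology_group p (disc k) (collar k)) (relative_homology_group p Y nbhd)"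
  proof (rule iso_of_comp_iso[OF hom_induced_hom iso_cut_disc])
    show "(hom_induced p cut_space (nbhd - A) Y nbhd id \<circ> hom_induced p cut_disc (collar k - disc_sphere k) cut_space (nbhd - A) \<phi>)
       \<in> iso (relative_homology_group p cut_disc (collar k - disc_sphere k)) (relative_homology_group p Y nbhd)"
      by (rule iso_set_trans[OF hom iso_cut_space])
    fix x
    have "hom_induced p (disc k) (collar k) Y nbhd \<phi> (hom_induced p cut_disc (collar k - disc_sphere k) (disc k) (collar k) id x)
       = hom_induced p cut_disc (collar k - disc_sphere k) Y nbhd (\<phi> \<circ> id) x"
      by (rule hom_induced_compose') (use im cont in \<open>auto simp: continuous_map_from_subtopology\<close>)
    also have "\<dots> = hom_induced p cut_space (nbhd - A) Y nbhd id (hom_induced p cut_disc (collar k - disc_sphere k) cut_space (nbhd - A) \<phi> x)"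
      using hom_induced_compose'[OF cut im(3), of Y id nbhd p x] by (simp add: continuous_map_from_subtopology Pi_def)
    finally show "hom_induced p (disc k) (collar k) Y nbhd \<phi> (hom_induced p cut_disc (collar k - disc_sphere k) (disc k) (collar k) id x)
       = (hom_induced p cut_space (nbhd - A) Y nbhd id \<circ> hom_induced p cut_disc (collar k - disc_sphere k) cut_space (nbhd - A) \<phi>) x"
      by simp
  qed
  show ?thesis
  proof (rule iso_if_comp_iso[OF _ _ _ hom_induced_hom iso_nbhd])
    show "(hom_induced p (disc k) (collar k) Y nbhd \<phi> \<circ> hom_induced p (disc k) (disc_sphere k) (disc k) (collar k) id)
      \<in> iso (relative_homology_group p (disc k) (disc_sphere k)) (relative_homology_group p Y nbhd)"
      by (rule iso_set_trans[OF iso_collar mid])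
    fix x
    have "hom_induced p Y A Y nbhd id (hom_induced p (disc k) (disc_sphere k) Y A \<phi> x)
       = hom_induced p (disc k) (disc_sphere k) Y nbhd (id \<circ> \<phi>) x"
      by (rule hom_induced_compose') (use im cont in \<open>auto simp: nbhd_def\<close>)
    also have "\<dots> = hom_induced p (disc k) (collar k) Y nbhd \<phi> (hom_induced p (disc k) (disc_sphere k) (disc k) (collar k) id x)"
      using hom_induced_compose'[OF _ _ cont im(2), of "disc k" id "disc_sphere k" p x] disc_sphere_collar[of k]
      by (simp add: Pi_def subset_iff)
    finally show "hom_induced p Y A Y nbhd id (hom_induced p (disc k) (disc_sphere k) Y A \<phi> x)
       = (hom_induced p (disc k) (collar k) Y nbhd \<phi> \<circ> hom_induced p (disc k) (disc_sphere k) (disc k) (collar k) id) x"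
      by simp
  qed auto
qed

section \<open>The group of cellular chains\<close>

text \<open>A word in the elements \<open>g e\<close>. Homology groups are multiplicative here, so this is the
integral combination with coefficients \<open>n\<close>; the cellular boundary is defined by such
an expression.\<close>

definition word :: "('g, 'm) monoid_scheme \<Rightarrow> ('c \<Rightarrow> 'g) \<Rightarrow> 'c set \<Rightarrow> ('c \<Rightarrow> int) \<Rightarrow> 'g" where
  "word G g F n = (\<Otimes>\<^bsub>G\<^esub>e\<in>F. g e [^]\<^bsub>G\<^esub> n e)"

lemma word_insert:
  assumes "comm_group G" "finite F" "e \<notin> F" "g \<in> insert e F \<rightarrow> carrier G"
  shows "word G g (insert e F) n = g e [^]\<^bsub>G\<^esub> n e \<otimes>\<^bsub>G\<^esub> word G g F n"
proof -
  interpret comm_group G by fact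
  show ?thesis unfolding word_def using assms by (subst finprod_insert) auto
qed

lemma word_empty: "comm_group G \<Longrightarrow> word G g {} n = \<one>\<^bsub>G\<^esub>"
  by (simp add: word_def comm_monoid.finprod_empty comm_group.axioms)

lemma word_closed:
  assumes "comm_group G" "g \<in> F \<rightarrow> carrier G" shows "word G g F n \<in> carrier G"
proof -
  interpret comm_group G by fact
  show ?thesis unfolding word_def using assms by (intro finprod_closed) auto
qed

lemma word_cong:
  assumes "comm_group G" "g \<in> F \<rightarrow> carrier G" "\<And>e. e \<in> F \<Longrightarrow> g e = g' e" "\<And>e. e \<in> F \<Longrightarrow> n e = n' e"
  shows "word G g F n = word G g' F n'"
proof -
  interpret comm_group G by fact
  show ?thesis unfolding word_def
  proof (rule finprod_cong')
    show "(\<lambda>e. g' e [^]\<^bsub>G\<^esub> n' e) \<in> F \<rightarrow> carrier G"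
      using assms(2,3) by (auto simp: Pi_iff)
  qed (use assms in auto)
qed

lemma word_hom:
  assumes "comm_group G" "comm_group H" "h \<in> hom G H" "finite F" "g \<in> F \<rightarrow> carrier G"
  shows "h (word G g F n) = word H (\<lambda>e. h (g e)) F n"
proof -
  interpret G: comm_group G by fact
  interpret H: comm_group H by fact
  interpret h: group_hom G H h using assms by unfold_locales
  show ?thesis using assms(4,5)
  proof (induction F)
    case (insert e F)
    then show ?case using word_closed[of G g F n] assms(1,2)
      by (simp add: word_insert h.hom_int_pow Pi_iff)
  qed (simp add: word_empty assms)
qed

lemma word_single:
  assumes "comm_group G" "finite F" "g \<in> F \<rightarrow> carrier G" "e \<in> F" "\<And>f. f \<in> F \<Longrightarrow> f \<noteq> e \<Longrightarrow> g f = \<one>\<^bsub>G\<^esub>"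
  shows "word G g F n = g e [^]\<^bsub>G\<^esub> n e"
proof -
  interpret comm_group G by fact
  have "word G g F n = word G g (insert e (F - {e})) n" using assms(4) by (simp add: insert_absorb)
  also have "\<dots> = g e [^]\<^bsub>G\<^esub> n e \<otimes>\<^bsub>G\<^esub> word G g (F - {e}) n"
    by (rule word_insert) (use assms in auto)
  also have "word G g (F - {e}) n = word G (\<lambda>_. \<one>\<^bsub>G\<^esub>) (F - {e}) n"
    by (rule word_cong) (use assms in auto)
  also have "\<dots> = \<one>\<^bsub>G\<^esub>" by (simp add: word_def)
  moreover have "g e \<in> carrier G" using assms by auto
  ultimately show ?thesis by simp
qed

lemma word_add:
  assumes "comm_group G" "finite F" "g \<in> F \<rightarrow> carrier G"
  shows "word G g F (\<lambda>e. m e + n e) = word G g F m \<otimes>\<^bsub>G\<^esub> word G g F n"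
proof -
  interpret comm_group G by fact
  show ?thesis using assms(2,3)
  proof (induction F)
    case (insert e F)
    then show ?case using word_closed[of G g F n] word_closed[of G g F m] assms(1)
      by (simp add: word_insert int_pow_mult Pi_iff m_ac)
  qed (simp add: word_empty assms)
qed

lemma word_pow:
  assumes "comm_group G" "finite F" "g \<in> F \<rightarrow> carrier G"
  shows "word G g F (\<lambda>e. n e * c) = word G g F n [^]\<^bsub>G\<^esub> (c :: int)"
proof -
  interpret comm_group G by fact
  show ?thesis using assms(2,3)
  proof (induction F)
    case (insert e F)
    then show ?case using word_closed[of G g F n] assms(1)
      by (simp add: word_insert int_pow_pow int_pow_distrib Pi_iff)
  qed (simp add: word_empty assms)
qed

text \<open>A space obtained from its closed subset \<open>A\<close> by attaching finitely many
\<open>k\<close>-cells, as in the step from one skeleton to the next.\<close>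

locale cells_attachment =
  fixes Y :: "'a topology" and A :: "'a set" and k :: nat and \<phi> :: "'c \<Rightarrow> (nat \<Rightarrow> real) \<Rightarrow> 'a" and F :: "'c set"
  assumes Hausdorff: "Hausdorff_space Y"
    and finite_cells: "finite F"
    and closed_A: "closedin Y A"
    and cont: "\<And>e. e \<in> F \<Longrightarrow> continuous_map (disc k) Y (\<phi> e)"
    and inj: "\<And>e. e \<in> F \<Longrightarrow> inj_on (\<phi> e) (open_disc k)"
    and sphere: "\<And>e. e \<in> F \<Longrightarrow> \<phi> e ` disc_sphere k \<subseteq> A"
    and disjoint_A: "\<And>e. e \<in> F \<Longrightarrow> \<phi> e ` open_disc k \<inter> A = {}"
    and disjoint: "\<And>e f. e \<in> F \<Longrightarrow> f \<in> F \<Longrightarrow> e \<noteq> f \<Longrightarrow> \<phi> e ` open_disc k \<inter> \<phi> f ` open_disc k = {}"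
    and cover: "topspace Y = A \<union> (\<Union>e\<in>F. \<phi> e ` open_disc k)"
begin

abbreviation "G \<equiv> relative_homology_group (int k) Y A"

definition cell :: "'c \<Rightarrow> 'a chain set" where
  "cell e = hom_induced (int k) (disc k) (disc_sphere k) Y A (\<phi> e) (disc_class k)"

lemma cell_carrier: "cell e \<in> carrier G"
  by (simp add: cell_def hom_induced_carrier)

definition sub :: "'c set \<Rightarrow> 'a set" where "sub E = A \<union> (\<Union>e\<in>E. \<phi> e ` open_disc k)"

lemma sub_subset: "E \<subseteq> F \<Longrightarrow> sub E \<subseteq> topspace Y"
  using cover by (auto simp: sub_def)

lemma closed_sub: assumes "E \<subseteq> F" shows "closedin Y (sub E)"
proof -
  have "sub E = A \<union> (\<Union>e\<in>E. \<phi> e ` disc_points k)"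
    using sphere assms by (fastforce simp: sub_def disc_points_Un)
  moreover have "closedin Y (\<phi> e ` disc_points k)" if "e \<in> E" for e
    using continuous_imp_closed_map[OF cont compact_disc Hausdorff, of e] that assms
      closedin_topspace[of "disc k"] unfolding closed_map_def by auto
  moreover have "finite E" using assms finite_cells finite_subset by blast
  ultimately show ?thesis using closed_A by (auto intro!: closedin_Un closedin_Union)
qed

lemma restriction:
  assumes "E \<subseteq> F" shows "cells_attachment (subtopology Y (sub E)) A k \<phi> E"
proof
  have im: "\<phi> e ` disc_points k \<subseteq> sub E" if "e \<in> E" for e
    using that assms sphere[of e] by (auto simp: sub_def disc_points_Un)
  show "continuous_map (disc k) (subtopology Y (sub E)) (\<phi> e)" if "e \<in> E" for e
    using im[OF that] cont that assms by (auto simp: continuous_map_in_subtopology)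
  show "closedin (subtopology Y (sub E)) A"
    using closed_A by (metis Un_upper1 closedin_subset_topspace sub_def)
  show "topspace (subtopology Y (sub E)) = A \<union> (\<Union>e\<in>E. \<phi> e ` open_disc k)"
    using sub_subset[OF assms] by (auto simp: sub_def)
qed (use assms finite_subset[OF assms finite_cells] Hausdorff inj sphere disjoint_A disjoint in
      \<open>auto simp: Hausdorff_space_subtopology subset_iff\<close>)

lemma single:
  assumes "e \<in> F" shows "cell_attachment Y (sub (F - {e})) k (\<phi> e)"
proof
  show "\<phi> e ` open_disc k \<inter> sub (F - {e}) = {}"
    using disjoint[OF assms] disjoint_A[OF assms] by (fastforce simp: sub_def)
  show "topspace Y = sub (F - {e}) \<union> \<phi> e ` open_disc k"
    using cover assms by (auto simp: sub_def)
  show "\<phi> e ` disc_sphere k \<subseteq> sub (F - {e})"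
    using sphere[OF assms] by (auto simp: sub_def)
qed (use assms Hausdorff closed_sub cont inj in auto)

abbreviation "rel E \<equiv> hom_induced (int k) Y A Y (sub E) id"
abbreviation "incl E \<equiv> hom_induced (int k) (subtopology Y (sub E)) A Y A id"

lemma A_sub: "A \<subseteq> sub E" by (auto simp: sub_def)

lemma incl_cell:
  assumes "e \<in> E" "E \<subseteq> F"
  shows "incl E (cells_attachment.cell (subtopology Y (sub E)) A k \<phi> e) = cell e"
proof -
  interpret E: cells_attachment "subtopology Y (sub E)" A k \<phi> E by (rule restriction[OF assms(2)])
  show ?thesis unfolding E.cell_def cell_def
    using hom_induced_compose'[OF E.cont[OF assms(1)], of "disc_sphere k" A Y id A] E.sphere[OF assms(1)]
    by (auto simp: Pi_iff image_subset_iff continuous_map_from_subtopology)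
qed

lemma rel_cell:
  assumes "e \<in> F"
  shows "rel E (cell e) = hom_induced (int k) (disc k) (disc_sphere k) Y (sub E) (\<phi> e) (disc_class k)"
  unfolding cell_def
  using hom_induced_compose'[OF cont[OF assms], of "disc_sphere k" A Y id "sub E"] sphere[OF assms] A_sub[of E]
  by (auto simp: Pi_iff image_subset_iff)

lemma exact: "rel E ` carrier G \<subseteq> carrier (relative_homology_group (int k) Y (sub E))"
  "incl E ` carrier (relative_homology_group (int k) (subtopology Y (sub E)) A)
     = kernel G (relative_homology_group (int k) Y (sub E)) (rel E)"
  using homology_exactness_triple_3[OF A_sub, of "int k" Y E] by (auto simp: hom_induced_carrier)

text \<open>A cell other than \<open>e\<close> lives in the subspace that is divided out.\<close>

lemma rel_other_cell:
  assumes "f \<in> F" "e \<in> F" "f \<noteq> e"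
  shows "rel (F - {e}) (cell f) = \<one>\<^bsub>relative_homology_group (int k) Y (sub (F - {e}))\<^esub>"
proof -
  let ?E = "F - {e}"
  interpret E: cells_attachment "subtopology Y (sub ?E)" A k \<phi> ?E by (rule restriction) auto
  have "cell f \<in> incl ?E ` carrier (relative_homology_group (int k) (subtopology Y (sub ?E)) A)"
    using incl_cell[of f ?E] E.cell_carrier[of f] assms by (metis DiffI Diff_subset empty_iff image_eqI insert_iff)
  then show ?thesis unfolding exact(2) by (simp add: kernel_def)
qed

text \<open>Relative to \<open>A\<close> and all the other cells, the space has a single cell attached.\<close>

lemma rel_cell_iso:
  assumes "e \<in> F"
  shows "(\<lambda>n::int. rel (F - {e}) (cell e) [^]\<^bsub>relative_homology_group (int k) Y (sub (F - {e}))\<^esub> n)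
     \<in> iso integer_group (relative_homology_group (int k) Y (sub (F - {e})))"
proof -
  interpret e: cell_attachment Y "sub (F - {e})" k "\<phi> e" by (rule single[OF assms])
  let ?H = "relative_homology_group (int k) Y (sub (F - {e}))"
  let ?h = "hom_induced (int k) (disc k) (disc_sphere k) Y (sub (F - {e})) (\<phi> e)"
  have h: "?h \<in> iso (disc_group k) ?H" by (rule e.characteristic_map_iso)
  interpret h: group_hom "disc_group k" ?H ?h
    using h by (simp add: group_hom_def group_hom_axioms_def iso_def)
  have "disc_class k \<in> carrier (disc_group k)"
    by (rule disc_class_generates)
  then have "?h (disc_class k [^]\<^bsub>disc_group k\<^esub> n) = rel (F - {e}) (cell e) [^]\<^bsub>?H\<^esub> n" for n :: int
    by (simp add: rel_cell[OF assms] h.hom_int_pow)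
  then show ?thesis using iso_set_trans[OF pow_disc_class_iso h] by (simp add: o_def)
qed

text \<open>Dividing out all cells but \<open>e\<close> leaves the power of the class of \<open>e\<close> with
exponent \<open>n e\<close>, and this class has infinite order.\<close>

lemma word_cells_inj:
  assumes "word G cell F n = \<one>\<^bsub>G\<^esub>" "e \<in> F" shows "n e = 0"
proof -
  let ?H = "relative_homology_group (int k) Y (sub (F - {e}))"
  let ?r = "rel (F - {e})"
  have "?r (word G cell F n) = word ?H (\<lambda>f. ?r (cell f)) F n"
    by (rule word_hom) (auto simp: finite_cells cell_carrier hom_induced_hom)
  also have "\<dots> = ?r (cell e) [^]\<^bsub>?H\<^esub> n e"
    by (rule word_single) (auto simp: finite_cells hom_induced_carrier assms rel_other_cell)
  finally have "?r (cell e) [^]\<^bsub>?H\<^esub> n e = ?r (cell e) [^]\<^bsub>?H\<^esub> (0::int)"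
    using hom_one[OF hom_induced_hom, of "int k" Y A Y "sub (F - {e})" id] by (simp add: assms)
  then show ?thesis
    using rel_cell_iso[OF assms(2)] unfolding iso_def bij_betw_def inj_on_def by simp
qed

end

text \<open>Induction on the number of cells. Modulo the other cells, the given class is a power of the class
of the last one. The quotient by that power vanishes relative to the other cells, so by exactness
it comes from the space without the last cell.\<close>

theorem cells_generate:
  assumes "cells_attachment Y A k \<phi> F" "x \<in> carrier (relative_homology_group (int k) Y A)"
  shows "\<exists>n. x = word (relative_homology_group (int k) Y A) (cells_attachment.cell Y A k \<phi>) F n"
proof -
  have "finite F" using assms cells_attachment.finite_cells by blast
  then show ?thesis using assms
  proof (induction F arbitrary: Y x)
    case empty
    then interpret cells_attachment Y A k \<phi> "{}" by simp
    have "topspace Y = A" using cover by simp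
    then show ?case using trivial_relative_homology_group_topspace[of "int k" Y] empty.prems
      by (simp add: word_empty trivial_group_def)
  next
    case (insert e F)
    interpret cells_attachment Y A k \<phi> "insert e F" by fact
    let ?H = "relative_homology_group (int k) Y (sub F)"
    have Fe: "insert e F - {e} = F" using insert by auto
    interpret H: comm_group ?H by simp
    interpret G: comm_group G by simp
    interpret r: group_hom G ?H "rel F" by (simp add: group_hom_def group_hom_axioms_def hom_induced_hom)
    have "rel F x \<in> carrier ?H" by (simp add: hom_induced_carrier)
    then obtain m :: int where m: "rel F x = rel F (cell e) [^]\<^bsub>?H\<^esub> m"
      using rel_cell_iso[of e] unfolding Fe iso_def bij_betw_def by auto
    let ?y = "x \<otimes>\<^bsub>G\<^esub> inv\<^bsub>G\<^esub> (cell e [^]\<^bsub>G\<^esub> m)"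
    have "?y \<in> kernel G ?H (rel F)"
      using insert.prems m cell_carrier by (simp add: kernel_def r.hom_int_pow)
    then obtain z where z: "z \<in> carrier (relative_homology_group (int k) (subtopology Y (sub F)) A)" "incl F z = ?y"
      unfolding exact(2)[symmetric] by auto
    interpret E: cells_attachment "subtopology Y (sub F)" A k \<phi> F by (rule restriction) auto
    obtain n where n: "z = word E.G E.cell F n" using insert.IH[OF E.cells_attachment_axioms z(1)] by auto
    have "incl F z = word G (\<lambda>f. incl F (E.cell f)) F n"
      unfolding n by (rule word_hom) (auto simp: insert E.cell_carrier hom_induced_hom)
    also have "\<dots> = word G cell F n"
      by (rule word_cong) (use incl_cell[of _ F] in \<open>auto simp: hom_induced_carrier\<close>)
    finally have y: "?y = word G cell F n" using z(2) by simp
    have "word G cell (insert e F) (n(e := m)) = cell e [^]\<^bsub>G\<^esub> m \<otimes>\<^bsub>G\<^esub> word G cell F (n(e := m))"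
      by (subst word_insert) (use insert cell_carrier in auto)
    also have "word G cell F (n(e := m)) = ?y"
      unfolding y by (rule word_cong) (use insert cell_carrier in auto)
    also have "cell e [^]\<^bsub>G\<^esub> m \<otimes>\<^bsub>G\<^esub> ?y = x"
      using insert.prems cell_carrier by (metis G.int_pow_closed G.inv_closed G.inv_solve_right G.m_closed G.m_comm)
    finally show ?case by metis
  qed
qed

section \<open>Incidence numbers\<close>

locale finite_cw =
  fixes X :: "('a, 'c) cw"
  assumes cw: "finite_cw_complex X"
begin

lemma Hausdorff_space: "Hausdorff_space (cw_space X)"
  using cw by (simp add: finite_cw_complex_def)

lemma finite_cells: "finite (cw_cells X k)"
proof -
  have "Pair k ` cw_cells X k \<subseteq> (SIGMA k:UNIV. cw_cells X k)" by auto
  then have "finite (Pair k ` cw_cells X k)"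
    using cw by (auto simp: finite_cw_complex_def intro: finite_subset)
  then show ?thesis by (rule finite_imageD) (auto simp: inj_on_def)
qed

lemma finite_nonempty_dimensions: "finite {k. cw_cells X k \<noteq> {}}"
proof -
  have "{k. cw_cells X k \<noteq> {}} \<subseteq> fst ` (SIGMA k:UNIV. cw_cells X k)" by force
  moreover have "finite (SIGMA k:UNIV. cw_cells X k)" using cw by (simp only: finite_cw_complex_def)
  ultimately show ?thesis using finite_subset finite_imageI by blast
qed

lemma map_continuous: "e \<in> cw_cells X k \<Longrightarrow> continuous_map (disc k) (cw_space X) (cw_map X k e)"
  and map_inj: "e \<in> cw_cells X k \<Longrightarrow> inj_on (cw_map X k e) (open_disc k)"
  and map_sphere: "e \<in> cw_cells X k \<Longrightarrow> cw_map X k e ` disc_sphere k \<subseteq> below X k"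
  and open_cells_disjoint: "e \<in> cw_cells X k \<Longrightarrow> f \<in> cw_cells X l \<Longrightarrow> (k, e) \<noteq> (l, f) \<Longrightarrow>
    open_cell X k e \<inter> open_cell X l f = {}"
  and space_eq: "topspace (cw_space X) = cells_union X"
  using cw by (simp_all add: finite_cw_complex_def)

lemma below_Suc: "below X (Suc k) = below X k \<union> (\<Union>e\<in>cw_cells X k. open_cell X k e)"
  by (auto simp: below_def lessThan_Suc)

lemma below_mono: "j \<le> k \<Longrightarrow> below X j \<subseteq> below X k"
  unfolding below_def by (rule UN_mono) auto

lemma below_subset: "below X k \<subseteq> topspace (cw_space X)"
  unfolding space_eq by (auto simp: below_def cells_union_def)

lemma below_Suc_closed_cells: "below X (Suc k) = below X k \<union> (\<Union>e\<in>cw_cells X k. cw_map X k e ` disc_points k)"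
proof -
  have "cw_map X k e ` disc_points k = open_cell X k e \<union> cw_map X k e ` disc_sphere k" for e
    by (simp add: open_cell_def disc_points_Un image_Un)
  moreover have "(\<Union>e\<in>cw_cells X k. cw_map X k e ` disc_sphere k) \<subseteq> below X k"
    using map_sphere[of _ k] by blast
  ultimately show ?thesis unfolding below_Suc by (simp add: UN_Un_distrib) blast
qed

lemma closedin_below: "closedin (cw_space X) (below X k)"
proof (induction k)
  case 0 then show ?case by (simp add: below_def)
next
  case (Suc k)
  have "closedin (cw_space X) (cw_map X k e ` disc_points k)" if "e \<in> cw_cells X k" for e
    using continuous_imp_closed_map[OF map_continuous[OF that] compact_disc Hausdorff_space]
      closedin_topspace[of "disc k"] unfolding closed_map_def by auto
  then show ?case unfolding below_Suc_closed_cells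
    using Suc finite_cells by (auto intro!: closedin_Un closedin_Union)
qed

lemma below_disjoint: "e \<in> cw_cells X k \<Longrightarrow> open_cell X k e \<inter> below X k = {}"
  using open_cells_disjoint[of e k] by (auto simp: below_def)

lemma topspace_skel_top [simp]: "topspace (skel_top X k) = below X (Suc k)"
  using below_subset by (auto simp: skel_top_def)

lemma attachment: "cells_attachment (skel_top X k) (below X k) k (cw_map X k) (cw_cells X k)"
proof
  show "continuous_map (disc k) (skel_top X k) (cw_map X k e)" if "e \<in> cw_cells X k" for e
    using map_continuous[OF that] that by (auto simp: skel_top_def continuous_map_in_subtopology below_Suc_closed_cells)
  show "closedin (skel_top X k) (below X k)"
    unfolding skel_top_def by (rule closedin_subset_topspace[OF closedin_below below_mono]) auto
  show "topspace (skel_top X k) = below X k \<union> (\<Union>e\<in>cw_cells X k. cw_map X k e ` open_disc k)"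
    by (simp add: below_Suc open_cell_def)
  show "cw_map X k e ` open_disc k \<inter> cw_map X k f ` open_disc k = {}"
    if "e \<in> cw_cells X k" "f \<in> cw_cells X k" "e \<noteq> f" for e f
    using open_cells_disjoint[OF that(1,2)] that(3) by (simp add: open_cell_def)
  show "cw_map X k e ` open_disc k \<inter> below X k = {}" if "e \<in> cw_cells X k" for e
    using below_disjoint[OF that] by (simp add: open_cell_def)
  show "Hausdorff_space (skel_top X k)"
    by (simp add: skel_top_def Hausdorff_space_subtopology Hausdorff_space)
qed (use finite_cells map_inj map_sphere in auto)

lemma cell_class_eq: "cells_attachment.cell (skel_top X k) (below X k) k (cw_map X k) = cell_class X k"
  by (rule ext) (simp add: cells_attachment.cell_def[OF attachment] cell_class_def)

lemma cell_class_carrier: "cell_class X k e \<in> carrier (skel_group X k)"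
  by (simp add: cell_class_def skel_group_def hom_induced_carrier)

lemma comm_group_skel: "comm_group (skel_group X k)"
  by (simp add: skel_group_def)

text \<open>The skeletal group is free on the classes of the cells. This gives the definite description in
\<open>incidence\<close> its meaning.\<close>

lemma ex1_word:
  assumes "x \<in> carrier (skel_group X k)"
  shows "\<exists>!n. (\<forall>f. f \<notin> cw_cells X k \<longrightarrow> n f = 0) \<and> x = word (skel_group X k) (cell_class X k) (cw_cells X k) n"
proof -
  interpret comm_group "skel_group X k" by (rule comm_group_skel)
  let ?w = "word (skel_group X k) (cell_class X k) (cw_cells X k)"
  obtain n where n: "x = ?w n"
    using cells_generate[OF attachment[of k], of x] assms unfolding cell_class_eq skel_group_def by blast
  show ?thesis
  proof (rule ex1I)
    show "(\<forall>f. f \<notin> cw_cells X k \<longrightarrow> (\<lambda>f. if f \<in> cw_cells X k then n f else 0) f = 0) \<and>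
        x = ?w (\<lambda>f. if f \<in> cw_cells X k then n f else 0)"
      unfolding n by (simp, rule word_cong) (auto simp: comm_group_skel cell_class_carrier)
  next
    fix m assume m: "(\<forall>f. f \<notin> cw_cells X k \<longrightarrow> m f = 0) \<and> x = ?w m"
    have "?w (\<lambda>e. m e + - n e) = ?w m \<otimes>\<^bsub>skel_group X k\<^esub> ?w (\<lambda>e. n e * (-1))"
      by (subst word_add[symmetric]) (auto simp: comm_group_skel finite_cells cell_class_carrier)
    also have "?w (\<lambda>e. n e * (-1)) = ?w n [^]\<^bsub>skel_group X k\<^esub> (-1::int)"
      by (rule word_pow) (auto simp: comm_group_skel finite_cells cell_class_carrier)
    also have "?w m \<otimes>\<^bsub>skel_group X k\<^esub> \<dots> = \<one>\<^bsub>skel_group X k\<^esub>"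
      using m n assms by (simp add: int_pow_neg)
    finally have "m e + - n e = 0" if "e \<in> cw_cells X k" for e
      using cells_attachment.word_cells_inj[OF attachment[of k], of "\<lambda>e. m e + - n e" e] that
      by (simp add: cell_class_eq skel_group_def)
    then show "m = (\<lambda>f. if f \<in> cw_cells X k then n f else 0)" using m by auto
  qed
qed

lemma skel_top_restrict: "subtopology (skel_top X (Suc k)) (below X (Suc k)) = skel_top X k"
  using below_mono[of "Suc k" "Suc (Suc k)"]
  by (simp add: skel_top_def subtopology_subtopology inf.absorb2)

lemma skel_boundary_hom: "skel_boundary X k \<in> hom (skel_group X (Suc k)) (skel_group X k)"
proof -
  have "skel_boundary X k = hom_induced (int k) (skel_top X k) {} (skel_top X k) (below X k) id \<circ>
       hom_boundary (int (Suc k)) (skel_top X (Suc k)) (below X (Suc k))"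
    by (auto simp: skel_boundary_def)
  moreover have "hom_boundary (int (Suc k)) (skel_top X (Suc k)) (below X (Suc k))
      \<in> hom (skel_group X (Suc k)) (homology_group (int k) (skel_top X k))"
    using hom_boundary_hom[of "int (Suc k)" "skel_top X (Suc k)" "below X (Suc k)"]
    by (simp add: skel_top_restrict skel_group_def)
  moreover have "hom_induced (int k) (skel_top X k) {} (skel_top X k) (below X k) id
      \<in> hom (homology_group (int k) (skel_top X k)) (skel_group X k)"
    unfolding skel_group_def by (rule hom_induced_hom)
  ultimately show ?thesis by (simp only: hom_compose)
qed

text \<open>The composite contains two consecutive maps of the exact sequence of the pair formed by the
skeleta of dimensions \<open>k + 1\<close> and \<open>k\<close>.\<close>

lemma skel_boundary_boundary:
  assumes "z \<in> carrier (skel_group X (Suc (Suc k)))"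
  shows "skel_boundary X k (skel_boundary X (Suc k) z) = \<one>\<^bsub>skel_group X k\<^esub>"
proof -
  let ?Y = "skel_top X (Suc k)" and ?A = "below X (Suc k)"
  let ?w = "hom_boundary (int (Suc (Suc k))) (skel_top X (Suc (Suc k))) (below X (Suc (Suc k))) z"
  have "?w \<in> carrier (homology_group (int (Suc k)) ?Y)"
    using hom_boundary_carrier[of "int (Suc (Suc k))" "skel_top X (Suc (Suc k))" "below X (Suc (Suc k))" z]
    by (simp add: skel_top_restrict)
  then have "hom_induced (int (Suc k)) ?Y {} ?Y ?A id ?w \<in>
      kernel (relative_homology_group (int (Suc k)) ?Y ?A) (homology_group (int (Suc k) - 1) (subtopology ?Y ?A))
        (hom_boundary (int (Suc k)) ?Y ?A)"
    using homology_exactness_axiom_1[of "int (Suc k)" ?Y ?A] by (auto simp: image_iff)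
  then have "hom_boundary (int (Suc k)) ?Y ?A (hom_induced (int (Suc k)) ?Y {} ?Y ?A id ?w)
      = \<one>\<^bsub>homology_group (int k) (skel_top X k)\<^esub>"
    by (simp add: kernel_def skel_top_restrict)
  then have "skel_boundary X k (skel_boundary X (Suc k) z) =
      hom_induced (int k) (skel_top X k) {} (skel_top X k) (below X k) id \<one>\<^bsub>homology_group (int k) (skel_top X k)\<^esub>"
    by (simp only: skel_boundary_def)
  also have "\<dots> = \<one>\<^bsub>skel_group X k\<^esub>"
    unfolding skel_group_def by (rule hom_one[OF hom_induced_hom]) auto
  finally show ?thesis .
qed

lemma incidence:
  "f \<notin> cw_cells X k \<Longrightarrow> incidence X k e f = 0"
  "skel_boundary X k (cell_class X (Suc k) e)
     = word (skel_group X k) (cell_class X k) (cw_cells X k) (incidence X k e)"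
proof -
  have "skel_boundary X k (cell_class X (Suc k) e) \<in> carrier (skel_group X k)"
    by (rule hom_in_carrier[OF skel_boundary_hom cell_class_carrier])
  from theI'[OF ex1_word[OF this]]
  show "f \<notin> cw_cells X k \<Longrightarrow> incidence X k e f = 0"
  "skel_boundary X k (cell_class X (Suc k) e)
     = word (skel_group X k) (cell_class X k) (cw_cells X k) (incidence X k e)"
    unfolding incidence_def word_def by blast+
qed

lemma incidence_unique:
  assumes "\<And>f. f \<notin> cw_cells X k \<Longrightarrow> n f = 0"
    "skel_boundary X k (cell_class X (Suc k) e) = word (skel_group X k) (cell_class X k) (cw_cells X k) n"
  shows "incidence X k e = n"
proof -
  have "skel_boundary X k (cell_class X (Suc k) e) \<in> carrier (skel_group X k)"
    by (rule hom_in_carrier[OF skel_boundary_hom cell_class_carrier])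
  from ex1_word[OF this] show ?thesis using assms incidence(1)[of _ k e] incidence(2)[of k e] by blast
qed

lemma skel_boundary_word:
  assumes "finite F"
  shows "skel_boundary X k (word (skel_group X (Suc k)) (cell_class X (Suc k)) F c)
     = word (skel_group X k) (cell_class X k) (cw_cells X k) (\<lambda>f. \<Sum>e\<in>F. incidence X k e f * c e)"
  using assms
proof (induction F)
  case empty
  have "skel_boundary X k \<one>\<^bsub>skel_group X (Suc k)\<^esub> = \<one>\<^bsub>skel_group X k\<^esub>"
    by (rule hom_one[OF skel_boundary_hom]) (simp_all add: skel_group_def)
  moreover have "word (skel_group X k) (cell_class X k) (cw_cells X k) (\<lambda>f. 0) = \<one>\<^bsub>skel_group X k\<^esub>"
  proof -
    interpret comm_group "skel_group X k" by (rule comm_group_skel)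
    show ?thesis by (simp add: word_def)
  qed
  ultimately show ?case by (simp add: word_empty comm_group_skel)
next
  case (insert e F)
  interpret G: comm_group "skel_group X (Suc k)" by (rule comm_group_skel)
  interpret H: comm_group "skel_group X k" by (rule comm_group_skel)
  interpret d: group_hom "skel_group X (Suc k)" "skel_group X k" "skel_boundary X k"
    by (simp add: group_hom_def group_hom_axioms_def skel_boundary_hom)
  have "skel_boundary X k (word (skel_group X (Suc k)) (cell_class X (Suc k)) (insert e F) c)
      = skel_boundary X k (cell_class X (Suc k) e) [^]\<^bsub>skel_group X k\<^esub> c e \<otimes>\<^bsub>skel_group X k\<^esub>
        skel_boundary X k (word (skel_group X (Suc k)) (cell_class X (Suc k)) F c)"
    using insert by (simp add: word_insert comm_group_skel cell_class_carrier d.hom_int_pow word_closed Pi_iff)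
  also have "\<dots> = word (skel_group X k) (cell_class X k) (cw_cells X k) (\<lambda>f. incidence X k e f * c e + (\<Sum>e\<in>F. incidence X k e f * c e))"
    unfolding incidence insert.IH
    by (simp add: word_add word_pow comm_group_skel cell_class_carrier finite_cells)
  finally show ?case using insert by simp
qed

text \<open>The identity $\partial\partial = 0$ for the incidence numbers, read off from its counterpart in
the free skeletal group by comparing exponents.\<close>

theorem incidence_incidence:
  "(\<Sum>f\<in>cw_cells X (Suc k). incidence X k f g * incidence X (Suc k) e f) = 0"
proof (cases "g \<in> cw_cells X k")
  case True
  have "\<one>\<^bsub>skel_group X k\<^esub> = skel_boundary X k (skel_boundary X (Suc k) (cell_class X (Suc (Suc k)) e))"
    by (rule skel_boundary_boundary[OF cell_class_carrier, symmetric])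
  also have "\<dots> = word (skel_group X k) (cell_class X k) (cw_cells X k)
      (\<lambda>g. \<Sum>f\<in>cw_cells X (Suc k). incidence X k f g * incidence X (Suc k) e f)"
    unfolding incidence by (rule skel_boundary_word[OF finite_cells])
  finally show ?thesis
    by (intro cells_attachment.word_cells_inj[OF attachment[of k] _ True])
      (simp only: cell_class_eq skel_group_def)
next
  case False
  then show ?thesis by (simp add: incidence)
qed

end

section \<open>Subcomplexes\<close>

locale finite_cw_subcomplex = finite_cw X for X :: "('a, 'c) cw" +
  fixes Y :: "('a, 'c) cw"
  assumes subcomplex: "subcomplex Y X"
begin

lemma cells_subset: "cw_cells Y k \<subseteq> cw_cells X k"
  and map_eq: "cw_map Y = cw_map X"
  and space_sub: "cw_space Y = subtopology (cw_space X) (cells_union Y)"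
  and closed: "closedin (cw_space X) (cells_union Y)"
  using subcomplex by (auto simp: subcomplex_def)

lemma open_cell_eq: "open_cell Y k e = open_cell X k e"
  by (simp add: open_cell_def map_eq)

lemma below_subset_below: "below Y k \<subseteq> below X k"
  unfolding below_def open_cell_eq by (intro UN_mono cells_subset) auto

lemma below_subset_union: "below Y k \<subseteq> cells_union Y"
  by (auto simp: below_def cells_union_def)

lemma union_Int_below: "cells_union Y \<inter> below X k \<subseteq> below Y k"
proof
  fix x assume "x \<in> cells_union Y \<inter> below X k"
  then obtain l f j e where "f \<in> cw_cells Y l" "x \<in> open_cell X l f" "j < k" "e \<in> cw_cells X j" "x \<in> open_cell X j e"
    by (auto simp: cells_union_def below_def open_cell_eq)
  moreover from this have "(l, f) = (j, e)" using open_cells_disjoint[of f l e j] cells_subset by blast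
  ultimately show "x \<in> below Y k" by (auto simp: below_def open_cell_eq)
qed

text \<open>The point set of a subcomplex is closed and the open disc is dense in the disc: a point
\<open>x\<close> of the disc is the limit of \<open>t * x\<close> for \<open>t\<close> tending to
1 from below.\<close>

lemma closed_cell_subset:
  assumes "e \<in> cw_cells Y k" shows "cw_map X k e ` disc_points k \<subseteq> cells_union Y"
proof -
  let ?S = "{x \<in> topspace (disc k). cw_map X k e x \<in> cells_union Y}"
  have e: "e \<in> cw_cells X k" using assms cells_subset by auto
  have "closedin (disc k) ?S"
    by (rule closedin_continuous_map_preimage[OF map_continuous[OF e] closed])
  moreover have "open_disc k \<subseteq> ?S"
  proof
    fix x assume x: "x \<in> open_disc k"
    then have "cw_map X k e x \<in> open_cell Y k e" by (simp add: open_cell_def map_eq)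
    then have "cw_map X k e x \<in> cells_union Y" using assms unfolding cells_union_def by blast
    then show "x \<in> ?S" using x by (simp add: disc_points_Un)
  qed
  ultimately have "disc k closure_of open_disc k \<subseteq> ?S" by (simp add: closure_of_minimal)
  moreover have "x \<in> disc k closure_of open_disc k" if x: "x \<in> disc_points k" for x
  proof -
    let ?g = "\<lambda>t i. t * x i :: real"
    have "?g ` {0..<1} \<subseteq> open_disc k"
    proof
      fix y assume "y \<in> ?g ` {0..<1}"
      then obtain t where t: "0 \<le> t" "t < 1" "y = ?g t" by auto
      have "t * radius k x \<le> t * 1" using t x by (intro mult_left_mono) (auto simp: disc_points_def)
      then have "t * radius k x < 1" using t by simp
      then show "y \<in> open_disc k" using x t by (auto simp: open_disc_eq disc_points_def radius_scale')
    qed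
    moreover have "continuous_on (closure {0..<1::real}) ?g"
      by (intro continuous_on_coordinatewise_then_product continuous_intros)
    ultimately have "?g ` closure {0..<1} \<subseteq> closure (open_disc k)"
      by (intro image_closure_subset) (use closure_subset in auto)
    then have "?g 1 \<in> closure (open_disc k)" by (rule subsetD, intro image_eqI[of _ _ 1]) simp_all
    then have "x \<in> closure (open_disc k)" by simp
    then show ?thesis using x by (auto simp: disc_eq closure_of_subtopology open_disc_eq Int_absorb1)
  qed
  ultimately show ?thesis by auto
qed

lemma finite_cw_complex_sub: "finite_cw_complex Y"
  unfolding finite_cw_complex_def
proof (intro conjI allI ballI impI)
  show "Hausdorff_space (cw_space Y)"
    by (simp add: space_sub Hausdorff_space_subtopology Hausdorff_space)
  have "(SIGMA k:UNIV. cw_cells Y k) \<subseteq> (SIGMA k:UNIV. cw_cells X k)" using cells_subset by auto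
  then show "finite (SIGMA k:UNIV. cw_cells Y k)"
    using cw by (auto simp: finite_cw_complex_def intro: finite_subset)
  show "topspace (cw_space Y) = cells_union Y"
    using closedin_subset[OF closed] by (auto simp: space_sub)
next
  fix k e assume e: "e \<in> cw_cells Y k"
  then have e': "e \<in> cw_cells X k" using cells_subset by auto
  show "continuous_map (disc k) (cw_space Y) (cw_map Y k e)"
    using map_continuous[OF e'] closed_cell_subset[OF e]
    by (auto simp: space_sub continuous_map_in_subtopology map_eq)
  show "inj_on (cw_map Y k e) (open_disc k)" using map_inj[OF e'] by (simp add: map_eq)
  show "cw_map Y k e ` disc_sphere k \<subseteq> below Y k"
    using map_sphere[OF e'] closed_cell_subset[OF e] union_Int_below[of k] by (auto simp: map_eq disc_points_Un)
next
  fix k l e f assume "e \<in> cw_cells Y k" "f \<in> cw_cells Y l" "(k, e) \<noteq> (l, f)"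
  then show "open_cell Y k e \<inter> open_cell Y l f = {}"
    using open_cells_disjoint[of e k f l] cells_subset[of k] cells_subset[of l] by (auto simp: open_cell_eq)
qed

sublocale Y: finite_cw Y by unfold_locales (rule finite_cw_complex_sub)

lemma skel_top_sub: "skel_top Y k = subtopology (cw_space X) (below Y (Suc k))"
  by (simp add: skel_top_def space_sub subtopology_subtopology inf.absorb2 below_subset_union)

lemma continuous_inclusion: "continuous_map (skel_top Y k) (skel_top X k) id"
  using below_subset_below[of "Suc k"] below_subset[of "Suc k"]
  by (auto simp: skel_top_sub skel_top_def[of X] continuous_map_in_subtopology continuous_map_from_subtopology)

definition incl :: "nat \<Rightarrow> 'a chain set \<Rightarrow> 'a chain set" where
  "incl k = hom_induced (int k) (skel_top Y k) (below Y k) (skel_top X k) (below X k) id"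

lemma incl_hom: "incl k \<in> hom (skel_group Y k) (skel_group X k)"
  by (simp add: incl_def skel_group_def hom_induced_hom)

lemma incl_cell_class:
  assumes "e \<in> cw_cells Y k" shows "incl k (cell_class Y k e) = cell_class X k e"
proof -
  interpret Y: cells_attachment "skel_top Y k" "below Y k" k "cw_map Y k" "cw_cells Y k" by (rule Y.attachment)
  have "incl k (cell_class Y k e) = hom_induced (int k) (disc k) (disc_sphere k) (skel_top X k) (below X k) (id \<circ> cw_map Y k e) (disc_class k)"
    unfolding incl_def cell_class_def
    by (rule hom_induced_compose') (use Y.cont[OF assms] Y.sphere[OF assms] continuous_inclusion[of k] below_subset_below[of k] in auto)
  then show ?thesis by (simp add: cell_class_def map_eq)
qed

text \<open>Naturality of the connecting map and functoriality.\<close>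

lemma skel_boundary_incl:
  "skel_boundary X k (incl (Suc k) z) = incl k (skel_boundary Y k z)"
proof -
  have sub: "below Y (Suc k) \<subseteq> below X (Suc k)" for k by (rule below_subset_below)
  have nat: "hom_boundary (int (Suc k)) (skel_top X (Suc k)) (below X (Suc k)) (incl (Suc k) z)
    = hom_induced (int k) (skel_top Y k) {} (skel_top X k) {} id
       (hom_boundary (int (Suc k)) (skel_top Y (Suc k)) (below Y (Suc k)) z)"
    using naturality_hom_induced[OF continuous_inclusion[of "Suc k"], of "below Y (Suc k)" "below X (Suc k)" "int (Suc k)"] sub[of k]
    by (simp add: fun_eq_iff incl_def skel_top_restrict Y.skel_top_restrict Pi_iff subset_iff)
  let ?w = "hom_boundary (int (Suc k)) (skel_top Y (Suc k)) (below Y (Suc k)) z"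
  have "hom_induced (int k) (skel_top X k) {} (skel_top X k) (below X k) id (hom_induced (int k) (skel_top Y k) {} (skel_top X k) {} id ?w)
     = hom_induced (int k) (skel_top Y k) {} (skel_top X k) (below X k) (id \<circ> id) ?w"
    by (rule hom_induced_compose') (use continuous_inclusion[of k] in auto)
  also have "\<dots> = incl k (hom_induced (int k) (skel_top Y k) {} (skel_top Y k) (below Y k) id ?w)"
    unfolding incl_def
    by (rule hom_induced_compose'[symmetric]) (use continuous_inclusion[of k] below_subset_below[of k] in auto)
  finally show ?thesis unfolding skel_boundary_def nat .
qed

text \<open>The inclusion maps the class of a cell to the class of the same cell and commutes with the
boundary. So the coefficients found in \<open>Y\<close>, extended by 0, also express the boundary
in \<open>X\<close>, where they are unique.\<close>

theorem incidence_subcomplex: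
  assumes "e \<in> cw_cells Y (Suc k)" shows "incidence X k e = incidence Y k e"
proof (rule incidence_unique)
  show "incidence Y k e f = 0" if "f \<notin> cw_cells X k" for f
    using that cells_subset Y.incidence(1) by blast
  have "skel_boundary X k (cell_class X (Suc k) e) = incl k (skel_boundary Y k (cell_class Y (Suc k) e))"
    by (simp add: skel_boundary_incl incl_cell_class[OF assms, symmetric])
  also have "\<dots> = word (skel_group X k) (\<lambda>f. incl k (cell_class Y k f)) (cw_cells Y k) (incidence Y k e)"
    unfolding Y.incidence
    by (rule word_hom) (auto simp: comm_group_skel Y.comm_group_skel incl_hom Y.finite_cells Y.cell_class_carrier)
  also have "\<dots> = word (skel_group X k) (cell_class X k) (cw_cells Y k) (incidence Y k e)"
    by (rule word_cong) (auto simp: comm_group_skel incl_cell_class cell_class_carrier)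
  also have "\<dots> = word (skel_group X k) (cell_class X k) (cw_cells X k) (incidence Y k e)"
  proof -
    interpret G: comm_group "skel_group X k" by (rule comm_group_skel)
    show ?thesis unfolding word_def
      by (rule G.finprod_mono_neutral_cong_left)
        (use finite_cells[of k] cells_subset[of k] Y.incidence(1)[of _ k e] in \<open>auto simp: cell_class_carrier\<close>)
  qed
  finally show "skel_boundary X k (cell_class X (Suc k) e) = word (skel_group X k) (cell_class X k) (cw_cells X k) (incidence Y k e)" .
qed

end

lemma (in finite_cw) skeleton_subcomplex: "subcomplex (skeleton X k) X"
proof -
  have o: "open_cell (skeleton X k) j e = open_cell X j e" for j e by (simp add: open_cell_def skeleton_def)
  have u: "cells_union (skeleton X k) = below X (Suc k)"
    unfolding cells_union_def below_def o
    by (force simp: skeleton_def less_Suc_eq_le split: if_splits)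
  show ?thesis unfolding subcomplex_def u
    by (auto simp: skeleton_def closedin_below)
qed

lemma subcomplex_trans:
  assumes "subcomplex Z Y" "subcomplex Y X" shows "subcomplex Z X"
proof -
  have Y: "cw_space Y = subtopology (cw_space X) (cells_union Y)" "closedin (cw_space X) (cells_union Y)"
    and Z: "cw_space Z = subtopology (cw_space Y) (cells_union Z)" "closedin (cw_space Y) (cells_union Z)"
    using assms by (simp_all add: subcomplex_def)
  have "cells_union Z \<subseteq> cells_union Y"
    using closedin_subset[OF Z(2)] unfolding Y(1) by auto
  moreover have "closedin (cw_space X) (cells_union Z)"
    using closedin_trans_full[OF Z(2)[unfolded Y(1)] Y(2)] .
  moreover have "cw_cells Z k \<subseteq> cw_cells X k" for k
    using assms by (auto simp: subcomplex_def)
  ultimately show ?thesis using assms Z(1) unfolding Y(1) subcomplex_def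
    by (simp add: subtopology_subtopology inf.absorb2)
qed

section \<open>Linear algebra in modules\<close>

text \<open>The coefficient ring is a type, so the axioms concern only the additive group of the record and
its scalar multiplication.\<close>

locale lmod = abelian_group M for M :: "('r::comm_ring_1, 'm) module" (structure) +
  assumes smult_closed [simp]: "x \<in> carrier M \<Longrightarrow> r \<odot> x \<in> carrier M"
    and smult_add_right: "x \<in> carrier M \<Longrightarrow> y \<in> carrier M \<Longrightarrow> r \<odot> (x \<oplus> y) = r \<odot> x \<oplus> r \<odot> y"
    and smult_add_left: "x \<in> carrier M \<Longrightarrow> (r + s) \<odot> x = r \<odot> x \<oplus> s \<odot> x"
    and smult_assoc: "x \<in> carrier M \<Longrightarrow> (r * s) \<odot> x = r \<odot> (s \<odot> x)"
    and smult_one [simp]: "x \<in> carrier M \<Longrightarrow> 1 \<odot> x = x"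
begin

lemma smult_zero_left [simp]: assumes "x \<in> carrier M" shows "0 \<odot> x = \<zero>"
proof -
  have "0 \<odot> x = 0 \<odot> x \<oplus> 0 \<odot> x" using smult_add_left[OF assms, of 0 0] by simp
  then show ?thesis using assms by (metis add.l_cancel_one smult_closed)
qed

lemma smult_zero_right [simp]: "r \<odot> \<zero> = \<zero>"
proof -
  have "r \<odot> \<zero> = r \<odot> \<zero> \<oplus> r \<odot> \<zero>" using smult_add_right[of \<zero> \<zero> r] by simp
  then show ?thesis by (metis add.l_cancel_one smult_closed zero_closed)
qed

lemma smult_minus_one: assumes "x \<in> carrier M" shows "(-1) \<odot> x = \<ominus> x"
proof -
  have "x \<oplus> (-1) \<odot> x = \<zero>" using smult_add_left[OF assms, of 1 "-1"] assms by simp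
  then show ?thesis using assms by (metis minus_equality add.m_comm smult_closed)
qed

lemma nth_carrier: "set bs \<subseteq> carrier M \<Longrightarrow> i < length bs \<Longrightarrow> bs ! i \<in> carrier M"
  by (meson nth_mem subsetD)

lemma lin_comb_Nil [simp]: "lin_comb M [] a = \<zero>"
  by (simp add: lin_comb_def)

lemma lin_comb_snoc:
  assumes "set bs \<subseteq> carrier M" "b \<in> carrier M"
  shows "lin_comb M (bs @ [b]) a = lin_comb M bs a \<oplus> a (length bs) \<odot> b"
proof -
  have "lin_comb M (bs @ [b]) a = (\<Oplus>i\<in>insert (length bs) {..<length bs}. a i \<odot> ((bs @ [b]) ! i))"
    by (simp add: lin_comb_def lessThan_Suc)
  also have "\<dots> = a (length bs) \<odot> b \<oplus> (\<Oplus>i\<in>{..<length bs}. a i \<odot> ((bs @ [b]) ! i))"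
    using assms by (subst finsum_insert) (auto simp: nth_append nth_carrier)
  also have "(\<Oplus>i\<in>{..<length bs}. a i \<odot> ((bs @ [b]) ! i)) = lin_comb M bs a"
    unfolding lin_comb_def using assms by (intro finsum_cong') (auto simp: nth_append nth_carrier)
  finally have "lin_comb M (bs @ [b]) a = a (length bs) \<odot> b \<oplus> lin_comb M bs a" .
  moreover have "lin_comb M bs a \<in> carrier M"
    unfolding lin_comb_def using assms by (intro finsum_closed) (auto simp: nth_carrier)
  ultimately show ?thesis using assms by (simp add: a_comm)
qed

lemma lin_comb_closed [simp]: "set bs \<subseteq> carrier M \<Longrightarrow> lin_comb M bs a \<in> carrier M"
  by (induction bs rule: rev_induct) (auto simp: lin_comb_snoc)

lemma lin_comb_add:
  "set bs \<subseteq> carrier M \<Longrightarrow> lin_comb M bs (\<lambda>i. a i + b i) = lin_comb M bs a \<oplus> lin_comb M bs b"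
  by (induction bs rule: rev_induct) (auto simp: lin_comb_snoc smult_add_left a_ac)

lemma lin_comb_smult:
  "set bs \<subseteq> carrier M \<Longrightarrow> lin_comb M bs (\<lambda>i. r * a i) = r \<odot> lin_comb M bs a"
  by (induction bs rule: rev_induct) (auto simp: lin_comb_snoc smult_assoc smult_add_right)

lemma lin_comb_cong: "(\<And>i. i < length bs \<Longrightarrow> a i = b i) \<Longrightarrow> set bs \<subseteq> carrier M \<Longrightarrow> lin_comb M bs a = lin_comb M bs b"
  by (induction bs rule: rev_induct) (auto simp: lin_comb_snoc)

lemma lin_comb_zero: "(\<And>i. i < length bs \<Longrightarrow> a i = 0) \<Longrightarrow> set bs \<subseteq> carrier M \<Longrightarrow> lin_comb M bs a = \<zero>"
  by (induction bs rule: rev_induct) (auto simp: lin_comb_snoc)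

lemma lin_comb_append:
  "set bs \<subseteq> carrier M \<Longrightarrow> set cs \<subseteq> carrier M \<Longrightarrow>
   lin_comb M (bs @ cs) a = lin_comb M bs a \<oplus> lin_comb M cs (\<lambda>i. a (length bs + i))"
  by (induction cs rule: rev_induct) (auto simp: lin_comb_snoc a_ac simp flip: append_assoc)

lemma lin_comb_unit:
  "set bs \<subseteq> carrier M \<Longrightarrow> i < length bs \<Longrightarrow> lin_comb M bs (\<lambda>j. if j = i then 1 else 0) = bs ! i"
proof (induction bs rule: rev_induct)
  case (snoc b bs)
  then show ?case
    by (cases "i = length bs") (auto simp: lin_comb_snoc nth_append lin_comb_zero nth_carrier)
qed auto

lemma lin_comb_lin_comb:
  assumes "set bs \<subseteq> carrier M" "\<And>j. j < length vs \<Longrightarrow> vs ! j = lin_comb M bs (A j)"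
  shows "lin_comb M vs a = lin_comb M bs (\<lambda>i. \<Sum>j<length vs. a j * A j i)"
  using assms(2)
proof (induction vs rule: rev_induct)
  case Nil
  then show ?case using assms(1) by (simp add: lin_comb_zero)
next
  case (snoc v vs)
  have v: "v = lin_comb M bs (A (length vs))" using snoc.prems[of "length vs"] by simp
  have vs: "vs ! j = lin_comb M bs (A j)" if "j < length vs" for j
    using snoc.prems[of j] that by (simp add: nth_append)
  then have "set vs \<subseteq> carrier M" using assms(1) by (auto simp: in_set_conv_nth)
  then show ?case using snoc.IH[OF vs] assms(1)
    by (simp add: lin_comb_snoc v lin_comb_add lin_comb_smult)
qed

definition indep :: "'m list \<Rightarrow> bool" where
  "indep bs \<longleftrightarrow> (\<forall>a. lin_comb M bs a = \<zero> \<longrightarrow> (\<forall>i<length bs. a i = 0))"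

lemma lin_comb_minus:
  assumes "set bs \<subseteq> carrier M"
  shows "lin_comb M bs (\<lambda>i. a i - b i) = lin_comb M bs a \<ominus> lin_comb M bs b"
  using lin_comb_add[OF assms, of a "\<lambda>i. (-1) * b i"] assms
  by (simp add: lin_comb_smult[OF assms, of "-1", simplified] a_minus_def smult_minus_one)

lemma module_basis_iff:
  "module_basis M bs \<longleftrightarrow> set bs \<subseteq> carrier M \<and> indep bs \<and> (\<forall>x\<in>carrier M. \<exists>a. x = lin_comb M bs a)"
proof (intro iffI conjI; (elim conjE)?)
  assume b: "module_basis M bs"
  then show s: "set bs \<subseteq> carrier M" by (simp add: module_basis_def)
  show "\<forall>x\<in>carrier M. \<exists>a. x = lin_comb M bs a"
    using b unfolding module_basis_def coords_of_def by blast
  show "indep bs" unfolding indep_def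
  proof (intro allI impI)
    fix a i assume a: "lin_comb M bs a = \<zero>" "i < length bs"
    let ?a = "\<lambda>i. if i < length bs then a i else 0"
    have "coords_of M bs \<zero> ?a" unfolding coords_of_def
      using lin_comb_cong[of bs ?a a] s a(1) by auto
    moreover have "coords_of M bs \<zero> (\<lambda>_. 0)" unfolding coords_of_def using s by (simp add: lin_comb_zero)
    ultimately have "?a = (\<lambda>_. 0)" using b zero_closed unfolding module_basis_def by blast
    then show "a i = 0" using a(2) by meson
  qed
next
  assume s: "set bs \<subseteq> carrier M" and i: "indep bs" and e: "\<forall>x\<in>carrier M. \<exists>a. x = lin_comb M bs a"
  show "module_basis M bs" unfolding module_basis_def
  proof (intro conjI s ballI)
    fix x assume "x \<in> carrier M"
    then obtain a where a: "x = lin_comb M bs a" using e by blast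
    let ?a = "\<lambda>i. if i < length bs then a i else 0"
    show "\<exists>!a. coords_of M bs x a"
    proof (rule ex1I)
      show "coords_of M bs x ?a" unfolding coords_of_def using lin_comb_cong[of bs ?a a] s a by auto
      fix b assume b: "coords_of M bs x b"
      then have "lin_comb M bs (\<lambda>i. b i - a i) = \<zero>"
        using s a by (simp add: lin_comb_minus coords_of_def a_minus_def r_neg)
      then have "\<forall>i<length bs. b i - a i = 0" using i unfolding indep_def by blast
      then show "b = ?a" using b by (auto simp: coords_of_def)
    qed
  qed
qed

lemma basis_carrier: "module_basis M bs \<Longrightarrow> set bs \<subseteq> carrier M"
  by (simp add: module_basis_def)

lemma coords_unique:
  assumes "module_basis M bs" "x = lin_comb M bs a" "i < length bs"
  shows "coords M bs x i = a i"
proof -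
  let ?a = "\<lambda>i. if i < length bs then a i else 0"
  have s: "set bs \<subseteq> carrier M" using assms(1) by (rule basis_carrier)
  have "coords_of M bs x ?a" unfolding coords_of_def using lin_comb_cong[of bs ?a a] s assms by auto
  moreover have "\<exists>!a. coords_of M bs x a" using assms s unfolding module_basis_def by simp
  ultimately have "coords M bs x = ?a" unfolding coords_def by (rule the1_equality[rotated])
  then show ?thesis using assms(3) by simp
qed

lemma lin_comb_coords:
  assumes "module_basis M bs" "x \<in> carrier M" shows "lin_comb M bs (coords M bs x) = x"
proof -
  have "\<exists>!a. coords_of M bs x a" using assms unfolding module_basis_def by simp
  then have "coords_of M bs x (coords M bs x)" unfolding coords_def by (rule theI')
  then show ?thesis by (simp add: coords_of_def)
qed

lemma basis_matrix_carrier [simp]: "basis_matrix M bs vs \<in> carrier_mat (length bs) (length vs)"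
  by (simp add: basis_matrix_def)

lemma basis_matrix_lin_comb:
  assumes b: "module_basis M bs" and vs: "set vs \<subseteq> carrier M"
    and P: "P \<in> carrier_mat (length vs) (length ws)"
    and ws: "\<And>j. j < length ws \<Longrightarrow> ws ! j = lin_comb M vs (\<lambda>i. P $$ (i, j))"
  shows "basis_matrix M bs ws = basis_matrix M bs vs * P"
proof (rule eq_matI)
  fix i j assume "i < dim_row (basis_matrix M bs vs * P)" "j < dim_col (basis_matrix M bs vs * P)"
  then have i: "i < length bs" and j: "j < length ws" using P by (auto simp: basis_matrix_def)
  have "ws ! j = lin_comb M bs (\<lambda>i. \<Sum>k<length vs. P $$ (k, j) * coords M bs (vs ! k) i)"
    unfolding ws[OF j]
    by (rule lin_comb_lin_comb) (use b vs in \<open>auto simp: basis_carrier lin_comb_coords nth_carrier\<close>)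
  from coords_unique[OF b this i]
  have "coords M bs (ws ! j) i = (\<Sum>k<length vs. P $$ (k, j) * coords M bs (vs ! k) i)" .
  then show "basis_matrix M bs ws $$ (i, j) = (basis_matrix M bs vs * P) $$ (i, j)"
    using i j P by (simp add: basis_matrix_def scalar_prod_def lessThan_atLeast0 mult.commute)
qed (use P in \<open>auto simp: basis_matrix_def\<close>)

lemma basis_matrix_change:
  assumes "module_basis M bs" "module_basis M vs" "set ws \<subseteq> carrier M"
  shows "basis_matrix M bs ws = basis_matrix M bs vs * basis_matrix M vs ws"
proof (rule basis_matrix_lin_comb)
  fix j assume j: "j < length ws"
  then have "ws ! j \<in> carrier M" using assms(3) by auto
  then have "ws ! j = lin_comb M vs (coords M vs (ws ! j))" using assms by (simp add: lin_comb_coords)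
  also have "\<dots> = lin_comb M vs (\<lambda>i. basis_matrix M vs ws $$ (i, j))"
    using j assms by (intro lin_comb_cong) (auto simp: basis_matrix_def basis_carrier)
  finally show "ws ! j = lin_comb M vs (\<lambda>i. basis_matrix M vs ws $$ (i, j))" .
qed (use assms in \<open>auto simp: basis_carrier\<close>)

lemma basis_matrix_self:
  assumes "module_basis M bs" shows "basis_matrix M bs bs = 1\<^sub>m (length bs)"
proof (rule eq_matI)
  fix i j assume "i < dim_row (1\<^sub>m (length bs) :: 'r Matrix.mat)" "j < dim_col (1\<^sub>m (length bs) :: 'r Matrix.mat)"
  then have i: "i < length bs" and j: "j < length bs" by auto
  have "bs ! j = lin_comb M bs (\<lambda>i. if i = j then 1 else 0)"
    using lin_comb_unit[of bs j] basis_carrier[OF assms] j by simp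
  from coords_unique[OF assms this i] show "basis_matrix M bs bs $$ (i, j) = 1\<^sub>m (length bs) $$ (i, j)"
    using i j by (simp add: basis_matrix_def)
qed (auto simp: basis_matrix_def)

lemma basis_matrix_inverse:
  assumes "module_basis M bs" "module_basis M vs"
  shows "basis_matrix M bs vs * basis_matrix M vs bs = 1\<^sub>m (length bs)"
  using basis_matrix_change[OF assms basis_carrier[OF assms(1)]] basis_matrix_self[OF assms(1)] by simp

end

text \<open>The two matrices of a change of basis are inverse to each other, so $AB$ and $BA$ are identity
matrices of the two sizes. They have the same trace, and in characteristic 0 the trace of an
identity matrix determines its size.\<close>

lemma basis_length_unique:
  fixes M :: "('r::{comm_ring_1,ring_char_0}, 'm) module"
  assumes "lmod M" "module_basis M bs" "module_basis M vs"
  shows "length bs = length vs"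
proof -
  interpret lmod M by fact
  let ?A = "basis_matrix M bs vs" and ?B = "basis_matrix M vs bs"
  have e: "(\<Sum>k<length vs. ?A $$ (i, k) * ?B $$ (k, i)) = 1" if "i < length bs" for i
    using arg_cong[OF basis_matrix_inverse[OF assms(2,3)], of "\<lambda>Q. Q $$ (i, i)"] that
    by (simp add: scalar_prod_def lessThan_atLeast0 basis_matrix_def)
  have f: "(\<Sum>k<length bs. ?B $$ (i, k) * ?A $$ (k, i)) = 1" if "i < length vs" for i
    using arg_cong[OF basis_matrix_inverse[OF assms(3,2)], of "\<lambda>Q. Q $$ (i, i)"] that
    by (simp add: scalar_prod_def lessThan_atLeast0 basis_matrix_def)
  have "of_nat (length bs) = (\<Sum>i<length bs. \<Sum>k<length vs. ?A $$ (i, k) * ?B $$ (k, i))"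
    using e by simp
  also have "\<dots> = (\<Sum>k<length vs. \<Sum>i<length bs. ?B $$ (k, i) * ?A $$ (i, k))"
    by (subst sum.swap) (simp add: mult.commute)
  also have "\<dots> = of_nat (length vs)" using f by simp
  finally show ?thesis by simp
qed

lemma basis_det_inverse:
  fixes M :: "('r::{comm_ring_1,ring_char_0}, 'm) module"
  assumes "lmod M" "module_basis M bs" "module_basis M vs"
  shows "Determinant.det (basis_matrix M bs vs) * Determinant.det (basis_matrix M vs bs) = 1"
proof -
  interpret lmod M by fact
  have "length vs = length bs" using basis_length_unique[OF assms] by simp
  then show ?thesis
    using basis_matrix_inverse[OF assms(2,3)] det_mult[of "basis_matrix M bs vs" "length bs" "basis_matrix M vs bs"]
    by (metis basis_matrix_carrier det_one)
qed

lemma basis_det_change: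
  fixes M :: "('r::{comm_ring_1,ring_char_0}, 'm) module"
  assumes "lmod M" "module_basis M bs" "module_basis M vs" "set ws \<subseteq> carrier M" "length ws = length bs"
  shows "Determinant.det (basis_matrix M bs ws)
     = Determinant.det (basis_matrix M bs vs) * Determinant.det (basis_matrix M vs ws)"
proof -
  interpret lmod M by fact
  have "length vs = length bs" using basis_length_unique[OF assms(1-3)] by simp
  then show ?thesis unfolding basis_matrix_change[OF assms(2-4)]
    using assms(5) basis_matrix_carrier[of bs vs] basis_matrix_carrier[of vs ws]
    by (intro det_mult[of _ "length bs"]) simp_all
qed

lemma linear_map_lin_comb:
  assumes "lmod M" "lmod N" "linear_map M N f" "set bs \<subseteq> carrier M"
  shows "f (lin_comb M bs a) = lin_comb N (map f bs) a"
proof -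
  interpret M: lmod M by fact
  interpret N: lmod N by fact
  have f: "f x \<in> carrier N" if "x \<in> carrier M" for x using assms(3) that by (auto simp: linear_map_def)
  have z: "f \<zero>\<^bsub>M\<^esub> = \<zero>\<^bsub>N\<^esub>"
  proof -
    have "f (0 \<odot>\<^bsub>M\<^esub> \<zero>\<^bsub>M\<^esub>) = 0 \<odot>\<^bsub>N\<^esub> f \<zero>\<^bsub>M\<^esub>" using assms(3) unfolding linear_map_def by blast
    then show ?thesis using f by simp
  qed
  show ?thesis using assms(4)
  proof (induction bs rule: rev_induct)
    case (snoc b bs)
    then have "set (map f bs) \<subseteq> carrier N" using f by auto
    then show ?case using snoc assms(3) f
      by (simp add: M.lin_comb_snoc N.lin_comb_snoc linear_map_def)
  qed (use z in simp)
qed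

lemma linear_map_zero:
  assumes "lmod M" "lmod N" "linear_map M N f" shows "f \<zero>\<^bsub>M\<^esub> = \<zero>\<^bsub>N\<^esub>"
proof -
  interpret M: lmod M by fact
  interpret N: lmod N by fact
  show ?thesis using linear_map_lin_comb[OF assms, of "[]"] by simp
qed

lemma linear_map_carrier: "linear_map M N f \<Longrightarrow> x \<in> carrier M \<Longrightarrow> f x \<in> carrier N"
  by (auto simp: linear_map_def)

lemma linear_iso_basis:
  assumes "lmod M" "lmod N" "linear_iso M N f" "module_basis M bs"
  shows "module_basis N (map f bs)"
proof -
  interpret M: lmod M by fact
  interpret N: lmod N by fact
  have l: "linear_map M N f" and bij: "bij_betw f (carrier M) (carrier N)"
    using assms(3) by (auto simp: linear_iso_def)
  have s: "set bs \<subseteq> carrier M" using assms(4) by (rule M.basis_carrier)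
  note lc = linear_map_lin_comb[OF assms(1,2) l s]
  show ?thesis unfolding N.module_basis_iff
  proof (intro conjI ballI)
    show "set (map f bs) \<subseteq> carrier N" using s linear_map_carrier[OF l] by auto
    show "N.indep (map f bs)" unfolding N.indep_def
    proof (intro allI impI)
      fix a i assume "lin_comb N (map f bs) a = \<zero>\<^bsub>N\<^esub>" and i: "i < length (map f bs)"
      then have "f (lin_comb M bs a) = f \<zero>\<^bsub>M\<^esub>" by (simp add: lc linear_map_zero[OF assms(1,2) l])
      then have "lin_comb M bs a = \<zero>\<^bsub>M\<^esub>" using bij s by (auto simp: bij_betw_def inj_on_def)
      then show "a i = 0" using assms(4) i by (simp add: M.module_basis_iff M.indep_def)
    qed
    fix y assume "y \<in> carrier N"
    then obtain x where "x \<in> carrier M" "y = f x" using bij by (auto simp: bij_betw_def)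
    then show "\<exists>a. y = lin_comb N (map f bs) a"
      using M.lin_comb_coords[OF assms(4)] unfolding lc[symmetric] by metis
  qed
qed

lemma linear_iso_inv:
  assumes "lmod M" "lmod N" "linear_iso M N f"
  shows "linear_iso N M (inv_into (carrier M) f)"
proof -
  interpret M: lmod M by fact
  interpret N: lmod N by fact
  let ?g = "inv_into (carrier M) f"
  have l: "linear_map M N f" and bij: "bij_betw f (carrier M) (carrier N)"
    using assms(3) by (auto simp: linear_iso_def)
  have g: "?g y \<in> carrier M" "f (?g y) = y" if "y \<in> carrier N" for y
    using bij that by (auto simp: bij_betw_def inv_into_into f_inv_into_f)
  have inj: "x = x'" if "x \<in> carrier M" "x' \<in> carrier M" "f x = f x'" for x x'
    using bij that by (auto simp: bij_betw_def inj_on_def)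
  have "linear_map N M ?g" unfolding linear_map_def
  proof (intro conjI ballI allI)
    show "?g \<in> carrier N \<rightarrow> carrier M" using g by auto
    fix x assume x: "x \<in> carrier N"
    show "?g (r \<odot>\<^bsub>N\<^esub> x) = r \<odot>\<^bsub>M\<^esub> ?g x" for r
      using l g[OF x] g[of "r \<odot>\<^bsub>N\<^esub> x"] x by (intro inj) (auto simp: linear_map_def)
    fix y assume y: "y \<in> carrier N"
    show "?g (x \<oplus>\<^bsub>N\<^esub> y) = ?g x \<oplus>\<^bsub>M\<^esub> ?g y"
      using l g[OF x] g[OF y] g[of "x \<oplus>\<^bsub>N\<^esub> y"] x y by (intro inj) (auto simp: linear_map_def)
  qed
  then show ?thesis using bij_betw_inv_into[OF bij] by (simp add: linear_iso_def)
qed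

section \<open>Submodules, quotients and exact sequences\<close>

text \<open>A submodule, with scalars restricted along \<open>\<phi>\<close>. For \<open>\<phi>\<close> the
identity this is an ordinary submodule; for \<open>real_of_int\<close> it is the situation of the
lattice $H_k(X;\mathbb{Z})_0$ in real homology.\<close>

definition submodule_along :: "('s \<Rightarrow> 'r) \<Rightarrow> ('s::comm_ring_1, 'm) module \<Rightarrow> ('r::comm_ring_1, 'm) module \<Rightarrow> bool" where
  "submodule_along \<phi> N M \<longleftrightarrow> lmod M \<and>
     (\<forall>r s. \<phi> (r + s) = \<phi> r + \<phi> s) \<and> (\<forall>r s. \<phi> (r * s) = \<phi> r * \<phi> s) \<and> \<phi> 1 = 1 \<and> 
     carrier N \<subseteq> carrier M \<and> \<zero>\<^bsub>N\<^esub> = \<zero>\<^bsub>M\<^esub> \<and> (\<oplus>\<^bsub>N\<^esub>) = (\<oplus>\<^bsub>M\<^esub>) \<and> (\<forall>r x. r \<odot>\<^bsub>N\<^esub> x = \<phi> r \<odot>\<^bsub>M\<^esub> x) \<and>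
     \<zero>\<^bsub>M\<^esub> \<in> carrier N \<and> (\<forall>x\<in>carrier N. \<forall>y\<in>carrier N. x \<oplus>\<^bsub>M\<^esub> y \<in> carrier N) \<and>
     (\<forall>r. \<forall>x\<in>carrier N. \<phi> r \<odot>\<^bsub>M\<^esub> x \<in> carrier N)"

lemma submodule_along_lmod: assumes "submodule_along \<phi> N M" shows "lmod N"
proof -
  interpret M: lmod M using assms by (simp add: submodule_along_def)
  have s: "x \<in> carrier N \<Longrightarrow> x \<in> carrier M" for x using assms by (auto simp: submodule_along_def)
  have p: "\<phi> (- 1) = - 1"
  proof -
    have "\<phi> (1 + - 1) = 1 + \<phi> (- 1)" "\<phi> (0 + 0) = \<phi> 0 + \<phi> 0" using assms unfolding submodule_along_def by metis+
    then show ?thesis by (simp add: eq_neg_iff_add_eq_0 add.commute)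
  qed
  have neg: "\<ominus>\<^bsub>M\<^esub> x \<in> carrier N" if "x \<in> carrier N" for x
    using assms that s[OF that] p unfolding submodule_along_def by (metis M.smult_minus_one)
  show ?thesis
  proof (rule lmod.intro)
    show "abelian_group N"
    proof (rule abelian_groupI)
      fix x assume x: "x \<in> carrier N"
      then show "\<exists>y\<in>carrier N. y \<oplus>\<^bsub>N\<^esub> x = \<zero>\<^bsub>N\<^esub>"
        using neg[OF x] s[OF x] assms by (intro bexI[of _ "\<ominus>\<^bsub>M\<^esub> x"]) (auto simp: submodule_along_def M.l_neg)
    next
      fix x y z assume "x \<in> carrier N" "y \<in> carrier N" "z \<in> carrier N"
      then have "x \<oplus>\<^bsub>M\<^esub> y \<oplus>\<^bsub>M\<^esub> z = x \<oplus>\<^bsub>M\<^esub> (y \<oplus>\<^bsub>M\<^esub> z)" by (intro M.a_assoc s)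
      then show "x \<oplus>\<^bsub>N\<^esub> y \<oplus>\<^bsub>N\<^esub> z = x \<oplus>\<^bsub>N\<^esub> (y \<oplus>\<^bsub>N\<^esub> z)" using assms by (simp add: submodule_along_def)
    next
      fix x y assume "x \<in> carrier N" "y \<in> carrier N"
      then have "x \<oplus>\<^bsub>M\<^esub> y = y \<oplus>\<^bsub>M\<^esub> x" by (intro M.a_comm s)
      then show "x \<oplus>\<^bsub>N\<^esub> y = y \<oplus>\<^bsub>N\<^esub> x" using assms by (simp add: submodule_along_def)
    qed (use assms s in \<open>simp_all add: submodule_along_def\<close>)
    show "lmod_axioms N"
      by (rule lmod_axioms.intro)
        (use assms s M.smult_add_right M.smult_add_left M.smult_assoc in \<open>simp_all add: submodule_along_def\<close>)
  qed
qed

lemma submodule_along_lin_comb: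
  assumes "submodule_along \<phi> N M" "set bs \<subseteq> carrier N"
  shows "lin_comb N bs a = lin_comb M bs (\<lambda>i. \<phi> (a i))"
proof -
  interpret M: lmod M using assms by (simp add: submodule_along_def)
  interpret N: lmod N using assms submodule_along_lmod by blast
  have s: "carrier N \<subseteq> carrier M" using assms by (auto simp: submodule_along_def)
  show ?thesis using assms(2)
  proof (induction bs rule: rev_induct)
    case (snoc b bs)
    then have "set bs \<subseteq> carrier M" "b \<in> carrier M" using s by auto
    then show ?case using snoc assms(1) by (simp add: M.lin_comb_snoc N.lin_comb_snoc submodule_along_def)
  qed (use assms in \<open>simp add: submodule_along_def\<close>)
qed

text \<open>\<open>exact_triple N M P f\<close>: $0 \to N \to M \to P \to 0$, with \<open>N\<close> a
submodule of \<open>M\<close>.\<close>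

definition exact_triple :: "('r::comm_ring_1, 'm) module \<Rightarrow> ('r, 'm) module \<Rightarrow> ('r, 'n) module \<Rightarrow> ('m \<Rightarrow> 'n) \<Rightarrow> bool" where
  "exact_triple N M P f \<longleftrightarrow> submodule_along (\<lambda>r. r) N M \<and> lmod P \<and> linear_map M P f \<and>
     f ` carrier M = carrier P \<and> carrier N = {x \<in> carrier M. f x = \<zero>\<^bsub>P\<^esub>}"

text \<open>Given an element of \<open>M\<close>, its image in \<open>P\<close> dictates the coefficients of
\<open>ws\<close>; the rest lies in \<open>N\<close>.\<close>

lemma exact_basis:
  assumes ex: "exact_triple N M P f" and us: "module_basis N us"
    and ws: "set ws \<subseteq> carrier M" "module_basis P (map f ws)"
  shows "module_basis M (us @ ws)"
proof -
  have sub: "submodule_along (\<lambda>r. r) N M" and f: "linear_map M P f"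
    and ker: "carrier N = {x \<in> carrier M. f x = \<zero>\<^bsub>P\<^esub>}" using ex by (auto simp: exact_triple_def)
  interpret M: lmod M using sub by (simp add: submodule_along_def)
  interpret N: lmod N using sub submodule_along_lmod by blast
  interpret P: lmod P using ex by (simp add: exact_triple_def)
  note lcf = linear_map_lin_comb[OF M.lmod_axioms P.lmod_axioms f]
  have usN: "set us \<subseteq> carrier N" using us N.basis_carrier by blast
  then have usM: "set us \<subseteq> carrier M" using ker by auto
  note lcN = submodule_along_lin_comb[OF sub usN]
  have fus: "f (lin_comb M us a) = \<zero>\<^bsub>P\<^esub>" for a
    using N.lin_comb_closed[OF usN, of a] unfolding lcN ker by simp
  have app: "lin_comb M (us @ ws) a = lin_comb N us a \<oplus>\<^bsub>M\<^esub> lin_comb M ws (\<lambda>i. a (length us + i))" for a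
    using usM ws by (simp add: M.lin_comb_append lcN)
  have f_app: "f (lin_comb M (us @ ws) a) = lin_comb P (map f ws) (\<lambda>i. a (length us + i))" for a
  proof -
    have "f (lin_comb M (us @ ws) a) = f (lin_comb M us a) \<oplus>\<^bsub>P\<^esub> f (lin_comb M ws (\<lambda>i. a (length us + i)))"
      using f usM ws by (simp add: M.lin_comb_append linear_map_def)
    then show ?thesis using fus lcf[OF ws(1)] P.lin_comb_closed[OF P.basis_carrier[OF ws(2)]] by simp
  qed
  show ?thesis unfolding M.module_basis_iff
  proof (intro conjI ballI)
    show "set (us @ ws) \<subseteq> carrier M" using usM ws by simp
    show "M.indep (us @ ws)" unfolding M.indep_def
    proof (intro allI impI)
      fix a i assume a: "lin_comb M (us @ ws) a = \<zero>\<^bsub>M\<^esub>" and i: "i < length (us @ ws)"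
      then have "lin_comb P (map f ws) (\<lambda>i. a (length us + i)) = \<zero>\<^bsub>P\<^esub>"
        using f_app[of a] linear_map_zero[OF M.lmod_axioms P.lmod_axioms f] by simp
      then have z: "a (length us + i) = 0" if "i < length ws" for i
        using ws(2) that unfolding P.module_basis_iff P.indep_def by (metis length_map)
      then have "lin_comb M ws (\<lambda>i. a (length us + i)) = \<zero>\<^bsub>M\<^esub>" using ws(1) by (simp add: M.lin_comb_zero)
      then have "lin_comb N us a = \<zero>\<^bsub>N\<^esub>"
        using a app[of a] sub N.lin_comb_closed[OF usN, of a] by (simp add: submodule_along_def subset_iff)
      then have y: "\<forall>i<length us. a i = 0" using us unfolding N.module_basis_iff N.indep_def by blast
      show "a i = 0" using y z[of "i - length us"] i by (cases "i < length us") auto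
    qed
    fix x assume x: "x \<in> carrier M"
    then have "f x \<in> carrier P" using f by (rule linear_map_carrier[rotated])
    then obtain a where a: "f x = lin_comb P (map f ws) a" using ws(2) unfolding P.module_basis_iff by blast
    let ?y = "x \<ominus>\<^bsub>M\<^esub> lin_comb M ws a"
    have "?y = x \<oplus>\<^bsub>M\<^esub> (-1) \<odot>\<^bsub>M\<^esub> lin_comb M ws a"
      using ws(1) by (simp add: a_minus_def M.smult_minus_one)
    then have "f ?y = f x \<oplus>\<^bsub>P\<^esub> (-1) \<odot>\<^bsub>P\<^esub> f (lin_comb M ws a)"
      using f x ws(1) by (simp add: linear_map_def)
    also have "\<dots> = \<zero>\<^bsub>P\<^esub>"
      using \<open>f x \<in> carrier P\<close> lcf[OF ws(1), of a] a by (simp add: P.smult_minus_one P.r_neg)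
    finally have "?y \<in> carrier N" using x ws(1) unfolding ker by simp
    then obtain b where b: "?y = lin_comb N us b" using us unfolding N.module_basis_iff by blast
    let ?c = "\<lambda>i. if i < length us then b i else a (i - length us)"
    have "lin_comb M (us @ ws) ?c = lin_comb N us b \<oplus>\<^bsub>M\<^esub> lin_comb M ws a"
      unfolding app using N.lin_comb_cong[OF _ usN, of ?c b] by simp
    also have "\<dots> = x" unfolding b[symmetric] using x ws(1) by (simp add: a_minus_def M.a_assoc M.l_neg)
    finally show "\<exists>a. x = lin_comb M (us @ ws) a" by metis
  qed
qed

text \<open>With respect to bases adapted to the exact sequence the matrix is block triangular, with the two
matrices on the right as diagonal blocks.\<close>

lemma exact_det:
  fixes M N :: "('r::idom, 'm) module" and P :: "('r, 'n) module"
  assumes ex: "exact_triple N M P f" and us: "module_basis N us"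
    and ws: "set ws \<subseteq> carrier M" "module_basis P (map f ws)"
    and us': "set us' \<subseteq> carrier N" "length us' = length us"
    and ws': "set ws' \<subseteq> carrier M" "length ws' = length ws"
  shows "Determinant.det (basis_matrix M (us @ ws) (us' @ ws'))
    = Determinant.det (basis_matrix N us us') * Determinant.det (basis_matrix P (map f ws) (map f ws'))"
proof -
  have sub: "submodule_along (\<lambda>r. r) N M" and f: "linear_map M P f"
    and ker: "carrier N = {x \<in> carrier M. f x = \<zero>\<^bsub>P\<^esub>}" using ex by (auto simp: exact_triple_def)
  interpret M: lmod M using sub by (simp add: submodule_along_def)
  interpret N: lmod N using sub submodule_along_lmod by blast
  interpret P: lmod P using ex by (simp add: exact_triple_def)
  note lcf = linear_map_lin_comb[OF M.lmod_axioms P.lmod_axioms f]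
  have usN: "set us \<subseteq> carrier N" using us N.basis_carrier by blast
  then have usM: "set us \<subseteq> carrier M" using ker by auto
  note lcN = submodule_along_lin_comb[OF sub usN]
  have b: "module_basis M (us @ ws)" by (rule exact_basis[OF ex us ws])
  let ?n = "length us" and ?m = "length ws"
  have c1: "coords M (us @ ws) u i = (if i < ?n then coords N us u i else 0)"
    if "u \<in> carrier N" "i < ?n + ?m" for u i
  proof -
    let ?c = "\<lambda>i. if i < ?n then coords N us u i else 0"
    have "lin_comb M (us @ ws) ?c = lin_comb M us ?c \<oplus>\<^bsub>M\<^esub> \<zero>\<^bsub>M\<^esub>"
      using usM ws(1) by (simp add: M.lin_comb_append M.lin_comb_zero)
    also have "\<dots> = lin_comb M us (coords N us u)" using usM M.lin_comb_cong[of us ?c "coords N us u"] by simp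
    also have "\<dots> = u" using N.lin_comb_coords[OF us that(1)] lcN by simp
    finally show ?thesis using M.coords_unique[OF b, of u ?c i] that(2) by simp
  qed
  have c2: "coords P (map f ws) (f w) i = coords M (us @ ws) w (?n + i)"
    if w: "w \<in> carrier M" "i < ?m" for w i
  proof -
    let ?c = "coords M (us @ ws) w"
    have "f w = f (lin_comb M us ?c \<oplus>\<^bsub>M\<^esub> lin_comb M ws (\<lambda>i. ?c (?n + i)))"
      using M.lin_comb_coords[OF b w(1)] usM ws(1) by (simp add: M.lin_comb_append)
    also have "\<dots> = f (lin_comb M us ?c) \<oplus>\<^bsub>P\<^esub> f (lin_comb M ws (\<lambda>i. ?c (?n + i)))"
      using f usM ws(1) by (simp add: linear_map_def)
    also have "f (lin_comb M us ?c) = \<zero>\<^bsub>P\<^esub>"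
      using N.lin_comb_closed[OF usN, of ?c] unfolding lcN ker by simp
    finally have "f w = lin_comb P (map f ws) (\<lambda>i. ?c (?n + i))"
      using lcf[OF ws(1)] P.lin_comb_closed[OF P.basis_carrier[OF ws(2)]] by simp
    then show ?thesis using P.coords_unique[OF ws(2)] w(2) by simp
  qed
  let ?A = "basis_matrix N us us'" and ?D = "basis_matrix P (map f ws) (map f ws')"
  let ?B = "Matrix.mat ?n ?m (\<lambda>(i, j). coords M (us @ ws) (ws' ! j) i)"
  have "basis_matrix M (us @ ws) (us' @ ws') = four_block_mat ?A ?B (0\<^sub>m ?m ?n) ?D"
  proof (rule eq_matI)
    fix i j assume "i < dim_row (four_block_mat ?A ?B (0\<^sub>m ?m ?n) ?D)" "j < dim_col (four_block_mat ?A ?B (0\<^sub>m ?m ?n) ?D)"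
    then have i: "i < ?n + ?m" and j: "j < ?n + ?m" using us'(2) ws'(2) by (auto simp: basis_matrix_def)
    have "j < ?n \<Longrightarrow> us' ! j \<in> carrier N" using us' by (metis N.nth_carrier)
    moreover have "\<not> j < ?n \<Longrightarrow> ws' ! (j - ?n) \<in> carrier M" using ws' j by (metis M.nth_carrier add_diff_inverse_nat nat_add_left_cancel_less)
    ultimately show "basis_matrix M (us @ ws) (us' @ ws') $$ (i, j) = four_block_mat ?A ?B (0\<^sub>m ?m ?n) ?D $$ (i, j)"
      using i j us'(2) ws'(2) c1[of "us' ! j" i] c2[of "ws' ! (j - ?n)" "i - ?n"]
      by (auto simp: basis_matrix_def nth_append)
  qed (use us'(2) ws'(2) in \<open>auto simp: basis_matrix_def\<close>)
  then show ?thesis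
    using det_four_block_mat_lower_left_zero[of ?A ?n ?B ?m "0\<^sub>m ?m ?n" ?D] us'(2) ws'(2)
      N.basis_matrix_carrier[of us us'] P.basis_matrix_carrier[of "map f ws" "map f ws'"] by simp
qed

section \<open>Modules of finitely supported functions\<close>

definition fun_module :: "('c \<Rightarrow> 'r) set \<Rightarrow> ('r::comm_ring_1, 'c \<Rightarrow> 'r) module" where
  "fun_module S = \<lparr>carrier = S, monoid.mult = undefined, one = undefined,
      zero = (\<lambda>_. 0), add = (\<lambda>c d e. c e + d e), module.smult = (\<lambda>r c e. r * c e)\<rparr>"

definition fun_submodule :: "('c \<Rightarrow> 'r::comm_ring_1) set \<Rightarrow> bool" where
  "fun_submodule S \<longleftrightarrow> (\<lambda>_. 0) \<in> S \<and> (\<forall>c\<in>S. \<forall>d\<in>S. (\<lambda>e. c e + d e) \<in> S) \<and> (\<forall>r. \<forall>c\<in>S. (\<lambda>e. r * c e) \<in> S)"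

lemma fun_module_simps [simp]:
  "carrier (fun_module S) = S" "\<zero>\<^bsub>fun_module S\<^esub> = (\<lambda>_. 0)" "c \<oplus>\<^bsub>fun_module S\<^esub> d = (\<lambda>e. c e + d e)"
  "r \<odot>\<^bsub>fun_module S\<^esub> c = (\<lambda>e. r * c e)"
  by (simp_all add: fun_module_def)

lemma fun_submodule_zero: "fun_submodule S \<Longrightarrow> (\<lambda>_. 0) \<in> S"
  and fun_submodule_add: "fun_submodule S \<Longrightarrow> c \<in> S \<Longrightarrow> d \<in> S \<Longrightarrow> (\<lambda>e. c e + d e) \<in> S"
  and fun_submodule_smult: "fun_submodule S \<Longrightarrow> c \<in> S \<Longrightarrow> (\<lambda>e. r * c e) \<in> S"
  by (simp_all add: fun_submodule_def)

lemma fun_submodule_diff: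
  assumes "fun_submodule S" "c \<in> S" "d \<in> S" shows "(\<lambda>e. c e - d e) \<in> S"
  using fun_submodule_add[OF assms(1,2) fun_submodule_smult[OF assms(1,3), of "-1"]] by simp

lemma fun_submodule_trivial: "fun_submodule {\<lambda>_. 0}"
  by (simp add: fun_submodule_def)

lemma fun_submodule_image:
  assumes S: "fun_submodule S"
    and add: "\<And>c d. f (\<lambda>e. c e + d e) = (\<lambda>e. f c e + f d e)" and smult: "\<And>r c. f (\<lambda>e. r * c e) = (\<lambda>e. r * f c e)"
  shows "fun_submodule (f ` S)"
  unfolding fun_submodule_def
proof (intro conjI ballI allI)
  have "f (\<lambda>_. 0) = (\<lambda>_. 0)" using smult[of 0 "\<lambda>_. 0"] by simp
  then show "(\<lambda>_. 0) \<in> f ` S" by (intro rev_image_eqI[OF fun_submodule_zero[OF S]]) simp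
  fix c assume "c \<in> f ` S"
  then obtain a where a: "a \<in> S" "c = f a" by blast
  show "(\<lambda>e. r * c e) \<in> f ` S" for r
    by (rule rev_image_eqI[OF fun_submodule_smult[OF S a(1), of r]]) (simp add: a(2) smult)
  fix d assume "d \<in> f ` S"
  then obtain b where b: "b \<in> S" "d = f b" by blast
  show "(\<lambda>e. c e + d e) \<in> f ` S"
    by (rule rev_image_eqI[OF fun_submodule_add[OF S a(1) b(1)]]) (simp add: a(2) b(2) add)
qed

lemma lmod_fun_module: assumes "fun_submodule S" shows "lmod (fun_module S)"
proof (rule lmod.intro)
  note rules = fun_submodule_zero[OF assms] fun_submodule_add[OF assms] fun_submodule_smult[OF assms]
  show "abelian_group (fun_module S)"
  proof (rule abelian_groupI)
    fix x assume "x \<in> carrier (fun_module S)"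
    then have "(\<lambda>e. 0 - x e) \<in> S" using fun_submodule_diff[OF assms rules(1)] by simp
    then show "\<exists>y\<in>carrier (fun_module S). y \<oplus>\<^bsub>fun_module S\<^esub> x = \<zero>\<^bsub>fun_module S\<^esub>"
      by (intro bexI[of _ "\<lambda>e. 0 - x e"]) auto
  qed (use rules in \<open>auto simp: algebra_simps\<close>)
  show "lmod_axioms (fun_module S)"
    by (rule lmod_axioms.intro) (use rules in \<open>auto simp: algebra_simps\<close>)
qed

lemma lin_comb_fun_module:
  assumes "fun_submodule S" "set bs \<subseteq> S"
  shows "lin_comb (fun_module S) bs a = (\<lambda>e. \<Sum>i<length bs. a i * (bs ! i) e)"
proof -
  interpret lmod "fun_module S" by (rule lmod_fun_module[OF assms(1)])
  show ?thesis using assms(2)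
  proof (induction bs rule: rev_induct)
    case (snoc b bs)
    have "(\<Sum>i<length bs. a i * ((bs @ [b]) ! i) e) = (\<Sum>i<length bs. a i * (bs ! i) e)" for e
      by (rule sum.cong) (auto simp: nth_append)
    then show ?case using snoc by (simp add: lin_comb_snoc)
  qed simp
qed

lemma fun_submodule_along:
  "fun_submodule S \<Longrightarrow> fun_submodule S' \<Longrightarrow> S' \<subseteq> S \<Longrightarrow> submodule_along (\<lambda>r. r) (fun_module S') (fun_module S)"
  unfolding submodule_along_def
  by (intro conjI lmod_fun_module) (simp_all add: fun_submodule_def, simp add: fun_module_def)

text \<open>A coset of a submodule as a set of functions. The cosets used by \<open>quotient_module\<close>
and \<open>homology_map\<close> take this form in every \<open>fun_module S\<close>, independently
of \<open>S\<close>.\<close>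

definition coset :: "('c \<Rightarrow> 'r::comm_ring_1) set \<Rightarrow> ('c \<Rightarrow> 'r) \<Rightarrow> ('c \<Rightarrow> 'r) set" where
  "coset B x = (\<lambda>b e. b e + x e) ` B"

lemma a_r_coset_eq: "B +>\<^bsub>fun_module S\<^esub> x = coset B x"
  by (auto simp: a_r_coset_def' coset_def)

lemma mem_coset_iff: "fun_submodule B \<Longrightarrow> y \<in> coset B x \<longleftrightarrow> (\<lambda>e. y e - x e) \<in> B"
proof
  assume "(\<lambda>e. y e - x e) \<in> B"
  then show "y \<in> coset B x" unfolding coset_def by (rule rev_image_eqI) simp
qed (auto simp: coset_def)

lemma coset_eq_iff:
  assumes "fun_submodule B" shows "coset B x = coset B y \<longleftrightarrow> (\<lambda>e. x e - y e) \<in> B"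
proof
  assume "coset B x = coset B y"
  moreover have "x \<in> coset B x" using assms by (simp add: mem_coset_iff fun_submodule_def)
  ultimately show "(\<lambda>e. x e - y e) \<in> B" using mem_coset_iff[OF assms] by blast
next
  assume a: "(\<lambda>e. x e - y e) \<in> B"
  have "(\<lambda>e. z e - x e) \<in> B \<longleftrightarrow> (\<lambda>e. z e - y e) \<in> B" for z
  proof
    assume "(\<lambda>e. z e - x e) \<in> B"
    from fun_submodule_add[OF assms this a] show "(\<lambda>e. z e - y e) \<in> B" by simp
  next
    assume "(\<lambda>e. z e - y e) \<in> B"
    from fun_submodule_diff[OF assms this a] show "(\<lambda>e. z e - x e) \<in> B" by simp
  qed
  then show "coset B x = coset B y" using mem_coset_iff[OF assms] by blast
qed

lemma coset_zero: "coset B (\<lambda>_. 0) = B"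
  by (simp add: coset_def)

lemma coset_eq_zero_iff: "fun_submodule B \<Longrightarrow> coset B x = B \<longleftrightarrow> x \<in> B"
  using coset_eq_iff[of B x "\<lambda>_. 0"] by (simp add: coset_zero)

context
  fixes Z B :: "('c \<Rightarrow> 'r::comm_ring_1) set"
  assumes Z: "fun_submodule Z" and B: "fun_submodule B" and BZ: "B \<subseteq> Z"
begin

abbreviation "quot_module \<equiv> quotient_module (fun_module Z) B"

lemma quotient_carrier: "carrier quot_module = coset B ` Z"
  by (auto simp: quotient_module_def A_RCOSETS_def' a_r_coset_eq)

lemma quotient_zero: "\<zero>\<^bsub>quot_module\<^esub> = B"
  by (simp add: quotient_module_def)

lemma quotient_add: "coset B x \<oplus>\<^bsub>quot_module\<^esub> coset B y = coset B (\<lambda>e. x e + y e)"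
proof -
  have "coset B x \<oplus>\<^bsub>quot_module\<^esub> coset B y = (\<Union>s\<in>coset B x. \<Union>t\<in>coset B y. {\<lambda>e. s e + t e})"
    by (simp add: quotient_module_def set_add_def')
  also have "\<dots> = coset B (\<lambda>e. x e + y e)"
  proof (intro Set.set_eqI iffI)
    fix z assume "z \<in> (\<Union>s\<in>coset B x. \<Union>t\<in>coset B y. {\<lambda>e. s e + t e})"
    then obtain b b' where b: "b \<in> B" "b' \<in> B" and z: "z = (\<lambda>e. (b e + x e) + (b' e + y e))" by (auto simp: coset_def)
    have "(\<lambda>e. b e + b' e) \<in> B" using b B by (simp add: fun_submodule_def)
    then show "z \<in> coset B (\<lambda>e. x e + y e)" unfolding mem_coset_iff[OF B] z by (simp add: algebra_simps)
  next
    fix z assume "z \<in> coset B (\<lambda>e. x e + y e)"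
    then obtain b where b: "b \<in> B" "z = (\<lambda>e. (b e + x e) + (0 + y e))" by (auto simp: coset_def add.assoc)
    have "(\<lambda>e. b e + x e) \<in> coset B x" "(\<lambda>e. 0 + y e) \<in> coset B y"
      using b(1) B by (simp_all add: mem_coset_iff fun_submodule_def)
    then show "z \<in> (\<Union>s\<in>coset B x. \<Union>t\<in>coset B y. {\<lambda>e. s e + t e})" unfolding b(2) by blast
  qed
  finally show ?thesis .
qed

lemma quotient_smult: "r \<odot>\<^bsub>quot_module\<^esub> coset B x = coset B (\<lambda>e. r * x e)"
proof -
  have "coset B (\<lambda>e. r * s e) = coset B (\<lambda>e. r * x e)" if "s \<in> coset B x" for s
  proof -
    have "(\<lambda>e. s e - x e) \<in> B" using that mem_coset_iff[OF B] by blast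
    from fun_submodule_smult[OF B this] have "(\<lambda>e. r * (s e - x e)) \<in> B" .
    then show ?thesis unfolding coset_eq_iff[OF B] by (simp add: right_diff_distrib)
  qed
  moreover have "x \<in> coset B x" using B by (simp add: mem_coset_iff fun_submodule_def)
  ultimately have "(\<Union>s\<in>coset B x. coset B (\<lambda>e. r * s e)) = coset B (\<lambda>e. r * x e)"
    using UN_constant_eq[of x "coset B x"] by blast
  then show ?thesis by (simp add: quotient_module_def a_r_coset_eq)
qed

lemma coset_linear: "linear_map (fun_module Z) quot_module (coset B)"
  by (auto simp: linear_map_def quotient_carrier quotient_add quotient_smult)

lemma lmod_quotient: "lmod quot_module"
proof (rule lmod.intro)
  note cl = fun_submodule_zero[OF Z] fun_submodule_add[OF Z] fun_submodule_smult[OF Z]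
  have z: "\<zero>\<^bsub>quot_module\<^esub> = coset B (\<lambda>_. 0)" by (simp add: quotient_zero coset_zero)
  show "abelian_group quot_module"
  proof (rule abelian_groupI)
    fix S assume "S \<in> carrier quot_module"
    then obtain x where x: "x \<in> Z" "S = coset B x" by (auto simp: quotient_carrier)
    have "(\<lambda>e. 0 - x e) \<in> Z" using fun_submodule_diff[OF Z cl(1) x(1)] .
    then show "\<exists>y\<in>carrier quot_module. y \<oplus>\<^bsub>quot_module\<^esub> S = \<zero>\<^bsub>quot_module\<^esub>"
      unfolding x(2) by (intro bexI[of _ "coset B (\<lambda>e. 0 - x e)"]) (auto simp: quotient_add z quotient_carrier)
  qed (use cl in \<open>auto simp: quotient_carrier quotient_add z algebra_simps\<close>)
  show "lmod_axioms quot_module"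
    by (rule lmod_axioms.intro)
      (use cl in \<open>auto simp: quotient_carrier quotient_add quotient_smult algebra_simps\<close>)
qed

lemma exact_quotient: "exact_triple (fun_module B) (fun_module Z) quot_module (coset B)"
  unfolding exact_triple_def
proof (intro conjI)
  show "carrier (fun_module B) = {x \<in> carrier (fun_module Z). coset B x = \<zero>\<^bsub>quot_module\<^esub>}"
    using BZ by (auto simp: quotient_zero coset_eq_zero_iff[OF B])
qed (use fun_submodule_along[OF Z B BZ] lmod_quotient coset_linear in \<open>simp_all add: quotient_carrier\<close>)

end

section \<open>The index of a subgroup\<close>

definition add_subgroup :: "'g::ab_group_add set \<Rightarrow> bool" where
  "add_subgroup S \<longleftrightarrow> 0 \<in> S \<and> (\<forall>x\<in>S. \<forall>y\<in>S. x - y \<in> S)"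

text \<open>The number of cosets \<open>x + K\<close> with \<open>x\<close> in \<open>G\<close>, which is 0 if
there are infinitely many.\<close>

definition sub_index :: "'g::ab_group_add set \<Rightarrow> 'g set \<Rightarrow> nat" where
  "sub_index G K = card ((\<lambda>x. {y. y - x \<in> K}) ` G)"

lemma add_subgroup_diff: "add_subgroup S \<Longrightarrow> x \<in> S \<Longrightarrow> y \<in> S \<Longrightarrow> x - y \<in> S"
  and add_subgroup_zero: "add_subgroup S \<Longrightarrow> 0 \<in> S"
  by (simp_all add: add_subgroup_def)

lemma add_subgroup_uminus: "add_subgroup S \<Longrightarrow> x \<in> S \<Longrightarrow> - x \<in> S"
  using add_subgroup_diff[of S 0 x] add_subgroup_zero[of S] by simp

lemma add_subgroup_add: "add_subgroup S \<Longrightarrow> x \<in> S \<Longrightarrow> y \<in> S \<Longrightarrow> x + y \<in> S"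
  using add_subgroup_diff[of S x "- y"] add_subgroup_uminus[of S y] by simp

lemma same_coset_iff:
  assumes "add_subgroup K" shows "{z. z - x \<in> K} = {z. z - y \<in> K} \<longleftrightarrow> x - y \<in> K"
proof
  assume "{z. z - x \<in> K} = {z. z - y \<in> K}"
  moreover have "x \<in> {z. z - x \<in> K}" using assms by (simp add: add_subgroup_zero)
  ultimately show "x - y \<in> K" by blast
next
  assume a: "x - y \<in> K"
  have "z - x \<in> K \<longleftrightarrow> z - y \<in> K" for z
    using add_subgroup_add[OF assms _ a, of "z - x"] add_subgroup_diff[OF assms _ a, of "z - y"] by auto
  then show "{z. z - x \<in> K} = {z. z - y \<in> K}" by simp
qed

lemma sub_index_transversal:
  assumes "add_subgroup K" "g ` P \<subseteq> G" "\<And>x. x \<in> G \<Longrightarrow> \<exists>!p. p \<in> P \<and> x - g p \<in> K"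
  shows "sub_index G K = card P"
proof -
  have "bij_betw (\<lambda>p. {z. z - g p \<in> K}) P ((\<lambda>x. {y. y - x \<in> K}) ` G)"
    unfolding bij_betw_def
  proof
    show "inj_on (\<lambda>p. {z. z - g p \<in> K}) P"
    proof (rule inj_onI)
      fix p q assume p: "p \<in> P" and q: "q \<in> P" and "{z. z - g p \<in> K} = {z. z - g q \<in> K}"
      then have "g p - g q \<in> K" by (simp add: same_coset_iff[OF assms(1)])
      moreover have "g p - g p \<in> K" using assms(1) by (simp add: add_subgroup_zero)
      moreover have "\<exists>!r. r \<in> P \<and> g p - g r \<in> K" using assms(2,3) p by blast
      ultimately show "p = q" using p q by blast
    qed
    show "(\<lambda>p. {z. z - g p \<in> K}) ` P = (\<lambda>x. {y. y - x \<in> K}) ` G"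
    proof
      show "(\<lambda>p. {z. z - g p \<in> K}) ` P \<subseteq> (\<lambda>x. {y. y - x \<in> K}) ` G" using assms(2) by blast
      show "(\<lambda>x. {y. y - x \<in> K}) ` G \<subseteq> (\<lambda>p. {z. z - g p \<in> K}) ` P"
      proof
        fix S assume "S \<in> (\<lambda>x. {y. y - x \<in> K}) ` G"
        then obtain x where x: "x \<in> G" "S = {y. y - x \<in> K}" by auto
        then obtain p where "p \<in> P" "x - g p \<in> K" using assms(3) by blast
        then show "S \<in> (\<lambda>p. {z. z - g p \<in> K}) ` P"
          using x(2) same_coset_iff[OF assms(1), of x "g p"] by auto
      qed
    qed
  qed
  then show ?thesis unfolding sub_index_def by (simp add: bij_betw_same_card)
qed

lemma transversal_exists:
  assumes "add_subgroup K"
  obtains R where "R \<subseteq> G" "\<And>x. x \<in> G \<Longrightarrow> \<exists>!r. r \<in> R \<and> x - r \<in> K" "sub_index G K = card R"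
proof -
  define r where "r S = (SOME x. x \<in> G \<and> {y. y - x \<in> K} = S)" for S
  have r: "r {y. y - x \<in> K} \<in> G" "x - r {y. y - x \<in> K} \<in> K" if "x \<in> G" for x
  proof -
    have "\<exists>x'. x' \<in> G \<and> {y. y - x' \<in> K} = {y. y - x \<in> K}" using that by blast
    from someI_ex[OF this] have "r {y. y - x \<in> K} \<in> G \<and> {y. y - r {y. y - x \<in> K} \<in> K} = {y. y - x \<in> K}"
      unfolding r_def .
    then show "r {y. y - x \<in> K} \<in> G" "x - r {y. y - x \<in> K} \<in> K"
      using same_coset_iff[OF assms, of x "r {y. y - x \<in> K}"] by blast+
  qed
  define R where "R = (\<lambda>x. r {y. y - x \<in> K}) ` G"
  have R: "R \<subseteq> G" using r(1) by (auto simp: R_def)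
  have u: "\<exists>!p. p \<in> R \<and> x - p \<in> K" if "x \<in> G" for x
  proof (rule ex1I[of _ "r {y. y - x \<in> K}"])
    show "r {y. y - x \<in> K} \<in> R \<and> x - r {y. y - x \<in> K} \<in> K" using r that by (auto simp: R_def)
    fix p assume p: "p \<in> R \<and> x - p \<in> K"
    then obtain x' where x': "x' \<in> G" "p = r {y. y - x' \<in> K}" by (auto simp: R_def)
    have "x' - p \<in> K" using r(2)[OF x'(1)] x'(2) by simp
    with p have "(x - p) - (x' - p) \<in> K" using add_subgroup_diff[OF assms] by blast
    then have "x - x' \<in> K" by simp
    then have "{y. y - x \<in> K} = {y. y - x' \<in> K}" by (simp add: same_coset_iff[OF assms])
    then show "p = r {y. y - x \<in> K}" using x'(2) by simp
  qed
  show ?thesis using that[OF R u] sub_index_transversal[OF assms, of "\<lambda>x. x" R G] R u by auto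
qed

text \<open>A coset of \<open>K\<close> is pinned down in two steps. First comes the coset of its image modulo
\<open>f ` K\<close>. After subtracting a representative, an element of the coset lies in the
kernel up to an element of \<open>K\<close>, and its class there is the second datum.\<close>

theorem sub_index_hom:
  assumes f: "\<And>x y. x \<in> G \<Longrightarrow> y \<in> G \<Longrightarrow> f (x - y) = f x - f y"
    and G: "add_subgroup G" and K: "add_subgroup K" "K \<subseteq> G"
  shows "sub_index G K = sub_index (f ` G) (f ` K) * sub_index {x \<in> G. f x = 0} {x \<in> K. f x = 0}"
proof -
  have f0: "f 0 = 0" using f[of 0 0] G by (simp add: add_subgroup_zero)
  have fadd: "f (x + y) = f x + f y" if "x \<in> G" "y \<in> G" for x y
    using f[of x "- y"] f[of 0 y] that G f0 by (simp add: add_subgroup_uminus add_subgroup_zero)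
  have fK: "add_subgroup (f ` K)"
    unfolding add_subgroup_def
  proof (intro conjI ballI)
    show "0 \<in> f ` K" using f0 K by (metis add_subgroup_zero imageI)
    fix x y assume "x \<in> f ` K" "y \<in> f ` K"
    then obtain a b where "a \<in> K" "b \<in> K" "x = f a" "y = f b" by blast
    then have "x - y = f (a - b)" "a - b \<in> K" using f K by (auto simp: add_subgroup_diff subset_iff)
    then show "x - y \<in> f ` K" by blast
  qed
  have kK: "add_subgroup {x \<in> K. f x = 0}"
    using K f f0 by (auto simp: add_subgroup_def subset_iff)
  obtain R1 where R1: "R1 \<subseteq> f ` G" "\<And>x. x \<in> f ` G \<Longrightarrow> \<exists>!r. r \<in> R1 \<and> x - r \<in> f ` K" "sub_index (f ` G) (f ` K) = card R1"
    by (rule transversal_exists[OF fK, of "f ` G"]) (rule that)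
  obtain R2 where R2: "R2 \<subseteq> {x \<in> G. f x = 0}" "\<And>x. x \<in> {x \<in> G. f x = 0} \<Longrightarrow> \<exists>!r. r \<in> R2 \<and> x - r \<in> {x \<in> K. f x = 0}"
     "sub_index {x \<in> G. f x = 0} {x \<in> K. f x = 0} = card R2"
    by (rule transversal_exists[OF kK, of "{x \<in> G. f x = 0}"]) (rule that)
  obtain g where g: "\<And>y. y \<in> f ` G \<Longrightarrow> g y \<in> G \<and> f (g y) = y" using bchoice[of "f ` G" "\<lambda>y x. x \<in> G \<and> f x = y"] by blast
  have "sub_index G K = card (R1 \<times> R2)"
  proof (rule sub_index_transversal[OF K(1), of "\<lambda>(r, s). g r + s"])
    show "(\<lambda>(r, s). g r + s) ` (R1 \<times> R2) \<subseteq> G"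
      using R1(1) R2(1) g by (auto intro!: add_subgroup_add[OF G])
    fix x assume x: "x \<in> G"
    obtain r where r: "r \<in> R1" "f x - r \<in> f ` K" and ru: "\<And>r'. r' \<in> R1 \<Longrightarrow> f x - r' \<in> f ` K \<Longrightarrow> r' = r"
      using R1(2)[of "f x"] x by blast
    have gr: "g r \<in> G" "f (g r) = r" using g R1(1) r(1) by auto
    obtain k where k: "k \<in> K" "f x - r = f k" using r(2) by blast
    have kG: "k \<in> G" using k K by blast
    let ?y = "x - g r - k"
    have y: "?y \<in> {x \<in> G. f x = 0}"
      using x gr kG k(2) G by (simp add: f add_subgroup_diff)
    obtain s where s: "s \<in> R2" "?y - s \<in> {x \<in> K. f x = 0}" and su: "\<And>s'. s' \<in> R2 \<Longrightarrow> ?y - s' \<in> {x \<in> K. f x = 0} \<Longrightarrow> s' = s"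
      using R2(2)[OF y] by blast
    show "\<exists>!p. p \<in> R1 \<times> R2 \<and> x - (case p of (r, s) \<Rightarrow> g r + s) \<in> K"
    proof (rule ex1I[of _ "(r, s)"])
      have "?y - s \<in> K" using s(2) by blast
      then have "(?y - s) + k \<in> K" using k(1) by (rule add_subgroup_add[OF K(1)])
      moreover have "(?y - s) + k = x - (g r + s)" by (simp add: algebra_simps)
      ultimately show "(r, s) \<in> R1 \<times> R2 \<and> x - (case (r, s) of (r, s) \<Rightarrow> g r + s) \<in> K"
        using r(1) s(1) by simp
      fix p assume p: "p \<in> R1 \<times> R2 \<and> x - (case p of (r, s) \<Rightarrow> g r + s) \<in> K"
      obtain r' s' where rs: "p = (r', s')" by force
      then have m: "r' \<in> R1" "s' \<in> R2" "x - (g r' + s') \<in> K" using p by auto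
      have s': "s' \<in> G" "f s' = 0" and gr': "g r' \<in> G" "f (g r') = r'" using m R1(1) R2(1) g by auto
      have "f (x - (g r' + s')) = f x - r'"
        using x s' gr' G by (simp add: f fadd add_subgroup_add)
      then have "f x - r' \<in> f ` K" using m(3) by (metis imageI)
      then have rr: "r' = r" using ru m(1) by blast
      have "?y - s' = (x - (g r' + s')) - k" using rr by (simp add: algebra_simps)
      also have "\<dots> \<in> K" using m(3) k(1) K by (simp add: add_subgroup_diff)
      finally have "?y - s' \<in> K" .
      moreover have "f (?y - s') = 0" using y s' by (simp add: f)
      ultimately have "s' = s" using su m(2) by blast
      then show "p = (r, s)" using rs rr by simp
    qed
  qed
  then show ?thesis using R1(3) R2(3) by (simp add: card_cartesian_product)
qed

theorem sub_index_tower: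
  assumes G: "add_subgroup G" and H: "add_subgroup H" "H \<subseteq> G" and K: "add_subgroup K" "K \<subseteq> H"
  shows "sub_index G K = sub_index G H * sub_index H K"
proof -
  obtain R1 where R1: "R1 \<subseteq> G" "\<And>x. x \<in> G \<Longrightarrow> \<exists>!r. r \<in> R1 \<and> x - r \<in> H" "sub_index G H = card R1"
    by (rule transversal_exists[OF H(1), of G]) (rule that)
  obtain R2 where R2: "R2 \<subseteq> H" "\<And>x. x \<in> H \<Longrightarrow> \<exists>!r. r \<in> R2 \<and> x - r \<in> K" "sub_index H K = card R2"
    by (rule transversal_exists[OF K(1), of H]) (rule that)
  have "sub_index G K = card (R1 \<times> R2)"
  proof (rule sub_index_transversal[OF K(1), of "\<lambda>(r, s). r + s"])
    show "(\<lambda>(r, s). r + s) ` (R1 \<times> R2) \<subseteq> G"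
      using R1(1) R2(1) H by (auto intro!: add_subgroup_add[OF G])
    fix x assume x: "x \<in> G"
    obtain r where r: "r \<in> R1" "x - r \<in> H" and ru: "\<And>r'. r' \<in> R1 \<Longrightarrow> x - r' \<in> H \<Longrightarrow> r' = r"
      using R1(2)[OF x] by blast
    obtain s where s: "s \<in> R2" "(x - r) - s \<in> K" and su: "\<And>s'. s' \<in> R2 \<Longrightarrow> (x - r) - s' \<in> K \<Longrightarrow> s' = s"
      using R2(2)[OF r(2)] by blast
    show "\<exists>!p. p \<in> R1 \<times> R2 \<and> x - (case p of (r, s) \<Rightarrow> r + s) \<in> K"
    proof (rule ex1I[of _ "(r, s)"])
      show "(r, s) \<in> R1 \<times> R2 \<and> x - (case (r, s) of (r, s) \<Rightarrow> r + s) \<in> K"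
        using r s by (simp add: diff_diff_eq)
      fix p assume p: "p \<in> R1 \<times> R2 \<and> x - (case p of (r, s) \<Rightarrow> r + s) \<in> K"
      obtain r' s' where rs: "p = (r', s')" by force
      then have m: "r' \<in> R1" "s' \<in> R2" "x - (r' + s') \<in> K" using p by auto
      have "x - (r' + s') \<in> H" "s' \<in> H" using m K(2) R2(1) by auto
      from add_subgroup_add[OF H(1) this] have "(x - (r' + s')) + s' \<in> H" .
      then have "x - r' \<in> H" by (simp add: algebra_simps)
      then have rr: "r' = r" using ru m(1) by blast
      then have "s' = s" using su m(2,3) by (simp add: diff_diff_eq)
      then show "p = (r, s)" using rs rr by simp
    qed
  qed
  then show ?thesis using R1(3) R2(3) by (simp add: card_cartesian_product)
qed

lemma sub_index_self: "add_subgroup G \<Longrightarrow> sub_index G G = 1"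
  by (subst sub_index_transversal[of G "\<lambda>_. 0" "{()}"]) (auto simp: add_subgroup_zero)

text \<open>Elements of \<open>S\<close> that are congruent modulo \<open>K\<close> are congruent modulo
\<open>K'\<close>, so there are at most as many classes in \<open>S\<close> as in
\<open>G\<close>.\<close>

lemma sub_index_Int_nonzero:
  assumes "sub_index G K \<noteq> 0" "S \<subseteq> G" "S \<noteq> {}" "K' \<subseteq> K" "add_subgroup K" "add_subgroup K'"
    "\<And>x y. x \<in> S \<Longrightarrow> y \<in> S \<Longrightarrow> x - y \<in> K \<Longrightarrow> x - y \<in> K'"
  shows "sub_index S K' \<noteq> 0"
proof -
  have fin: "finite ((\<lambda>x. {y. y - x \<in> K}) ` G)" using assms(1) unfolding sub_index_def by (metis card.infinite)
  let ?h = "\<lambda>C. {y. \<exists>x\<in>S. {y. y - x \<in> K} = C \<and> y - x \<in> K'}"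
  have "(\<lambda>x. {y. y - x \<in> K'}) ` S \<subseteq> ?h ` ((\<lambda>x. {y. y - x \<in> K}) ` G)"
  proof
    fix C assume "C \<in> (\<lambda>x. {y. y - x \<in> K'}) ` S"
    then obtain x where x: "x \<in> S" "C = {y. y - x \<in> K'}" by auto
    have "C = ?h {y. y - x \<in> K}"
    proof (intro Set.set_eqI iffI)
      fix y assume "y \<in> C" then show "y \<in> ?h {y. y - x \<in> K}" using x by blast
    next
      fix y assume "y \<in> ?h {y. y - x \<in> K}"
      then obtain x' where x': "x' \<in> S" "{y. y - x' \<in> K} = {y. y - x \<in> K}" "y - x' \<in> K'" by auto
      then have "x' - x \<in> K" using same_coset_iff[OF assms(5)] by blast
      then have "x' - x \<in> K'" using assms(7) x x' by blast
      then have "(y - x') + (x' - x) \<in> K'" using x'(3) assms(6) by (intro add_subgroup_add)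
      then show "y \<in> C" using x(2) by simp
    qed
    then show "C \<in> ?h ` ((\<lambda>x. {y. y - x \<in> K}) ` G)" using x(1) assms(2) by blast
  qed
  then have "finite ((\<lambda>x. {y. y - x \<in> K'}) ` S)" using fin by (meson finite_imageI finite_subset)
  then show ?thesis using assms(3) unfolding sub_index_def by simp
qed

lemma fun_submodule_add_subgroup: "fun_submodule S \<Longrightarrow> add_subgroup S"
  using fun_submodule_diff[of S] fun_submodule_zero[of S]
  by (simp add: add_subgroup_def fun_diff_def zero_fun_def)

lemma coset_eq_class: "fun_submodule B \<Longrightarrow> coset B x = {y. y - x \<in> B}"
  using mem_coset_iff[of B] by (auto simp: fun_diff_def)

section \<open>Freeness of submodules\<close>

definition supported :: "'c set \<Rightarrow> ('c \<Rightarrow> 'r::comm_ring_1) set" where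
  "supported E = {c. \<forall>e. e \<notin> E \<longrightarrow> c e = 0}"

definition basis_fun :: "'c \<Rightarrow> 'c \<Rightarrow> 'r::comm_ring_1" where
  "basis_fun e = (\<lambda>f. if f = e then 1 else 0)"

lemma fun_submodule_supported: "fun_submodule (supported E)"
  by (simp add: fun_submodule_def supported_def)

lemma basis_fun_supported: "e \<in> E \<Longrightarrow> basis_fun e \<in> supported E"
  by (auto simp: basis_fun_def supported_def)

lemma sum_basis_fun:
  assumes "distinct es"
  shows "(\<Sum>i<length es. a i * basis_fun (es ! i) e)
     = (if e \<in> set es then a (THE i. i < length es \<and> es ! i = e) else (0 :: 'r::comm_ring_1))"
proof (cases "e \<in> set es")
  case True
  then obtain i where i: "i < length es" "es ! i = e" by (auto simp: in_set_conv_nth)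
  then have the: "(THE i. i < length es \<and> es ! i = e) = i"
    using assms by (auto simp: nth_eq_iff_index_eq)
  have "(\<Sum>j<length es. a j * basis_fun (es ! j) e) = (\<Sum>j<length es. if j = i then a j else 0)"
    using i assms by (intro sum.cong) (auto simp: basis_fun_def nth_eq_iff_index_eq)
  then show ?thesis using i True the by simp
next
  case False
  then have "basis_fun (es ! i) e = (0::'r)" if "i < length es" for i
    using that by (auto simp: basis_fun_def)
  then show ?thesis using False by simp
qed

lemma basis_funs:
  assumes "distinct es"
  shows "module_basis (fun_module (supported (set es)) :: ('r::comm_ring_1, _) module) (map basis_fun es)"
proof -
  let ?M = "fun_module (supported (set es)) :: ('r, _) module"
  interpret lmod ?M by (rule lmod_fun_module[OF fun_submodule_supported])
  have s: "set (map basis_fun es :: (_ \<Rightarrow> 'r) list) \<subseteq> supported (set es)" by (auto intro: basis_fun_supported)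
  have lc: "lin_comb ?M (map basis_fun es) a = (\<lambda>e. \<Sum>i<length es. a i * basis_fun (es ! i) e)" for a
    by (subst lin_comb_fun_module[OF fun_submodule_supported s]) simp
  have lci: "lin_comb ?M (map basis_fun es) a (es ! i) = a i" if "i < length es" for a i
  proof -
    have "(THE j. j < length es \<and> es ! j = es ! i) = i"
      using that assms by (auto simp: nth_eq_iff_index_eq)
    then show ?thesis using that unfolding lc sum_basis_fun[OF assms] by simp
  qed
  show ?thesis unfolding module_basis_iff
  proof (intro conjI ballI)
    show "set (map basis_fun es) \<subseteq> carrier ?M" using s by simp
    show "indep (map basis_fun es)" unfolding indep_def
    proof (intro allI impI)
      fix a i assume "lin_comb ?M (map basis_fun es) a = \<zero>\<^bsub>?M\<^esub>" "i < length (map basis_fun es :: (_ \<Rightarrow> 'r) list)"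
      then show "a i = 0" using lci[of i a] by simp
    qed
    fix x assume "x \<in> carrier ?M"
    then have x: "e \<notin> set es \<Longrightarrow> x e = 0" for e by (simp add: supported_def)
    have "x e = lin_comb ?M (map basis_fun es) (\<lambda>i. x (es ! i)) e" for e
    proof (cases "e \<in> set es")
      case True
      then obtain i where "i < length es" "es ! i = e" by (auto simp: in_set_conv_nth)
      then show ?thesis using lci[of i] by auto
    next
      case False
      then show ?thesis using x unfolding lc sum_basis_fun[OF assms] by simp
    qed
    then show "\<exists>a. x = lin_comb ?M (map basis_fun es) a" by blast
  qed
qed

lemma coords_basis_funs:
  assumes "distinct es" "x \<in> supported (set es)" "i < length es"
  shows "coords (fun_module (supported (set es)) :: ('r::comm_ring_1, _) module) (map basis_fun es) x i = x (es ! i)"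
proof -
  let ?M = "fun_module (supported (set es)) :: ('r, _) module"
  interpret lmod ?M by (rule lmod_fun_module[OF fun_submodule_supported])
  have s: "set (map basis_fun es :: (_ \<Rightarrow> 'r) list) \<subseteq> supported (set es)" by (auto intro: basis_fun_supported)
  have "x = lin_comb ?M (map basis_fun es) (coords ?M (map basis_fun es) x)"
    using lin_comb_coords[OF basis_funs[OF assms(1)]] assms(2) by simp
  also have "\<dots> = (\<lambda>e. \<Sum>i<length es. coords ?M (map basis_fun es) x i * basis_fun (es ! i) e)"
    by (subst lin_comb_fun_module[OF fun_submodule_supported s]) simp
  finally have "x (es ! i) = (\<Sum>j<length es. coords ?M (map basis_fun es) x j * basis_fun (es ! j) (es ! i))"
    by metis
  also have "\<dots> = coords ?M (map basis_fun es) x i"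
  proof -
    have "(THE j. j < length es \<and> es ! j = es ! i) = i"
      using assms(1,3) by (auto simp: nth_eq_iff_index_eq)
    then show ?thesis using assms(3) unfolding sum_basis_fun[OF assms(1)] by simp
  qed
  finally show ?thesis by simp
qed

lemma basis_matrix_basis_funs:
  assumes "distinct es" "set vs \<subseteq> supported (set es)"
  shows "basis_matrix (fun_module (supported (set es)) :: ('r::comm_ring_1, _) module) (map basis_fun es) vs
    = Matrix.mat (length es) (length vs) (\<lambda>(i, j). (vs ! j) (es ! i))"
  using assms(2) by (auto simp: basis_matrix_def coords_basis_funs[OF assms(1)] subset_iff)

text \<open>Every ideal is principal. This is the property of $\mathbb{Z}$ and $\mathbb{R}$ that makes
submodules of $R^n$ free; stated for ideals as sets, it covers both rings.\<close>

definition principal_ideals :: "'r::comm_ring_1 itself \<Rightarrow> bool" where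
  "principal_ideals _ \<longleftrightarrow> (\<forall>I::'r set. 0 \<in> I \<longrightarrow> (\<forall>x\<in>I. \<forall>y\<in>I. x + y \<in> I) \<longrightarrow> (\<forall>r. \<forall>x\<in>I. r * x \<in> I) \<longrightarrow>
     (\<exists>d\<in>I. \<forall>x\<in>I. d dvd x))"

lemma principal_ideals_real: "principal_ideals TYPE(real)"
  unfolding principal_ideals_def
proof (intro allI impI)
  fix I :: "real set" assume "0 \<in> I"
  then show "\<exists>d\<in>I. \<forall>x\<in>I. d dvd x"
    by (cases "I = {0}") (auto simp: dvd_field_iff)
qed

lemma principal_ideals_int: "principal_ideals TYPE(int)"
  unfolding principal_ideals_def
proof (intro allI impI)
  fix I :: "int set"
  assume I: "0 \<in> I" "\<forall>x\<in>I. \<forall>y\<in>I. x + y \<in> I" "\<forall>r. \<forall>x\<in>I. r * x \<in> I"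
  show "\<exists>d\<in>I. \<forall>x\<in>I. d dvd x"
  proof (cases "I = {0}")
    case False
    then obtain x where x: "x \<in> I" "x \<noteq> 0" using I(1) by auto
    have "(-1) * x \<in> I" using I(3) x(1) by blast
    then have "\<exists>n::nat. n > 0 \<and> int n \<in> I"
      using x by (intro exI[of _ "nat \<bar>x\<bar>"]) (auto simp: abs_if)
    define d where "d = (LEAST n::nat. n > 0 \<and> int n \<in> I)"
    have d: "d > 0" "int d \<in> I"
      using LeastI_ex[OF \<open>\<exists>n::nat. n > 0 \<and> int n \<in> I\<close>] by (auto simp: d_def)
    have "int d dvd y" if y: "y \<in> I" for y
    proof (rule ccontr)
      assume "\<not> int d dvd y"
      then have p: "y mod int d > 0" using d(1) by (metis dvd_eq_mod_eq_0 of_nat_0_less_iff pos_mod_sign order_le_imp_less_or_eq)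
      have "(- (y div int d)) * int d \<in> I" using I(3) d(2) by blast
      then have "y + (- (y div int d)) * int d \<in> I" using I(2) y by blast
      then have "y mod int d \<in> I" by (simp add: minus_div_mult_eq_mod)
      then have "nat (y mod int d) > 0 \<and> int (nat (y mod int d)) \<in> I" using p by simp
      then have "d \<le> nat (y mod int d)" using Least_le[of "\<lambda>n. n > 0 \<and> int n \<in> I"] by (simp only: d_def)
      then show False using d(1) pos_mod_bound[of "int d" y] p by linarith
    qed
    then show ?thesis using d(2) by blast
  qed auto
qed

lemma fun_submodule_restrict: "fun_submodule L \<Longrightarrow> fun_submodule {c \<in> L. c e = 0}"
  by (auto simp: fun_submodule_def)

text \<open>The value of a function at \<open>e\<close>, kept as a function supported on \<open>e\<close>, so
that the values again form a module of functions.\<close>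

definition eval_at :: "'c \<Rightarrow> ('c \<Rightarrow> 'r::comm_ring_1) \<Rightarrow> 'c \<Rightarrow> 'r" where
  "eval_at e c = (\<lambda>x. if x = e then c e else 0)"

lemma fun_submodule_eval_at: "fun_submodule L \<Longrightarrow> fun_submodule (eval_at e ` L)"
  by (rule fun_submodule_image) (auto simp: eval_at_def)

lemma exact_eval_at:
  assumes "fun_submodule L"
  shows "exact_triple (fun_module {c \<in> L. c e = 0}) (fun_module L) (fun_module (eval_at e ` L)) (eval_at e)"
  unfolding exact_triple_def
proof (intro conjI)
  show "submodule_along (\<lambda>r. r) (fun_module {c \<in> L. c e = 0}) (fun_module L)"
    by (rule fun_submodule_along) (auto simp: assms fun_submodule_restrict)
  show "lmod (fun_module (eval_at e ` L))" by (intro lmod_fun_module fun_submodule_eval_at assms)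
  show "carrier (fun_module {c \<in> L. c e = 0}) = {x \<in> carrier (fun_module L). eval_at e x = \<zero>\<^bsub>fun_module (eval_at e ` L)\<^esub>}"
    by (auto simp: eval_at_def fun_eq_iff)
qed (auto simp: linear_map_def eval_at_def fun_eq_iff)

text \<open>The values at \<open>e\<close> of the elements of \<open>L\<close> form a principal ideal. Either
it is 0, or an element \<open>w\<close>
of \<open>L\<close> realising a generator splits the evaluation at \<open>e\<close>.\<close>

lemma peel_basis:
  fixes L :: "('c \<Rightarrow> 'r::idom) set"
  assumes "principal_ideals TYPE('r)" and L: "fun_submodule L"
  obtains "L = {c \<in> L. c e = 0}"
  | w where "w \<in> L" "w e \<noteq> 0" "module_basis (fun_module (eval_at e ` L)) [eval_at e w]" "\<And>c. c \<in> L \<Longrightarrow> w e dvd c e"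
proof -
  let ?I = "(\<lambda>c. c e) ` L"
  have "\<exists>d\<in>?I. \<forall>x\<in>?I. d dvd x"
  proof -
    have I0: "0 \<in> ?I" by (rule rev_image_eqI[OF fun_submodule_zero[OF L]]) simp
    have Ia: "\<forall>x\<in>?I. \<forall>y\<in>?I. x + y \<in> ?I"
    proof (intro ballI)
      fix x y assume "x \<in> ?I" "y \<in> ?I"
      then obtain a b where ab: "a \<in> L" "b \<in> L" "x = a e" "y = b e" by blast
      show "x + y \<in> ?I" by (rule rev_image_eqI[OF fun_submodule_add[OF L ab(1,2)]]) (simp add: ab)
    qed
    have Im: "\<forall>r. \<forall>x\<in>?I. r * x \<in> ?I"
    proof (intro allI ballI)
      fix r x assume "x \<in> ?I"
      then obtain a where a: "a \<in> L" "x = a e" by blast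
      show "r * x \<in> ?I" by (rule rev_image_eqI[OF fun_submodule_smult[OF L a(1), of r]]) (simp add: a)
    qed
    show ?thesis
      by (rule assms(1)[unfolded principal_ideals_def, THEN spec[of _ ?I], THEN mp, THEN mp, THEN mp, OF I0 Ia Im])
  qed
  then obtain w where w: "w \<in> L" "\<And>c. c \<in> L \<Longrightarrow> w e dvd c e" by blast
  show ?thesis
  proof (cases "w e = 0")
    case True
    then have "L = {c \<in> L. c e = 0}" using w(2) by auto
    then show ?thesis by (rule that(1))
  next
    case False
    let ?P = "fun_module (eval_at e ` L)"
    have sP: "fun_submodule (eval_at e ` L)" by (rule fun_submodule_eval_at[OF L])
    interpret P: lmod ?P by (rule lmod_fun_module[OF sP])
    have s: "set [eval_at e w] \<subseteq> eval_at e ` L" using w(1) by simp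
    have "module_basis ?P [eval_at e w]" unfolding P.module_basis_iff
    proof (intro conjI ballI)
      show "P.indep [eval_at e w]" unfolding P.indep_def lin_comb_fun_module[OF sP s]
        using False by (auto simp: eval_at_def fun_eq_iff split: if_splits)
      fix x assume "x \<in> carrier ?P"
      then obtain c where c: "c \<in> L" "x = eval_at e c" by auto
      then obtain r where "c e = w e * r" using w(2) by (auto elim: dvdE)
      then show "\<exists>a. x = lin_comb ?P [eval_at e w] a" unfolding lin_comb_fun_module[OF sP s] c(2)
        by (intro exI[of _ "\<lambda>_. r"]) (auto simp: eval_at_def mult.commute)
    qed (use s in simp)
    with w False show ?thesis by (intro that(2)) auto
  qed
qed

text \<open>Coordinate by coordinate: the elements of \<open>L\<close> vanishing at the last one have a basis
by induction, and at most one vector with a nonzero value there completes it. The basis is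
triangular in this sense, which keeps it independent after mapping its entries to the reals by an
injection \<open>\<phi>\<close>, as stated by the last conjunct. The maps to have in mind are
\<open>real_of_int\<close> and the identity.\<close>

lemma fun_submodule_free:
  fixes L :: "('c \<Rightarrow> 'r::idom) set" and \<phi> :: "'r \<Rightarrow> real"
  assumes pid: "principal_ideals TYPE('r)" and \<phi>: "\<phi> 0 = 0" "\<And>x. \<phi> x = 0 \<Longrightarrow> x = 0"
    and "fun_submodule L" "L \<subseteq> supported (set es)"
  shows "\<exists>ws. module_basis (fun_module L) ws \<and> length ws \<le> length es \<and>
     (\<forall>a. (\<forall>e. (\<Sum>i<length ws. a i * \<phi> ((ws ! i) e)) = 0) \<longrightarrow> (\<forall>i<length ws. a i = 0))"
  using assms(4,5)
proof (induction es arbitrary: L rule: rev_induct)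
  case Nil
  interpret lmod "fun_module L" by (rule lmod_fun_module[OF Nil(1)])
  have "module_basis (fun_module L) []"
    using Nil(2) unfolding module_basis_iff indep_def by (auto simp: supported_def)
  then show ?case by (intro exI[of _ "[]"]) simp
next
  case (snoc e es)
  let ?K = "{c \<in> L. c e = 0}"
  have "?K \<subseteq> supported (set es)" using snoc.prems(2) by (auto simp: supported_def)
  from snoc.IH[OF fun_submodule_restrict[OF snoc.prems(1)] this]
  obtain ws where ws: "module_basis (fun_module ?K) ws" "length ws \<le> length es"
    "\<And>a. \<forall>e. (\<Sum>i<length ws. a i * \<phi> ((ws ! i) e)) = 0 \<Longrightarrow> \<forall>i<length ws. a i = 0" by blast
  show ?case
  proof (rule peel_basis[OF pid snoc.prems(1), of e])
    assume "L = ?K"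
    then show ?thesis using ws by (intro exI[of _ ws]) auto
  next
    fix w assume w: "w \<in> L" "w e \<noteq> 0" "module_basis (fun_module (eval_at e ` L)) [eval_at e w]"
    have "module_basis (fun_module L) (ws @ [w])"
      by (rule exact_basis[OF exact_eval_at[OF snoc.prems(1)] ws(1)]) (use w in auto)
    moreover have "\<forall>i<length (ws @ [w]). a i = 0"
      if a: "\<forall>x. (\<Sum>i<length (ws @ [w]). a i * \<phi> (((ws @ [w]) ! i) x)) = 0" for a
    proof -
      have sum: "(\<Sum>i<length ws. a i * \<phi> ((ws ! i) x)) + a (length ws) * \<phi> (w x) = 0" for x
      proof -
        have "(\<Sum>i<length ws. a i * \<phi> ((ws ! i) x)) = (\<Sum>i<length ws. a i * \<phi> (((ws @ [w]) ! i) x))"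
          by (intro sum.cong) (auto simp: nth_append)
        then show ?thesis using a[rule_format, of x] by simp
      qed
      have "(ws ! i) e = 0" if "i < length ws" for i
      proof -
        have "set ws \<subseteq> ?K" using ws(1) by (simp add: module_basis_def)
        then show ?thesis using that nth_mem by blast
      qed
      then have "(\<Sum>i<length ws. a i * \<phi> ((ws ! i) e)) = 0" using \<phi>(1) by simp
      with sum[of e] have "a (length ws) * \<phi> (w e) = 0" by simp
      then have z: "a (length ws) = 0" using w(2) \<phi>(2) by auto
      then have "\<forall>e. (\<Sum>i<length ws. a i * \<phi> ((ws ! i) e)) = 0" using sum by simp
      then have "\<forall>i<length ws. a i = 0" by (rule ws(3))
      then show ?thesis using z by (auto simp: less_Suc_eq)
    qed
    ultimately show ?thesis using ws(2) by (intro exI[of _ "ws @ [w]"]) simp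
  qed
qed

section \<open>Determinants as indices\<close>

definition fun_indep :: "('c \<Rightarrow> 'r::comm_ring_1) list \<Rightarrow> bool" where
  "fun_indep vs \<longleftrightarrow> (\<forall>a. (\<forall>e. (\<Sum>i<length vs. a i * (vs ! i) e) = 0) \<longrightarrow> (\<forall>i<length vs. a i = 0))"

lemma fun_module_basis_iff:
  assumes "fun_submodule S"
  shows "module_basis (fun_module S) bs \<longleftrightarrow>
    set bs \<subseteq> S \<and> fun_indep bs \<and> (\<forall>x\<in>S. \<exists>a. x = (\<lambda>e. \<Sum>i<length bs. a i * (bs ! i) e))"
proof -
  interpret lmod "fun_module S" by (rule lmod_fun_module[OF assms])
  show ?thesis
  proof (cases "set bs \<subseteq> S")
    case True
    show ?thesis
      unfolding module_basis_iff indep_def fun_indep_def lin_comb_fun_module[OF assms True]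
      by (simp add: fun_eq_iff)
  qed (simp add: module_basis_iff)
qed

abbreviation fun_span :: "('c \<Rightarrow> 'r::comm_ring_1) list \<Rightarrow> ('c \<Rightarrow> 'r) set" where
  "fun_span vs \<equiv> range (\<lambda>a e. \<Sum>i<length vs. a i * (vs ! i) e)"

lemma fun_submodule_span: "fun_submodule (fun_span vs)" (is "fun_submodule (range ?f)")
  unfolding fun_submodule_def
proof (intro conjI ballI allI)
  show "(\<lambda>_. 0) \<in> range ?f" by (rule range_eqI[of _ ?f "\<lambda>_. 0"]) simp
  fix c assume "c \<in> range ?f"
  then obtain a where a: "c = ?f a" by blast
  show "(\<lambda>x. r * c x) \<in> range ?f" for r
    by (rule range_eqI[of _ ?f "\<lambda>i. r * a i"]) (simp add: a sum_distrib_left ac_simps)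
  fix d assume "d \<in> range ?f"
  then obtain b where b: "d = ?f b" by blast
  show "(\<lambda>x. c x + d x) \<in> range ?f"
    by (rule range_eqI[of _ ?f "\<lambda>i. a i + b i"]) (simp add: a b sum.distrib algebra_simps)
qed

lemma set_subset_span:
  fixes vs :: "('c \<Rightarrow> 'r::comm_ring_1) list"
  shows "set vs \<subseteq> fun_span vs"
proof
  fix v assume "v \<in> set vs"
  then obtain j where j: "j < length vs" "vs ! j = v" by (auto simp: in_set_conv_nth)
  have "(\<Sum>i<length vs. (if i = j then 1 else 0) * (vs ! i) e) = v e" for e
    using j by (simp add: if_distrib[of "\<lambda>x. x * _"] cong: if_cong)
  then have "v = (\<lambda>e. \<Sum>i<length vs. (if i = j then 1 else 0) * (vs ! i) e)" by simp
  then show "v \<in> fun_span vs"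
    by (rule range_eqI[of _ "\<lambda>a e. \<Sum>i<length vs. a i * (vs ! i) e" "\<lambda>i. if i = j then 1 else 0"])
qed

lemma sum_append:
  "(\<Sum>i<length (us @ ws). a i * ((us @ ws) ! i) x)
     = (\<Sum>i<length us. a i * (us ! i) x) + (\<Sum>i<length ws. a (length us + i) * (ws ! i) x :: 'r::comm_ring_1)"
  by (induction ws rule: rev_induct) (simp_all add: nth_append add.assoc flip: append_assoc)

lemma basis_of_span:
  assumes "fun_indep vs"
  shows "module_basis (fun_module (fun_span vs)) vs"
  unfolding fun_module_basis_iff[OF fun_submodule_span] using assms set_subset_span by blast

lemma span_subset:
  assumes "fun_submodule S" "set vs \<subseteq> S" shows "fun_span vs \<subseteq> S"
proof -
  interpret lmod "fun_module S" by (rule lmod_fun_module[OF assms(1)])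
  show ?thesis using lin_comb_closed[of vs] assms(2) unfolding lin_comb_fun_module[OF assms] by auto
qed

lemma basis_span:
  assumes "fun_submodule S" "module_basis (fun_module S) vs"
  shows "fun_span vs = S"
  using assms span_subset[OF assms(1), of vs] unfolding fun_module_basis_iff[OF assms(1)] by blast

text \<open>The span of the vectors has a triangular basis, which stays independent over the reals, and the
matrix expressing the given vectors in it is invertible over the integers, hence over the reals.\<close>

theorem real_indep_if_int_indep:
  assumes vs: "fun_indep (vs :: ('c \<Rightarrow> int) list)" "set vs \<subseteq> supported E" and E: "finite E"
  shows "fun_indep (map real_chain vs)"
proof -
  let ?L = "fun_span vs"
  obtain es where es: "set es = E" using finite_list[OF E] by blast
  have L: "fun_submodule ?L" by (rule fun_submodule_span)
  interpret lmod "fun_module ?L" by (rule lmod_fun_module[OF L])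
  have "?L \<subseteq> supported (set es)"
    unfolding es by (rule span_subset[OF fun_submodule_supported vs(2)])
  from fun_submodule_free[OF principal_ideals_int _ _ L this, of real_of_int]
  obtain ws where ws: "module_basis (fun_module ?L) ws"
    and wsi: "\<And>a. \<forall>e. (\<Sum>i<length ws. a i * real_of_int ((ws ! i) e)) = 0 \<Longrightarrow> \<forall>i<length ws. a i = 0" by auto
  have vsb: "module_basis (fun_module ?L) vs" by (rule basis_of_span[OF vs(1)])
  let ?P = "basis_matrix (fun_module ?L) ws vs" and ?Q = "basis_matrix (fun_module ?L) vs ws"
  have QP: "(\<Sum>i<length ws. ?Q $$ (k, i) * ?P $$ (i, j)) = (if k = j then 1 else 0)"
    if "k < length vs" "j < length vs" for k j
    using arg_cong[OF basis_matrix_inverse[OF vsb ws], of "\<lambda>R. R $$ (k, j)"] that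
    by (simp add: scalar_prod_def lessThan_atLeast0 basis_matrix_def)
  have ws_sub: "set ws \<subseteq> ?L" using ws by (simp add: module_basis_def)
  have vsj: "(vs ! j) e = (\<Sum>i<length ws. ?P $$ (i, j) * (ws ! i) e)" if j: "j < length vs" for j e
  proof -
    have "vs ! j = lin_comb (fun_module ?L) ws (coords (fun_module ?L) ws (vs ! j))"
      using lin_comb_coords[OF ws, of "vs ! j"] vsb j nth_carrier[OF basis_carrier[OF vsb]] by simp
    also have "\<dots> = (\<lambda>e. \<Sum>i<length ws. coords (fun_module ?L) ws (vs ! j) i * (ws ! i) e)"
      by (rule lin_comb_fun_module[OF L ws_sub])
    finally have "(vs ! j) e = (\<Sum>i<length ws. coords (fun_module ?L) ws (vs ! j) i * (ws ! i) e)" by metis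
    then show ?thesis using j by (simp add: basis_matrix_def)
  qed
  show ?thesis unfolding fun_indep_def
  proof (intro allI impI)
    fix a :: "nat \<Rightarrow> real" and k
    assume a: "\<forall>e. (\<Sum>j<length (map real_chain vs). a j * (map real_chain vs ! j) e) = 0" and k: "k < length (map real_chain vs)"
    have "(\<Sum>i<length ws. (\<Sum>j<length vs. a j * of_int (?P $$ (i, j))) * real_of_int ((ws ! i) e)) = 0" for e
    proof -
      have "0 = (\<Sum>j<length vs. a j * real_of_int ((vs ! j) e))"
        using a by (simp add: real_chain_def)
      also have "\<dots> = (\<Sum>j<length vs. \<Sum>i<length ws. a j * of_int (?P $$ (i, j)) * real_of_int ((ws ! i) e))"
        by (intro sum.cong) (simp_all add: vsj sum_distrib_left ac_simps)
      finally show ?thesis unfolding sum_distrib_right by (subst sum.swap) simp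
    qed
    then have "\<forall>i<length ws. (\<Sum>j<length vs. a j * of_int (?P $$ (i, j))) = 0"
      by (intro wsi allI)
    then have z: "(\<Sum>j<length vs. a j * of_int (?P $$ (i, j))) = 0" if "i < length ws" for i
      using that by blast
    have "a k = (\<Sum>j<length vs. a j * of_int (if k = j then 1 else 0))"
      using k by (simp add: if_distrib[of "\<lambda>x. _ * of_int x"] cong: if_cong)
    also have "\<dots> = (\<Sum>j<length vs. a j * of_int (\<Sum>i<length ws. ?Q $$ (k, i) * ?P $$ (i, j)))"
      using QP k by (intro sum.cong) auto
    also have "\<dots> = (\<Sum>i<length ws. of_int (?Q $$ (k, i)) * (\<Sum>j<length vs. a j * of_int (?P $$ (i, j))))"
      unfolding sum_distrib_left of_int_sum by (subst sum.swap) (simp add: ac_simps)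
    also have "\<dots> = 0" using z by simp
    finally show "a k = 0" .
  qed
qed

text \<open>Coordinates with respect to a basis of the submodule, followed by those of that basis in the
module.\<close>

lemma sub_basis_matrix:
  assumes sub: "submodule_along (\<lambda>r. r) N M" and us: "module_basis M us" and ws: "module_basis N ws" and vs: "set vs \<subseteq> carrier N"
  shows "basis_matrix M us vs = basis_matrix M us ws * basis_matrix N ws vs"
proof -
  interpret M: lmod M using sub by (simp add: submodule_along_def)
  interpret N: lmod N by (rule submodule_along_lmod[OF sub])
  have wsN: "set ws \<subseteq> carrier N" by (rule N.basis_carrier[OF ws])
  have wsM: "set ws \<subseteq> carrier M" using wsN sub by (auto simp: submodule_along_def)
  show ?thesis
  proof (rule M.basis_matrix_lin_comb[OF us wsM])
    fix j assume j: "j < length vs"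
    then have v: "vs ! j \<in> carrier N" by (rule N.nth_carrier[OF vs])
    have "lin_comb M ws (\<lambda>i. basis_matrix N ws vs $$ (i, j)) = lin_comb M ws (coords N ws (vs ! j))"
      using j by (intro M.lin_comb_cong wsM) (simp add: basis_matrix_def)
    also have "\<dots> = vs ! j"
      using N.lin_comb_coords[OF ws v] by (simp add: submodule_along_lin_comb[OF sub wsN])
    finally show "vs ! j = lin_comb M ws (\<lambda>i. basis_matrix N ws vs $$ (i, j))" by simp
  qed simp
qed

lemma det_1x1: "Determinant.det (Matrix.mat 1 1 f) = (f (0, 0) :: 'r::comm_ring_1)"
  by (subst det_single) auto

text \<open>The determinant is a unit of $\mathbb{Z}$.\<close>

lemma abs_basis_det:
  fixes M :: "(int, 'm) module"
  assumes "lmod M" "module_basis M bs" "module_basis M vs"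
  shows "\<bar>Determinant.det (basis_matrix M bs vs)\<bar> = 1"
  using basis_det_inverse[OF assms] by (metis abs_zmult_eq_1 abs_1)

lemma sub_index_multiples:
  fixes d :: int assumes "d \<noteq> 0"
  shows "sub_index (supported {e} :: ('c \<Rightarrow> int) set) {c \<in> supported {e}. d dvd c e} = nat \<bar>d\<bar>"
proof -
  let ?g = "\<lambda>n x. if x = e then n else (0 :: int)"
  have "sub_index (supported {e} :: ('c \<Rightarrow> int) set) {c \<in> supported {e}. d dvd c e} = card {0..<\<bar>d\<bar>}"
  proof (rule sub_index_transversal[of _ ?g])
    show "add_subgroup {c \<in> supported {e}. d dvd c e}"
      by (auto simp: add_subgroup_def supported_def)
    show "?g ` {0..<\<bar>d\<bar>} \<subseteq> supported {e}" by (auto simp: supported_def)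
    fix x :: "'c \<Rightarrow> int" assume x: "x \<in> supported {e}"
    show "\<exists>!n. n \<in> {0..<\<bar>d\<bar>} \<and> x - ?g n \<in> {c \<in> supported {e}. d dvd c e}"
    proof (rule ex1I[of _ "x e mod \<bar>d\<bar>"])
      have "d dvd x e - x e mod \<bar>d\<bar>" by (metis abs_dvd_iff dvd_minus_mod)
      then show "x e mod \<bar>d\<bar> \<in> {0..<\<bar>d\<bar>} \<and> x - ?g (x e mod \<bar>d\<bar>) \<in> {c \<in> supported {e}. d dvd c e}"
        using assms x by (simp add: supported_def)
      fix n assume n: "n \<in> {0..<\<bar>d\<bar>} \<and> x - ?g n \<in> {c \<in> supported {e}. d dvd c e}"
      then have "\<bar>d\<bar> dvd x e - n" by simp
      then have "x e mod \<bar>d\<bar> = n mod \<bar>d\<bar>" by (simp add: mod_eq_dvd_iff)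
      then show "n = x e mod \<bar>d\<bar>" using n by simp
    qed
  qed
  then show ?thesis by simp
qed

text \<open>Evaluation at the last coordinate has the multiples of some \<open>w e\<close> as its image on
\<open>L\<close>. It splits the factor \<open>\<bar>w e\<bar>\<close> off the index by
\<open>sub_index_hom\<close>, and off the determinant by \<open>exact_det\<close>; the rest is the
claim for the kernel, in one coordinate less.\<close>

theorem det_eq_index:
  fixes L :: "('c \<Rightarrow> int) set"
  assumes "distinct es" "fun_submodule L" "L \<subseteq> supported (set es)" "module_basis (fun_module L) vs" "length vs = length es"
  shows "real (sub_index (supported (set es)) L)
    = \<bar>real_of_int (Determinant.det (basis_matrix (fun_module (supported (set es))) (map basis_fun es) vs))\<bar>"
  using assms
proof (induction es arbitrary: L vs rule: rev_induct)
  case Nil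
  then have "L = {\<lambda>_. 0}" using fun_submodule_zero[of L] by (auto simp: supported_def)
  then have "supported (set []) = L" by (auto simp: supported_def)
  then have "sub_index (supported (set [])) L = 1"
    using sub_index_self[OF fun_submodule_add_subgroup[OF Nil(2)]] by simp
  moreover have "basis_matrix (fun_module (supported (set []))) (map basis_fun []) vs \<in> carrier_mat 0 0"
    using Nil(5) by (simp add: basis_matrix_def)
  ultimately show ?case by (simp add: det_dim_zero)
next
  case (snoc e es)
  let ?S = "supported (set (es @ [e])) :: ('c \<Rightarrow> int) set" and ?T = "supported (set es) :: ('c \<Rightarrow> int) set"
  let ?K = "{c \<in> L. c e = 0}"
  have dist: "distinct es" "e \<notin> set es" using snoc.prems(1) by auto
  have L: "fun_submodule L" by fact
  have S: "fun_submodule ?S" by (rule fun_submodule_supported)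
  have ker: "{c \<in> ?S. c e = 0} = ?T" using dist(2) by (auto simp: supported_def)
  have K: "fun_submodule ?K" by (rule fun_submodule_restrict[OF L])
  have KT: "?K \<subseteq> ?T" using snoc.prems(3) by (auto simp: supported_def)
  interpret L: lmod "fun_module L" by (rule lmod_fun_module[OF L])
  from fun_submodule_free[OF principal_ideals_int _ _ K KT, of real_of_int]
  obtain ws where ws: "module_basis (fun_module ?K) ws" "length ws \<le> length es" by auto
  show ?case
  proof (rule peel_basis[OF principal_ideals_int L, of e])
    \<comment> \<open>impossible: L would have too small a rank\<close>
    assume "L = ?K"
    then have "length vs = length ws"
      using basis_length_unique[OF L.lmod_axioms snoc.prems(4)] ws(1) by simp
    then show ?thesis using ws(2) snoc.prems(5) by simp
  next
    fix w assume w: "w \<in> L" "w e \<noteq> 0" "module_basis (fun_module (eval_at e ` L)) [eval_at e w]"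
      and wd: "\<And>c. c \<in> L \<Longrightarrow> w e dvd c e"
    have b: "module_basis (fun_module L) (ws @ [w])"
      by (rule exact_basis[OF exact_eval_at[OF L] ws(1)]) (use w in auto)
    have len: "length ws = length es"
      using basis_length_unique[OF L.lmod_axioms snoc.prems(4) b] snoc.prems(5) by simp
    have wS: "w \<in> ?S" using w(1) snoc.prems(3) by auto
    have eS: "basis_fun e \<in> ?S" by (rule basis_fun_supported) simp
    have Pe: "eval_at e ` ?S = supported {e}"
    proof
      show "supported {e} \<subseteq> eval_at e ` ?S"
      proof
        fix c :: "'c \<Rightarrow> int" assume "c \<in> supported {e}"
        then have "c = eval_at e c" "c \<in> ?S" by (auto simp: supported_def eval_at_def fun_eq_iff)
        then show "c \<in> eval_at e ` ?S" by blast
      qed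
    qed (auto simp: supported_def eval_at_def)
    have be: "eval_at e (basis_fun e :: 'c \<Rightarrow> int) = basis_fun e" by (auto simp: eval_at_def basis_fun_def)
    have exS: "exact_triple (fun_module ?T) (fun_module ?S) (fun_module (supported {e})) (eval_at e)"
      using exact_eval_at[OF S, of e] unfolding ker Pe .
    have we: "eval_at e w \<in> supported (set [e])" by (auto simp: eval_at_def supported_def)
    have "Determinant.det (basis_matrix (fun_module ?S) (map basis_fun es @ [basis_fun e]) (ws @ [w]))
       = Determinant.det (basis_matrix (fun_module ?T) (map basis_fun es) ws)
         * Determinant.det (basis_matrix (fun_module (supported {e})) (map (eval_at e) [basis_fun e]) (map (eval_at e) [w]))"
    proof (rule exact_det[OF exS basis_funs[OF dist(1)]])
      show "module_basis (fun_module (supported {e})) (map (eval_at e) [basis_fun e :: 'c \<Rightarrow> int])"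
        using basis_funs[of "[e]", where 'r=int] by (simp add: be)
      show "set ws \<subseteq> carrier (fun_module ?T)" using ws(1) KT by (auto simp: module_basis_def)
    qed (use eS wS len in auto)
    also have "basis_matrix (fun_module (supported {e})) (map (eval_at e) [basis_fun e]) (map (eval_at e) [w])
       = Matrix.mat 1 1 (\<lambda>(i, j). w e)"
    proof -
      have "basis_matrix (fun_module (supported {e})) [basis_fun e] [eval_at e w]
          = Matrix.mat 1 1 (\<lambda>(i, j). ([eval_at e w] ! j) ([e] ! i))"
        using basis_matrix_basis_funs[of "[e]" "[eval_at e w]"] we by simp
      also have "\<dots> = Matrix.mat 1 1 (\<lambda>(i, j). w e)" by (rule eq_matI) (auto simp: eval_at_def)
      finally show ?thesis by (simp add: be)
    qed
    finally have d1: "Determinant.det (basis_matrix (fun_module ?S) (map basis_fun (es @ [e])) (ws @ [w]))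
       = Determinant.det (basis_matrix (fun_module ?T) (map basis_fun es) ws) * w e"
      using det_1x1[of "\<lambda>(i, j). w e"] by simp
    have "basis_matrix (fun_module ?S) (map basis_fun (es @ [e])) vs
       = basis_matrix (fun_module ?S) (map basis_fun (es @ [e])) (ws @ [w]) * basis_matrix (fun_module L) (ws @ [w]) vs"
      by (rule sub_basis_matrix[OF fun_submodule_along[OF S L snoc.prems(3)] basis_funs[OF snoc.prems(1)] b])
        (use snoc.prems(4) in \<open>simp add: module_basis_def\<close>)
    then have dd: "Determinant.det (basis_matrix (fun_module ?S) (map basis_fun (es @ [e])) vs)
       = Determinant.det (basis_matrix (fun_module ?S) (map basis_fun (es @ [e])) (ws @ [w]))
         * Determinant.det (basis_matrix (fun_module L) (ws @ [w]) vs)"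
      using snoc.prems(5) len by (simp, intro det_mult[of _ "Suc (length es)"]) (simp_all add: basis_matrix_def)
    have det: "\<bar>Determinant.det (basis_matrix (fun_module ?S) (map basis_fun (es @ [e])) vs)\<bar>
       = \<bar>Determinant.det (basis_matrix (fun_module ?T) (map basis_fun es) ws)\<bar> * \<bar>w e\<bar>"
      unfolding dd d1 abs_mult using abs_basis_det[OF L.lmod_axioms b snoc.prems(4)] by simp
    have eL: "eval_at e ` L = {c \<in> supported {e}. w e dvd c e}"
    proof
      show "eval_at e ` L \<subseteq> {c \<in> supported {e}. w e dvd c e}"
        using wd by (auto simp: eval_at_def supported_def)
      show "{c \<in> supported {e}. w e dvd c e} \<subseteq> eval_at e ` L"
      proof
        fix c assume c: "c \<in> {c \<in> supported {e}. w e dvd c e}"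
        then obtain r where "c e = w e * r" by (auto elim: dvdE)
        then have "c = eval_at e (\<lambda>x. r * w x)" using c by (auto simp: eval_at_def supported_def fun_eq_iff)
        then show "c \<in> eval_at e ` L" using fun_submodule_smult[OF L w(1), of r] by blast
      qed
    qed
    have zero: "{x \<in> ?S. eval_at e x = 0} = ?T" "{x \<in> L. eval_at e x = 0} = ?K"
      unfolding ker[symmetric] by (auto simp: eval_at_def fun_eq_iff)
    have "sub_index ?S L = sub_index (eval_at e ` ?S) (eval_at e ` L) * sub_index {x \<in> ?S. eval_at e x = 0} {x \<in> L. eval_at e x = 0}"
      by (rule sub_index_hom) (use S L snoc.prems(3) in \<open>auto simp: fun_submodule_add_subgroup eval_at_def fun_eq_iff\<close>)
    also have "\<dots> = nat \<bar>w e\<bar> * sub_index ?T ?K"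
      unfolding zero eL Pe by (simp add: sub_index_multiples[OF w(2)])
    finally have "real (sub_index ?S L) = \<bar>real_of_int (w e)\<bar> * real (sub_index ?T ?K)" by simp
    also have "real (sub_index ?T ?K) = \<bar>real_of_int (Determinant.det (basis_matrix (fun_module ?T) (map basis_fun es) ws))\<bar>"
      by (rule snoc.IH[OF dist(1) K KT ws(1) len])
    also have "\<bar>real_of_int (w e)\<bar> * \<dots> = real_of_int \<bar>Determinant.det (basis_matrix (fun_module ?S) (map basis_fun (es @ [e])) vs)\<bar>"
      unfolding det by simp
    finally show ?thesis by simp
  qed
qed

section \<open>Ranks of real homology\<close>

text \<open>Going through a finite generating list and keeping the elements that are not combinations of those
kept before leaves a basis.\<close>

lemma real_basis_exists:
  fixes M :: "(real, 'm) module" (structure)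
  assumes "lmod M" "set xs \<subseteq> carrier M" "\<And>x. x \<in> carrier M \<Longrightarrow> \<exists>a. x = lin_comb M xs a"
  shows "\<exists>bs. module_basis M bs"
proof -
  interpret lmod M by fact
  have "\<exists>bs. set bs \<subseteq> carrier M \<and> indep bs \<and> (\<forall>x\<in>set xs. \<exists>a. x = lin_comb M bs a)" using assms(2)
  proof (induction xs rule: rev_induct)
    case Nil
    show ?case by (intro exI[of _ "[]"]) (simp add: indep_def)
  next
    case (snoc x xs)
    then obtain bs where bs: "set bs \<subseteq> carrier M" "indep bs" "\<forall>x\<in>set xs. \<exists>a. x = lin_comb M bs a" by auto
    have x: "x \<in> carrier M" using snoc.prems by simp
    show ?case
    proof (cases "\<exists>a. x = lin_comb M bs a")
      case True
      then show ?thesis using bs by (intro exI[of _ bs]) auto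
    next
      case False
      have "indep (bs @ [x])" unfolding indep_def
      proof (intro allI impI)
        fix a i assume a: "lin_comb M (bs @ [x]) a = \<zero>" and i: "i < length (bs @ [x])"
        have eq: "lin_comb M bs a \<oplus> a (length bs) \<odot> x = \<zero>" using a bs(1) x by (simp add: lin_comb_snoc)
        have z: "a (length bs) = 0"
        proof (rule ccontr)
          assume n: "a (length bs) \<noteq> 0"
          let ?c = "inverse (a (length bs))"
          have "(- ?c) \<odot> lin_comb M bs a = (- ?c) \<odot> lin_comb M bs a \<oplus> ?c \<odot> (lin_comb M bs a \<oplus> a (length bs) \<odot> x)"
            unfolding eq using bs(1) by simp
          also have "\<dots> = (- ?c) \<odot> lin_comb M bs a \<oplus> (?c \<odot> lin_comb M bs a \<oplus> (?c * a (length bs)) \<odot> x)"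
            using bs(1) x by (simp only: smult_add_right smult_assoc lin_comb_closed smult_closed)
          also have "\<dots> = ((- ?c) \<odot> lin_comb M bs a \<oplus> ?c \<odot> lin_comb M bs a) \<oplus> x"
            using bs(1) x n by (simp add: a_assoc)
          also have "(- ?c) \<odot> lin_comb M bs a \<oplus> ?c \<odot> lin_comb M bs a = \<zero>"
            using bs(1) smult_add_left[of "lin_comb M bs a" "- ?c" ?c] by simp
          finally have "x = lin_comb M bs (\<lambda>i. (- ?c) * a i)" using x bs(1) lin_comb_smult[OF bs(1), of "- ?c" a] by simp
          then show False using False by blast
        qed
        then have "lin_comb M bs a = \<zero>" using eq x bs(1) by simp
        then show "a i = 0" using bs(2) z i by (auto simp: indep_def less_Suc_eq)
      qed
      moreover have "\<exists>a. y = lin_comb M (bs @ [x]) a" if y: "y \<in> set (xs @ [x])" for y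
      proof (cases "y = x")
        case True
        have "x = lin_comb M (bs @ [x]) (\<lambda>i. if i = length bs then 1 else 0)"
          using lin_comb_unit[of "bs @ [x]" "length bs"] bs(1) x by simp
        then show ?thesis using True by blast
      next
        case False
        then obtain a where a: "y = lin_comb M bs a" using bs(3) y by auto
        let ?a = "\<lambda>i. if i < length bs then a i else 0"
        have "lin_comb M (bs @ [x]) ?a = lin_comb M bs ?a" using bs(1) x by (simp add: lin_comb_snoc)
        also have "\<dots> = y" unfolding a using bs(1) by (intro lin_comb_cong) auto
        finally show ?thesis by metis
      qed
      ultimately show ?thesis using bs(1) x by (intro exI[of _ "bs @ [x]"]) auto
    qed
  qed
  then obtain bs where bs: "set bs \<subseteq> carrier M" "indep bs" "\<forall>x\<in>set xs. \<exists>a. x = lin_comb M bs a" by blast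
  have "\<exists>a. x = lin_comb M bs a" if x: "x \<in> carrier M" for x
  proof -
    obtain a where a: "x = lin_comb M xs a" using assms(3) x by blast
    have "\<forall>j. \<exists>a. j < length xs \<longrightarrow> xs ! j = lin_comb M bs a" using bs(3) nth_mem[of _ xs] by blast
    from choice[OF this] obtain A where "\<And>j. j < length xs \<Longrightarrow> xs ! j = lin_comb M bs (A j)" by blast
    from lin_comb_lin_comb[OF bs(1) this] show ?thesis using a by blast
  qed
  then show ?thesis using bs by (intro exI[of _ bs]) (auto simp: module_basis_iff)
qed

lemma module_rank_eq:
  fixes M :: "('r::{comm_ring_1,ring_char_0}, 'm) module"
  assumes "lmod M" "module_basis M bs" shows "module_rank M = length bs"
  unfolding module_rank_def using assms basis_length_unique[OF assms(1) _ assms(2)] by blast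

lemma quotient_basis_exists:
  fixes Z B :: "('c \<Rightarrow> real) set"
  assumes "fun_submodule Z" "fun_submodule B" "B \<subseteq> Z" "Z \<subseteq> supported E" "finite E"
  obtains us ws where "module_basis (fun_module B) us" "set ws \<subseteq> Z"
    "module_basis (quot_module Z B) (map (coset B) ws)" "module_basis (fun_module Z) (us @ ws)"
proof -
  let ?Q = "quot_module Z B"
  obtain es where es: "set es = E" using finite_list[OF assms(5)] by blast
  obtain zs where zs: "module_basis (fun_module Z) zs"
    using fun_submodule_free[OF principal_ideals_real _ _ assms(1), of "\<lambda>x. x" es] assms(4) es by auto
  obtain us where us: "module_basis (fun_module B) us"
    using fun_submodule_free[OF principal_ideals_real _ _ assms(2), of "\<lambda>x. x" es] assms(3,4) es by auto
  interpret Z: lmod "fun_module Z" by (rule lmod_fun_module[OF assms(1)])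
  have Q: "lmod ?Q" by (rule lmod_quotient[OF assms(1-3)])
  interpret Q: lmod ?Q by (rule Q)
  have zsZ: "set zs \<subseteq> carrier (fun_module Z)" by (rule Z.basis_carrier[OF zs])
  have "\<exists>bs. module_basis ?Q bs"
  proof (rule real_basis_exists[OF Q, of "map (coset B) zs"])
    show "set (map (coset B) zs) \<subseteq> carrier ?Q" using zsZ by (auto simp: quotient_carrier[OF assms(1-3)])
    fix x assume "x \<in> carrier ?Q"
    then obtain z where z: "z \<in> Z" "x = coset B z" by (auto simp: quotient_carrier[OF assms(1-3)])
    then obtain a where "z = lin_comb (fun_module Z) zs a" using zs unfolding Z.module_basis_iff by auto
    then have "x = lin_comb ?Q (map (coset B) zs) a"
      using linear_map_lin_comb[OF Z.lmod_axioms Q coset_linear[OF assms(1-3)] zsZ] z by simp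
    then show "\<exists>a. x = lin_comb ?Q (map (coset B) zs) a" by blast
  qed
  then obtain bs where bs: "module_basis ?Q bs" by blast
  have "\<exists>ws. set ws \<subseteq> Z \<and> map (coset B) ws = bs"
  proof -
    have "set bs \<subseteq> coset B ` Z" using Q.basis_carrier[OF bs] by (simp add: quotient_carrier[OF assms(1-3)])
    then show ?thesis
      by (intro exI[of _ "map (inv_into Z (coset B)) bs"])
        (auto simp: f_inv_into_f subset_iff intro!: map_idI inv_into_into)
  qed
  then obtain ws where ws: "set ws \<subseteq> Z" "map (coset B) ws = bs" by blast
  show ?thesis
    by (rule that[OF us ws(1)])
      (use bs ws exact_basis[OF exact_quotient[OF assms(1-3)] us, of ws] in auto)
qed

text \<open>The ranks of the quotients of \<open>Z\<close> determine those of \<open>B\<close> and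
\<open>B'\<close>, and a basis of \<open>B'\<close> that is extended to one of \<open>B\<close> by
as many vectors as the ranks allow is not extended at all.\<close>

lemma equal_rank_imp_eq:
  fixes Z B B' :: "('c \<Rightarrow> real) set"
  assumes Z: "fun_submodule Z" and B: "fun_submodule B" and B': "fun_submodule B'" and sub: "B' \<subseteq> B" "B \<subseteq> Z" "Z \<subseteq> supported E" "finite E"
    and rank: "module_rank (quot_module Z B) = module_rank (quot_module Z B')"
  shows "B' = B"
proof -
  have B'Z: "B' \<subseteq> Z" using sub by auto
  obtain us ws where 1: "module_basis (fun_module B) us" 
    "module_basis (quot_module Z B) (map (coset B) ws)" "module_basis (fun_module Z) (us @ ws)"
    by (rule quotient_basis_exists[OF Z B sub(2-4)])
  obtain us' ws' where 2: "module_basis (fun_module B') us'" 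
    "module_basis (quot_module Z B') (map (coset B') ws')" "module_basis (fun_module Z) (us' @ ws')"
    by (rule quotient_basis_exists[OF Z B' B'Z sub(3,4)])
  have BE: "B \<subseteq> supported E" using sub by auto
  obtain us'' vs where 3: "module_basis (fun_module B') us''" "set vs \<subseteq> B"
    "module_basis (quot_module B B') (map (coset B') vs)" "module_basis (fun_module B) (us'' @ vs)"
    by (rule quotient_basis_exists[OF B B' sub(1) BE sub(4)])
  have "length ws = length ws'"
    using rank module_rank_eq[OF lmod_quotient[OF Z B sub(2)] 1(2)] module_rank_eq[OF lmod_quotient[OF Z B' B'Z] 2(2)] by simp
  then have "length us = length us'"
    using basis_length_unique[OF lmod_fun_module[OF Z] 1(3) 2(3)] by simp
  moreover have "length us'' = length us'"
    by (rule basis_length_unique[OF lmod_fun_module[OF B'] 3(1) 2(1)])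
  moreover have "length (us'' @ vs) = length us"
    by (rule basis_length_unique[OF lmod_fun_module[OF B] 3(4) 1(1)])
  ultimately have "vs = []" by simp
  then have "module_basis (fun_module B) us''" using 3(4) by simp
  then show ?thesis using 3(1) unfolding fun_module_basis_iff[OF B] fun_module_basis_iff[OF B'] 
    using sub(1) span_subset[OF B', of us''] by blast
qed

section \<open>Cellular cycles and boundaries\<close>

definition cyc :: "('a, 'c) cw \<Rightarrow> nat \<Rightarrow> ('c \<Rightarrow> 'r::comm_ring_1) set" where
  "cyc Y k = {c \<in> supported (cw_cells Y k). cw_boundary Y k c = (\<lambda>_. 0)}"

definition bnd :: "('a, 'c) cw \<Rightarrow> nat \<Rightarrow> ('c \<Rightarrow> 'r::comm_ring_1) set" where
  "bnd Y k = cw_boundary Y (Suc k) ` supported (cw_cells Y (Suc k))"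

lemma free_module_eq: "free_module E = fun_module (supported E)"
  by (simp add: free_module_def fun_module_def supported_def)

lemma restrict_fun_module: "restrict_module (fun_module S) N = fun_module N"
  by (simp add: restrict_module_def fun_module_def)

lemma cw_chains_eq: "cw_chains Y k = fun_module (supported (cw_cells Y k))"
  by (simp add: cw_chains_def free_module_eq)

lemma cw_cycles_eq: "cw_cycles Y k = fun_module (cyc Y k)"
  by (simp add: cw_cycles_def cw_chains_eq restrict_fun_module cyc_def)

lemma cw_boundaries_eq: "cw_boundaries Y k = fun_module (bnd Y k)"
  by (simp add: cw_boundaries_def cw_chains_eq restrict_fun_module bnd_def)

lemma cw_homology_eq: "cw_homology Y k = quot_module (cyc Y k) (bnd Y k)"
  by (simp add: cw_homology_def cw_cycles_eq cw_boundaries_eq)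

lemma boundary_add: "cw_boundary Y k (\<lambda>e. c e + d e) = (\<lambda>e. cw_boundary Y k c e + cw_boundary Y k d e)"
  by (cases k) (simp_all add: distrib_left sum.distrib)

lemma boundary_smult: "cw_boundary Y k (\<lambda>e. r * c e) = (\<lambda>e. r * cw_boundary Y k c e)"
  by (cases k) (simp_all add: sum_distrib_left ac_simps)

lemma boundary_zero: "cw_boundary Y k (\<lambda>_. 0) = (\<lambda>_. 0)"
  by (cases k) simp_all

lemma boundary_diff: "cw_boundary Y k (\<lambda>e. c e - d e) = (\<lambda>e. cw_boundary Y k c e - cw_boundary Y k d e)"
  by (cases k) (simp_all add: right_diff_distrib sum_subtractf)

lemma boundary_sum:
  "cw_boundary Y k (\<lambda>e. \<Sum>i<n. a i * v i e) = (\<lambda>e. \<Sum>i<(n::nat). a i * cw_boundary Y k (v i) e)"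
proof (induction n)
  case (Suc n)
  show ?case unfolding sum.lessThan_Suc boundary_add boundary_smult Suc ..
qed (simp add: boundary_zero)

lemma boundary_real_chain: "cw_boundary Y k (real_chain c) = real_chain (cw_boundary Y k c)"
  by (cases k) (simp_all add: real_chain_def fun_eq_iff)

lemma real_chain_zero_iff: "real_chain c = (\<lambda>_. 0) \<longleftrightarrow> c = (\<lambda>_. 0)"
  by (simp add: real_chain_def fun_eq_iff)

lemma real_chain_supported: "real_chain c \<in> supported E \<longleftrightarrow> c \<in> supported E"
  by (simp add: real_chain_def supported_def)

lemma real_chain_basis_fun: "real_chain (basis_fun e) = basis_fun e"
  by (simp add: real_chain_def basis_fun_def fun_eq_iff)

lemma supported_mono: "E \<subseteq> F \<Longrightarrow> supported E \<subseteq> supported F"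
  by (auto simp: supported_def)

lemma fun_submodule_Int: "fun_submodule S \<Longrightarrow> fun_submodule S' \<Longrightarrow> fun_submodule (S \<inter> S')"
  by (simp add: fun_submodule_def)

lemma fun_submodule_boundary_image: "fun_submodule S \<Longrightarrow> fun_submodule (cw_boundary Y k ` S)"
  by (rule fun_submodule_image) (simp_all add: boundary_add boundary_smult)

lemma fun_submodule_bnd: "fun_submodule (bnd Y k)"
  unfolding bnd_def by (rule fun_submodule_boundary_image[OF fun_submodule_supported])

lemma fun_submodule_cyc: "fun_submodule (cyc Y k)"
proof -
  have "fun_submodule {c. cw_boundary Y k c = (\<lambda>_. 0)}"
    by (auto simp: fun_submodule_def boundary_zero boundary_add boundary_smult)
  from fun_submodule_Int[OF fun_submodule_supported this] show ?thesis
    unfolding cyc_def by (simp add: Int_def)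
qed

lemma cyc_supported: "cyc Y k \<subseteq> supported (cw_cells Y k)"
  by (auto simp: cyc_def)

context finite_cw
begin

lemma boundary_in_supported: "cw_boundary X (Suc k) c \<in> supported (cw_cells X k)"
  by (auto simp: supported_def incidence(1))

lemma boundary_boundary: "cw_boundary X k (cw_boundary X (Suc k) c) = (\<lambda>_. 0)"
proof (cases k)
  case (Suc j)
  have "(\<Sum>f\<in>cw_cells X (Suc j). of_int (incidence X j f g) * (\<Sum>e\<in>cw_cells X (Suc (Suc j)). of_int (incidence X (Suc j) e f) * c e)) = 0" for g
  proof -
    have "(\<Sum>f\<in>cw_cells X (Suc j). of_int (incidence X j f g) * (\<Sum>e\<in>cw_cells X (Suc (Suc j)). of_int (incidence X (Suc j) e f) * c e))
      = (\<Sum>e\<in>cw_cells X (Suc (Suc j)). of_int (\<Sum>f\<in>cw_cells X (Suc j). incidence X j f g * incidence X (Suc j) e f) * c e)"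
      unfolding sum_distrib_left sum_distrib_right of_int_sum by (subst sum.swap) (simp add: ac_simps)
    then show ?thesis by (simp add: incidence_incidence)
  qed
  then show ?thesis by (simp add: Suc)
qed simp

lemma bnd_subset_cyc: "bnd X k \<subseteq> cyc X k"
  using boundary_in_supported boundary_boundary by (auto simp: bnd_def cyc_def simp del: cw_boundary.simps)

end

context finite_cw_subcomplex
begin

lemma boundary_sub: assumes "c \<in> supported (cw_cells Y k)" shows "cw_boundary Y k c = cw_boundary X k c"
proof (cases k)
  case (Suc j)
  have "(\<Sum>e\<in>cw_cells Y (Suc j). of_int (incidence Y j e f) * c e) = (\<Sum>e\<in>cw_cells X (Suc j). of_int (incidence X j e f) * c e)" for f
  proof (rule sum.mono_neutral_cong_left)
    show "\<forall>e\<in>cw_cells X (Suc j) - cw_cells Y (Suc j). of_int (incidence X j e f) * c e = 0"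
      using assms Suc by (simp add: supported_def)
  qed (use finite_cells cells_subset incidence_subcomplex in auto)
  then show ?thesis by (simp add: Suc)
qed simp

lemma cyc_sub: "cyc Y k = cyc X k \<inter> supported (cw_cells Y k)"
  using boundary_sub supported_mono[OF cells_subset] by (auto simp: cyc_def)

lemma bnd_sub: "bnd Y k = cw_boundary X (Suc k) ` supported (cw_cells Y (Suc k))"
  unfolding bnd_def by (rule image_cong[OF refl boundary_sub])

end

section \<open>The constants as indices\<close>

text \<open>The index of \<open>B\<close> in its saturation in \<open>Z\<close>, which is the order of the
torsion subgroup of \<open>Z / B\<close>.\<close>

definition torsion_index :: "('c \<Rightarrow> int) set \<Rightarrow> ('c \<Rightarrow> int) set \<Rightarrow> nat" where
  "torsion_index Z B = sub_index {z \<in> Z. \<exists>n. n \<noteq> 0 \<and> (\<lambda>e. n * z e) \<in> B} B"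

lemma card_torsion_elements:
  fixes Z B :: "('c \<Rightarrow> int) set"
  assumes "fun_submodule Z" "fun_submodule B" "B \<subseteq> Z"
  shows "card (torsion_elements (quot_module Z B)) = torsion_index Z B"
proof -
  have "torsion_elements (quot_module Z B) = coset B ` {z \<in> Z. \<exists>n. n \<noteq> 0 \<and> (\<lambda>e. n * z e) \<in> B}"
    unfolding torsion_elements_def quotient_carrier[OF assms] quotient_zero[OF assms]
  proof -
    have "n \<odot>\<^bsub>quot_module Z B\<^esub> coset B x = B \<longleftrightarrow> (\<lambda>e. n * x e) \<in> B" for n x
      by (simp add: quotient_smult[OF assms] coset_eq_zero_iff[OF assms(2)])
    then show "{S \<in> coset B ` Z. \<exists>n. n \<noteq> 0 \<and> n \<odot>\<^bsub>quot_module Z B\<^esub> S = B}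
        = coset B ` {z \<in> Z. \<exists>n. n \<noteq> 0 \<and> (\<lambda>e. n * z e) \<in> B}" by blast
  qed
  then show ?thesis
    by (simp add: torsion_index_def sub_index_def coset_eq_class[OF assms(2), abs_def])
qed

lemma coker_order_eq:
  assumes "fun_submodule (bnd Y k :: ('c \<Rightarrow> int) set)"
  shows "coker_order X Y V k = sub_index (supported (cw_cells X k - cw_cells V k)) (q_map X V k ` bnd Y k)"
proof -
  let ?S = "supported (cw_cells X k - cw_cells V k) :: ('c \<Rightarrow> int) set" and ?B = "q_map X V k ` bnd Y k"
  have B: "fun_submodule ?B" by (rule fun_submodule_image[OF assms]) (auto simp: q_map_def)
  have BS: "?B \<subseteq> ?S" by (auto simp: q_map_def supported_def)
  show ?thesis
    unfolding coker_order_def quotient_chains_def free_module_eq cw_boundaries_eq fun_module_simps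
      quotient_carrier[OF fun_submodule_supported B BS] sub_index_def
    by (simp add: coset_eq_class[OF B, abs_def])
qed

section \<open>Bases adapted to trees and truncations\<close>

definition enumeration :: "'c set \<Rightarrow> 'c list" where
  "enumeration A = (SOME l. distinct l \<and> set l = A)"

lemma enumeration:
  assumes "finite A" shows "distinct (enumeration A)" "set (enumeration A) = A"
proof -
  have "\<exists>l. distinct l \<and> set l = A" using finite_distinct_list[OF assms] by blast
  from someI_ex[OF this] show "distinct (enumeration A)" "set (enumeration A) = A" by (auto simp: enumeration_def)
qed

text \<open>What the trees and truncations provide in terms of cells; \<open>T k\<close> and \<open>V
k\<close> are the sets of \<open>k\<close>-cells of $T^k$ and $V^k$. The tree $T^k$ has no
\<open>k\<close>-cycles, the boundaries of the cells of $T^{k+1}$ span all real boundaries, and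
every real homology class of \<open>X\<close> has exactly one representative among the cycles of
$V^k$.\<close>

locale truncated_cw = finite_cw X for X :: "('a, 'c) cw" +
  fixes h :: "nat \<Rightarrow> ('c \<Rightarrow> real) set list" and T V :: "nat \<Rightarrow> 'c set"
  assumes T_V: "T k \<subseteq> V k" and V_X: "V k \<subseteq> cw_cells X k"
    and T_inj: "\<And>k c. c \<in> supported (T k) \<Longrightarrow> cw_boundary X k c = (\<lambda>_. 0 :: int) \<Longrightarrow> c = (\<lambda>_. 0)"
    and T_bnd: "\<And>k. cw_boundary X (Suc k) ` supported (T (Suc k)) = (bnd X k :: ('c \<Rightarrow> real) set)"
    and V_bij: "\<And>k. bij_betw (coset (bnd X k)) (cyc X k \<inter> supported (V k)) (coset (bnd X k) ` (cyc X k :: ('c \<Rightarrow> real) set))"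
    and combinatorial: "combinatorial_basis X h"
begin

lemma T_X: "T k \<subseteq> cw_cells X k" using T_V V_X by blast

definition tree :: "nat \<Rightarrow> 'c list" where
  "tree k = enumeration (T k)"

lemma tree: "distinct (tree k)" "set (tree k) = T k"
  unfolding tree_def by (rule enumeration[OF finite_subset[OF T_X finite_cells]])+

definition tree_bnd :: "nat \<Rightarrow> ('c \<Rightarrow> 'r::comm_ring_1) list" where
  "tree_bnd k = map (\<lambda>e. cw_boundary X k (basis_fun e)) (tree k)"

lemma length_tree_bnd [simp]: "length (tree_bnd k) = length (tree k)"
  by (simp add: tree_bnd_def)

lemma real_tree_bnd: "map real_chain (tree_bnd k) = tree_bnd k"
  by (simp add: tree_bnd_def boundary_real_chain[symmetric] real_chain_basis_fun)

lemma boundary_supported: "cw_boundary X k c \<in> supported (cw_cells X (k - 1))"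
  by (cases k) (auto simp: supported_def incidence(1))

lemma linear_boundary:
  "fun_submodule S \<Longrightarrow> cw_boundary X k ` S \<subseteq> S' \<Longrightarrow> linear_map (fun_module S) (fun_module S') (cw_boundary X k)"
  by (auto simp: linear_map_def boundary_add boundary_smult)

lemma tree_iso:
  assumes inj: "\<And>c. c \<in> supported (T k) \<Longrightarrow> cw_boundary X k c = (\<lambda>_. 0 :: 'r::comm_ring_1) \<Longrightarrow> c = (\<lambda>_. 0)"
  shows "linear_iso (fun_module (supported (T k))) (fun_module (cw_boundary X k ` supported (T k) :: ('c \<Rightarrow> 'r) set)) (cw_boundary X k)"
  unfolding linear_iso_def
proof
  show "linear_map (fun_module (supported (T k))) (fun_module (cw_boundary X k ` supported (T k) :: ('c \<Rightarrow> 'r) set)) (cw_boundary X k)"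
    by (rule linear_boundary[OF fun_submodule_supported subset_refl])
  have "inj_on (cw_boundary X k) (supported (T k) :: ('c \<Rightarrow> 'r) set)"
  proof (rule inj_onI)
    fix c d :: "'c \<Rightarrow> 'r" assume "c \<in> supported (T k)" "d \<in> supported (T k)" "cw_boundary X k c = cw_boundary X k d"
    then have "(\<lambda>e. c e - d e) \<in> supported (T k)" "cw_boundary X k (\<lambda>e. c e - d e) = (\<lambda>_. 0)"
      by (simp_all add: fun_submodule_diff[OF fun_submodule_supported] boundary_diff)
    then have "(\<lambda>e. c e - d e) = (\<lambda>_. 0)" by (rule inj)
    then show "c = d" by (simp add: fun_eq_iff)
  qed
  then show "bij_betw (cw_boundary X k) (carrier (fun_module (supported (T k))))
     (carrier (fun_module (cw_boundary X k ` supported (T k) :: ('c \<Rightarrow> 'r) set)))"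
    by (simp add: bij_betw_def)
qed

lemma tree_bnd_basis_gen:
  assumes inj: "\<And>c. c \<in> supported (T k) \<Longrightarrow> cw_boundary X k c = (\<lambda>_. 0 :: 'r::comm_ring_1) \<Longrightarrow> c = (\<lambda>_. 0)"
  shows "module_basis (fun_module (cw_boundary X k ` supported (T k) :: ('c \<Rightarrow> 'r) set)) (tree_bnd k)"
proof -
  have "module_basis (fun_module (cw_boundary X k ` supported (T k) :: ('c \<Rightarrow> 'r) set)) (map (cw_boundary X k) (map basis_fun (tree k)))"
    by (rule linear_iso_basis[OF lmod_fun_module[OF fun_submodule_supported]
          lmod_fun_module[OF fun_submodule_boundary_image[OF fun_submodule_supported]] tree_iso[OF inj]])
      (use basis_funs[OF tree(1)] in \<open>auto simp: tree(2)\<close>)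
  then show ?thesis by (simp add: tree_bnd_def o_def)
qed

lemma tree_bnd_indep: "fun_indep (tree_bnd k :: ('c \<Rightarrow> int) list)" "fun_indep (tree_bnd k :: ('c \<Rightarrow> real) list)"
proof -
  show i: "fun_indep (tree_bnd k :: ('c \<Rightarrow> int) list)"
  proof -
    have "module_basis (fun_module (cw_boundary X k ` supported (T k) :: ('c \<Rightarrow> int) set)) (tree_bnd k)"
      by (rule tree_bnd_basis_gen) (rule T_inj)
    then show ?thesis
      unfolding fun_module_basis_iff[OF fun_submodule_boundary_image[OF fun_submodule_supported]] by blast
  qed
  have "set (tree_bnd k :: ('c \<Rightarrow> int) list) \<subseteq> supported (cw_cells X (k - 1))"
    using boundary_supported by (auto simp: tree_bnd_def)
  from real_indep_if_int_indep[OF i this finite_cells]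
  show "fun_indep (tree_bnd k :: ('c \<Rightarrow> real) list)" by (simp add: real_tree_bnd)
qed

lemma supported_tree_expand:
  assumes "c \<in> supported (T k)"
  obtains a where "c = (\<lambda>e. \<Sum>i<length (tree k). a i * basis_fun (tree k ! i) e)"
    "cw_boundary X k c = (\<lambda>e. \<Sum>i<length (tree k). a i * (tree_bnd k ! i) e)"
proof -
  have "module_basis (fun_module (supported (T k))) (map basis_fun (tree k))"
    using basis_funs[OF tree(1)] by (simp add: tree(2))
  then obtain a where a: "c = (\<lambda>e. \<Sum>i<length (tree k). a i * (map basis_fun (tree k) ! i) e)"
    using assms unfolding fun_module_basis_iff[OF fun_submodule_supported] by auto
  have "(\<Sum>i<length (tree k). a i * (map basis_fun (tree k) ! i) e) = (\<Sum>i<length (tree k). a i * basis_fun (tree k ! i) e)" for e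
    by (rule sum.cong) auto
  with a have c: "c = (\<lambda>e. \<Sum>i<length (tree k). a i * basis_fun (tree k ! i) e)" by simp
  have "cw_boundary X k c = (\<lambda>e. \<Sum>i<length (tree k). a i * (tree_bnd k ! i) e)"
    unfolding c boundary_sum by (auto simp: tree_bnd_def intro!: ext sum.cong)
  with c show ?thesis by (rule that)
qed

text \<open>The boundaries of the tree cells are independent over the integers, hence over the reals.\<close>

lemma T_inj_real:
  assumes "c \<in> supported (T k)" "cw_boundary X k c = (\<lambda>_. 0 :: real)" shows "c = (\<lambda>_. 0)"
proof -
  obtain a where a: "c = (\<lambda>e. \<Sum>i<length (tree k). a i * basis_fun (tree k ! i) e)"
    "cw_boundary X k c = (\<lambda>e. \<Sum>i<length (tree k). a i * (tree_bnd k ! i) e)"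
    by (rule supported_tree_expand[OF assms(1)])
  have "\<forall>e. (\<Sum>i<length (tree k). a i * (tree_bnd k ! i) e) = 0" using a(2) assms(2) by (metis (no_types))
  then have "\<forall>i<length (tree k). a i = 0"
    using tree_bnd_indep(2)[of k] unfolding fun_indep_def length_tree_bnd by blast
  then show ?thesis unfolding a(1) by simp
qed

lemma image_boundary_tree:
  "cw_boundary X k ` supported (T k) = (cw_boundary X k ` supported (cw_cells X k) :: ('c \<Rightarrow> real) set)"
proof (cases k)
  case 0
  have "(\<lambda>_. 0 :: real) \<in> supported E" for E :: "'c set" by (simp add: supported_def)
  then have "supported (T 0) \<noteq> ({} :: ('c \<Rightarrow> real) set)" "supported (cw_cells X 0) \<noteq> ({} :: ('c \<Rightarrow> real) set)" by blast+
  then show ?thesis by (simp add: 0 image_constant_conv)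
next
  case (Suc j)
  then show ?thesis using T_bnd[of j] by (simp only: bnd_def)
qed

lemma tree_bnd_basis:
  "module_basis (fun_module (cw_boundary X k ` supported (cw_cells X k) :: ('c \<Rightarrow> real) set)) (tree_bnd k)"
  unfolding image_boundary_tree[symmetric] by (rule tree_bnd_basis_gen) (rule T_inj_real)

lemma bnd_basis: "module_basis (fun_module (bnd X k) :: (real, _) module) (tree_bnd (Suc k))"
  using tree_bnd_basis[of "Suc k"] unfolding bnd_def .

text \<open>Over the reals, the boundary of the cell is the boundary of a chain of the tree. By
\<open>real_indep_if_int_indep\<close> there is then such a relation with integral coefficients,
and the coefficient of the cell in it is not 0, since the tree has no cycles of its own.\<close>

lemma fundamental_cycle:
  assumes e: "e \<in> cw_cells X k" "e \<notin> T k"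
  obtains z :: "'c \<Rightarrow> int" where "z \<in> supported (insert e (T k))" "cw_boundary X k z = (\<lambda>_. 0)" "z e \<noteq> 0"
proof -
  let ?l = "length (tree k)"
  let ?v = "cw_boundary X k (basis_fun e) :: 'c \<Rightarrow> int"
  let ?vs = "tree_bnd k @ [?v]"
  have snoc: "(\<Sum>i<length (tree_bnd k @ [w]). a i * ((tree_bnd k @ [w]) ! i) x)
     = (\<Sum>i<?l. a i * (tree_bnd k ! i) x) + a ?l * w x" for a and w :: "'c \<Rightarrow> 'x::comm_ring_1" and x
    by (simp add: nth_append)
  have "\<not> fun_indep (map real_chain ?vs)"
  proof
    assume ind: "fun_indep (map real_chain ?vs)"
    have m: "map real_chain ?vs = tree_bnd k @ [cw_boundary X k (basis_fun e)]"
      by (simp add: real_tree_bnd boundary_real_chain[symmetric] real_chain_basis_fun)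
    have "cw_boundary X k (basis_fun e :: 'c \<Rightarrow> real) \<in> cw_boundary X k ` supported (T k)"
      unfolding image_boundary_tree using e(1) by (intro imageI basis_fun_supported)
    then obtain c where c: "c \<in> supported (T k)" "cw_boundary X k (basis_fun e :: 'c \<Rightarrow> real) = cw_boundary X k c" by blast
    obtain a where a: "cw_boundary X k c = (\<lambda>e. \<Sum>i<?l. a i * (tree_bnd k ! i) e)"
      by (rule supported_tree_expand[OF c(1)])
    let ?a = "\<lambda>i. if i < ?l then a i else -1"
    have "(\<Sum>i<length (map real_chain ?vs). ?a i * (map real_chain ?vs ! i) x) = 0" for x
      unfolding m snoc by (simp add: c(2) a)
    then have "\<forall>i<length (map real_chain ?vs). ?a i = 0"
      using ind[unfolded fun_indep_def, THEN spec[of _ ?a]] by blast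
    from this[rule_format, of ?l] show False by simp
  qed
  moreover have "set ?vs \<subseteq> supported (cw_cells X (k - 1))"
    using boundary_supported by (auto simp: tree_bnd_def)
  ultimately have "\<not> fun_indep ?vs" using real_indep_if_int_indep finite_cells by blast
  then obtain n i where n: "\<And>x. (\<Sum>i<?l. n i * (tree_bnd k ! i) x) + n ?l * ?v x = 0" and i: "i < Suc ?l" "n i \<noteq> 0"
    unfolding fun_indep_def snoc by auto
  have nl: "n ?l \<noteq> 0"
  proof
    assume z: "n ?l = 0"
    then have "\<forall>x. (\<Sum>i<?l. n i * (tree_bnd k ! i) x) = 0" using n by simp
    then have "\<forall>i<?l. n i = 0" using tree_bnd_indep(1)[of k] unfolding fun_indep_def length_tree_bnd by blast
    then show False using i z by (auto simp: less_Suc_eq)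
  qed
  let ?z = "\<lambda>x. (\<Sum>i<?l. n i * basis_fun (tree k ! i) x) + n ?l * basis_fun e x"
  have t: "basis_fun (tree k ! i) x = (0 :: int)" if "i < ?l" "x \<notin> T k" for i x
    using that tree(2)[of k] nth_mem[of i "tree k"] by (auto simp: basis_fun_def)
  have "?z \<in> supported (insert e (T k))"
    using t by (auto simp: supported_def basis_fun_def[of e])
  moreover have "cw_boundary X k ?z = (\<lambda>_. 0)"
  proof -
    have "cw_boundary X k ?z = (\<lambda>x. (\<Sum>i<?l. n i * cw_boundary X k (basis_fun (tree k ! i)) x) + n ?l * ?v x)"
      unfolding boundary_add boundary_sum boundary_smult ..
    also have "\<dots> = (\<lambda>x. (\<Sum>i<?l. n i * (tree_bnd k ! i) x) + n ?l * ?v x)"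
      by (simp add: tree_bnd_def)
    finally show ?thesis using n by simp
  qed
  moreover have "?z e \<noteq> 0" using nl t e(2) by (simp add: basis_fun_def[of e])
  ultimately show ?thesis by (rule that)
qed

text \<open>Every real cycle is a real combination of integral ones: subtracting multiples of fundamental
cycles removes the cells outside the tree one after the other, and a cycle on the tree is 0.\<close>

lemma real_cycle_induct:
  assumes U: "T k \<subseteq> U" "U \<subseteq> cw_cells X k" and S: "fun_submodule S"
    and zS: "\<And>z. z \<in> cyc X k \<Longrightarrow> z \<in> supported U \<Longrightarrow> real_chain z \<in> S"
    and c: "c \<in> cyc X k" "c \<in> supported U"
  shows "c \<in> S"
proof -
  have main: "c \<in> S" if "finite F" "F \<subseteq> U" "c \<in> supported (T k \<union> F)" "cw_boundary X k c = (\<lambda>_. 0)" for F c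
    using that
  proof (induction F arbitrary: c)
    case empty
    then show ?case using T_inj_real[of c k] fun_submodule_zero[OF S] by simp
  next
    case (insert e F)
    show ?case
    proof (cases "e \<in> T k")
      case True
      then show ?thesis using insert by (simp add: insert_absorb)
    next
      case False
      have "e \<in> cw_cells X k" using insert.prems U by auto
      then obtain z :: "'c \<Rightarrow> int" where z: "z \<in> supported (insert e (T k))" "cw_boundary X k z = (\<lambda>_. 0)" "z e \<noteq> 0"
        using fundamental_cycle False by blast
      let ?r = "c e / real_of_int (z e)"
      let ?d = "\<lambda>x. c x - ?r * real_chain z x"
      have sub: "insert e (T k) \<subseteq> U" using insert.prems U by auto
      have zU: "z \<in> supported U" using z(1) supported_mono[OF sub] by blast
      then have "z \<in> cyc X k" using z(2) supported_mono[OF U(2)] by (auto simp: cyc_def)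
      then have zS': "real_chain z \<in> S" using zS zU by blast
      have "?d \<in> S"
      proof (rule insert.IH)
        show "?d \<in> supported (T k \<union> F)"
          unfolding supported_def
        proof (intro CollectI allI impI)
          fix x assume x: "x \<notin> T k \<union> F"
          show "?d x = 0"
          proof (cases "x = e")
            case True
            then show ?thesis using z(3) by (simp add: real_chain_def)
          next
            case False
            then have "c x = 0" "z x = 0" using x insert.prems(2) z(1) by (auto simp: supported_def)
            then show ?thesis by (simp add: real_chain_def)
          qed
        qed
        have "cw_boundary X k ?d = (\<lambda>x. cw_boundary X k c x - ?r * cw_boundary X k (real_chain z) x)"
          unfolding boundary_diff boundary_smult ..
        then show "cw_boundary X k ?d = (\<lambda>_. 0)"
          unfolding boundary_real_chain z(2) insert.prems(3) by (simp add: real_chain_def)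
      qed (use insert.prems in auto)
      from fun_submodule_add[OF S this fun_submodule_smult[OF S zS', of ?r]] show ?thesis by simp
    qed
  qed
  have "finite U" using finite_subset[OF U(2) finite_cells] .
  moreover have "T k \<union> U = U" using U(1) by auto
  ultimately show ?thesis using main[of U c] c by (simp add: cyc_def)
qed

subsection \<open>Cycles in the truncation\<close>

definition trunc_cyc :: "nat \<Rightarrow> ('c \<Rightarrow> 'r::comm_ring_1) set" where
  "trunc_cyc k = cyc X k \<inter> supported (V k)"

lemma fun_submodule_trunc_cyc: "fun_submodule (trunc_cyc k)"
  unfolding trunc_cyc_def by (rule fun_submodule_Int[OF fun_submodule_cyc fun_submodule_supported])

definition cycle_basis :: "nat \<Rightarrow> ('c \<Rightarrow> int) list" where
  "cycle_basis k = (SOME z. module_basis (fun_module (trunc_cyc k)) z)"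

lemma cycle_basis: "module_basis (fun_module (trunc_cyc k)) (cycle_basis k)"
proof -
  obtain es where es: "set es = V k"
    using finite_list[OF finite_subset[OF V_X finite_cells]] by blast
  have "\<exists>z. module_basis (fun_module (trunc_cyc k :: ('c \<Rightarrow> int) set)) z"
    using fun_submodule_free[OF principal_ideals_int _ _ fun_submodule_trunc_cyc, of real_of_int k es] es
    by (auto simp: trunc_cyc_def)
  then show ?thesis unfolding cycle_basis_def by (rule someI_ex)
qed

text \<open>The real cycles of the truncation are spanned by integral ones, and integral independence persists
over the reals.\<close>

lemma real_trunc_cyc_basis:
  assumes "module_basis (fun_module (trunc_cyc k)) z"
  shows "module_basis (fun_module (trunc_cyc k)) (map real_chain z)"
proof -
  have z: "set z \<subseteq> trunc_cyc k" "fun_indep z" "\<And>x. x \<in> trunc_cyc k \<Longrightarrow> \<exists>a. x = (\<lambda>e. \<Sum>i<length z. a i * (z ! i) e)"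
    using assms unfolding fun_module_basis_iff[OF fun_submodule_trunc_cyc] by auto
  have sub: "set (map real_chain z) \<subseteq> (trunc_cyc k :: ('c \<Rightarrow> real) set)"
    using z(1) by (auto simp: trunc_cyc_def cyc_def real_chain_supported boundary_real_chain real_chain_zero_iff subset_iff)
  let ?S = "fun_span (map real_chain z)"
  have "x \<in> ?S" if x: "x \<in> trunc_cyc k" for x
  proof (rule real_cycle_induct[OF T_V V_X fun_submodule_span])
    fix y :: "'c \<Rightarrow> int" assume "y \<in> cyc X k" "y \<in> supported (V k)"
    then obtain a where a: "y = (\<lambda>e. \<Sum>i<length z. a i * (z ! i) e)" using z(3) by (auto simp: trunc_cyc_def)
    show "real_chain y \<in> ?S"
      by (rule range_eqI[of _ _ "\<lambda>i. real_of_int (a i)"]) (simp add: a real_chain_def)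
  qed (use x in \<open>auto simp: trunc_cyc_def\<close>)
  moreover have "fun_indep (map real_chain z)"
    by (rule real_indep_if_int_indep[OF z(2) _ finite_cells[of k]]) (use z(1) cyc_supported in \<open>auto simp: trunc_cyc_def\<close>)
  ultimately show ?thesis
    unfolding fun_module_basis_iff[OF fun_submodule_trunc_cyc] using sub by blast
qed

abbreviation "HR k \<equiv> cw_homology X k :: (real, ('c \<Rightarrow> real) set) module"
abbreviation "cls k \<equiv> coset (bnd X k :: ('c \<Rightarrow> real) set)"

lemmas quotient_rules = fun_submodule_cyc[of X] fun_submodule_bnd[of X] bnd_subset_cyc

lemma lmod_HR: "lmod (HR k)"
  unfolding cw_homology_eq by (rule lmod_quotient[OF quotient_rules])

lemma HR_carrier: "carrier (HR k) = cls k ` cyc X k"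
  unfolding cw_homology_eq by (rule quotient_carrier[OF quotient_rules])

lemma cls_linear: "linear_map (fun_module (cyc X k)) (HR k) (cls k)"
  unfolding cw_homology_eq by (rule coset_linear[OF quotient_rules])

lemma trunc_cyc_iso: "linear_iso (fun_module (trunc_cyc k)) (HR k) (cls k)"
  unfolding linear_iso_def
proof
  show "linear_map (fun_module (trunc_cyc k)) (HR k) (cls k)"
    using cls_linear[of k] by (auto simp: linear_map_def trunc_cyc_def)
  show "bij_betw (cls k) (carrier (fun_module (trunc_cyc k))) (carrier (HR k))"
    using V_bij[of k] by (simp add: HR_carrier trunc_cyc_def)
qed

lemma trunc_cyc_class_basis:
  assumes "module_basis (fun_module (trunc_cyc k)) z"
  shows "module_basis (HR k) (map (cls k) (map real_chain z))"
  by (rule linear_iso_basis[OF lmod_fun_module[OF fun_submodule_trunc_cyc] lmod_HR trunc_cyc_iso real_trunc_cyc_basis[OF assms]])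

lemma exact_homology: "exact_triple (fun_module (bnd X k)) (fun_module (cyc X k)) (HR k) (cls k)"
  unfolding cw_homology_eq by (rule exact_quotient[OF quotient_rules])

lemma exact_boundary:
  "exact_triple (fun_module (cyc X k)) (fun_module (supported (cw_cells X k)))
     (fun_module (cw_boundary X k ` supported (cw_cells X k) :: ('c \<Rightarrow> real) set)) (cw_boundary X k)"
  unfolding exact_triple_def
proof (intro conjI)
  show "submodule_along (\<lambda>r. r) (fun_module (cyc X k)) (fun_module (supported (cw_cells X k)) :: (real, _) module)"
    by (rule fun_submodule_along[OF fun_submodule_supported fun_submodule_cyc cyc_supported])
  show "lmod (fun_module (cw_boundary X k ` supported (cw_cells X k) :: ('c \<Rightarrow> real) set))"
    by (rule lmod_fun_module[OF fun_submodule_boundary_image[OF fun_submodule_supported]])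
  show "linear_map (fun_module (supported (cw_cells X k)))
     (fun_module (cw_boundary X k ` supported (cw_cells X k) :: ('c \<Rightarrow> real) set)) (cw_boundary X k)"
    by (rule linear_boundary[OF fun_submodule_supported subset_refl])
qed (simp_all add: cyc_def)

text \<open>The exact sequences $0 \to B_k \to Z_k \to H_k \to 0$ and $0 \to Z_k \to C_k \to \partial C_k \to
0$, one after the other.\<close>

lemma chain_basis:
  assumes b: "module_basis (fun_module (bnd X k)) b"
    and w: "set w \<subseteq> cyc X k" "module_basis (HR k) (map (cls k) w)"
    and u: "set u \<subseteq> supported (cw_cells X k)"
      "module_basis (fun_module (cw_boundary X k ` supported (cw_cells X k))) (map (cw_boundary X k) u)"
  shows "module_basis (fun_module (supported (cw_cells X k)) :: (real, _) module) (b @ w @ u)"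
proof -
  have "module_basis (fun_module (cyc X k)) (b @ w)"
    by (rule exact_basis[OF exact_homology b _ w(2)]) (use w in simp)
  from exact_basis[OF exact_boundary this _ u(2)] u(1) show ?thesis by simp
qed

lemma chain_det:
  assumes b: "module_basis (fun_module (bnd X k)) b"
    and w: "set w \<subseteq> cyc X k" "module_basis (HR k) (map (cls k) w)"
    and u: "set u \<subseteq> supported (cw_cells X k)"
      "module_basis (fun_module (cw_boundary X k ` supported (cw_cells X k))) (map (cw_boundary X k) u)"
    and b': "set b' \<subseteq> bnd X k" "length b' = length b"
    and w': "set w' \<subseteq> cyc X k" "length w' = length w"
    and u': "set u' \<subseteq> supported (cw_cells X k)" "length u' = length u"
  shows "Determinant.det (basis_matrix (fun_module (supported (cw_cells X k)) :: (real, _) module) (b @ w @ u) (b' @ w' @ u'))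
    = Determinant.det (basis_matrix (fun_module (bnd X k)) b b')
      * Determinant.det (basis_matrix (HR k) (map (cls k) w) (map (cls k) w'))
      * Determinant.det (basis_matrix (fun_module (cw_boundary X k ` supported (cw_cells X k)))
          (map (cw_boundary X k) u) (map (cw_boundary X k) u'))"
proof -
  have bw: "module_basis (fun_module (cyc X k)) (b @ w)"
    by (rule exact_basis[OF exact_homology b _ w(2)]) (use w in simp)
  have "Determinant.det (basis_matrix (fun_module (supported (cw_cells X k)) :: (real, _) module) ((b @ w) @ u) ((b' @ w') @ u'))
    = Determinant.det (basis_matrix (fun_module (cyc X k)) (b @ w) (b' @ w'))
      * Determinant.det (basis_matrix (fun_module (cw_boundary X k ` supported (cw_cells X k)))
          (map (cw_boundary X k) u) (map (cw_boundary X k) u'))"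
  proof (rule exact_det[OF exact_boundary bw _ u(2)])
    show "set (b' @ w') \<subseteq> carrier (fun_module (cyc X k))" using b' w' bnd_subset_cyc by auto
  qed (use u u' b' w' in auto)
  also have "Determinant.det (basis_matrix (fun_module (cyc X k)) (b @ w) (b' @ w'))
    = Determinant.det (basis_matrix (fun_module (bnd X k)) b b')
      * Determinant.det (basis_matrix (HR k) (map (cls k) w) (map (cls k) w'))"
    by (rule exact_det[OF exact_homology b _ w(2)]) (use w w' b' in auto)
  finally show ?thesis by simp
qed

subsection \<open>The combinatorial basis of homology\<close>

abbreviation "HL k \<equiv> homology_lattice X k"

lemma cls_add: "x \<in> cyc X k \<Longrightarrow> y \<in> cyc X k \<Longrightarrow> cls k x \<oplus>\<^bsub>HR k\<^esub> cls k y = cls k (\<lambda>e. x e + y e)"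
  using cls_linear[of k] by (simp add: linear_map_def)

lemma cls_smult: "x \<in> cyc X k \<Longrightarrow> r \<odot>\<^bsub>HR k\<^esub> cls k x = cls k (\<lambda>e. r * x e)"
  using cls_linear[of k] by (simp add: linear_map_def)

lemma real_cyc: "z \<in> cyc X k \<Longrightarrow> real_chain z \<in> cyc X k"
  by (auto simp: cyc_def real_chain_supported boundary_real_chain real_chain_zero_iff)

text \<open>The union defining \<open>homology_map\<close> runs over chains that differ by boundaries. The
submodule \<open>B\<close> may be smaller than the boundaries of \<open>X\<close>, as it is for a
subcomplex.\<close>

lemma homology_map_coset:
  assumes "z \<in> cyc X k" "B \<subseteq> bnd X k" "(\<lambda>_. 0) \<in> B"
  shows "homology_map X k real_chain (coset B z) = cls k (real_chain z)"
proof -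
  have "cls k (real_chain y) = cls k (real_chain z)" if "y \<in> coset B z" for y
  proof -
    from that obtain b where b: "b \<in> B" "y = (\<lambda>e. b e + z e)" by (auto simp: coset_def)
    then obtain c where c: "c \<in> supported (cw_cells X (Suc k))" "b = cw_boundary X (Suc k) c"
      using assms(2) by (auto simp: bnd_def)
    have "real_chain b \<in> (bnd X k :: ('c \<Rightarrow> real) set)"
      unfolding bnd_def c(2) boundary_real_chain[symmetric] using c(1) by (intro imageI) (simp add: real_chain_supported)
    moreover have "(\<lambda>e. real_chain y e - real_chain z e) = real_chain b"
      unfolding b(2) by (simp add: real_chain_def)
    ultimately show ?thesis by (simp add: coset_eq_iff[OF fun_submodule_bnd])
  qed
  moreover have "z \<in> coset B z" unfolding coset_def using assms(3) by (rule rev_image_eqI) simp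
  ultimately have "(\<Union>y\<in>coset B z. cls k (real_chain y)) = cls k (real_chain z)"
    using UN_constant_eq[of z "coset B z"] by blast
  then show ?thesis
    by (simp add: homology_map_def cw_boundaries_eq cw_chains_eq a_r_coset_eq)
qed

lemma HL_carrier: "carrier (HL k) = (\<lambda>z. cls k (real_chain z)) ` cyc X k"
proof -
  have "carrier (cw_homology X k :: (int, _) module) = coset (bnd X k) ` cyc X k"
    unfolding cw_homology_eq by (rule quotient_carrier[OF quotient_rules])
  then show ?thesis
    using homology_map_coset[OF _ subset_refl fun_submodule_zero[OF fun_submodule_bnd]]
    by (simp add: homology_lattice_def Let_def image_image)
qed

lemma HL_sub: "submodule_along real_of_int (HL k) (HR k)"
proof -
  have z: "\<zero>\<^bsub>HR k\<^esub> = cls k (real_chain (\<lambda>_. 0))"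
  proof -
    have "\<zero>\<^bsub>HR k\<^esub> = bnd X k" unfolding cw_homology_eq by (rule quotient_zero[OF quotient_rules])
    moreover have "real_chain (\<lambda>_::'c. 0) = (\<lambda>_. 0)" by (simp add: real_chain_def)
    ultimately show ?thesis by (simp add: coset_zero)
  qed
  show ?thesis unfolding submodule_along_def
  proof (intro conjI ballI allI)
    show "lmod (HR k)" by (rule lmod_HR)
    show "carrier (HL k) \<subseteq> carrier (HR k)" unfolding HL_carrier HR_carrier using real_cyc by auto
    show "\<zero>\<^bsub>HR k\<^esub> \<in> carrier (HL k)"
      unfolding HL_carrier z by (rule imageI) (rule fun_submodule_zero[OF fun_submodule_cyc])
    fix x assume "x \<in> carrier (HL k)"
    then obtain c where c: "c \<in> cyc X k" "x = cls k (real_chain c)" unfolding HL_carrier by blast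
    show "real_of_int r \<odot>\<^bsub>HR k\<^esub> x \<in> carrier (HL k)" for r
    proof -
      have "real_of_int r \<odot>\<^bsub>HR k\<^esub> x = cls k (real_chain (\<lambda>e. r * c e))"
        using cls_smult[OF real_cyc[OF c(1)], of "real_of_int r"] c(2) by (simp add: real_chain_def)
      then show ?thesis unfolding HL_carrier using fun_submodule_smult[OF fun_submodule_cyc c(1)] by blast
    qed
    fix y assume "y \<in> carrier (HL k)"
    then obtain d where d: "d \<in> cyc X k" "y = cls k (real_chain d)" unfolding HL_carrier by blast
    have "x \<oplus>\<^bsub>HR k\<^esub> y = cls k (real_chain (\<lambda>e. c e + d e))"
      using cls_add[OF real_cyc[OF c(1)] real_cyc[OF d(1)]] c(2) d(2) by (simp add: real_chain_def)
    then show "x \<oplus>\<^bsub>HR k\<^esub> y \<in> carrier (HL k)"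
      unfolding HL_carrier using fun_submodule_add[OF fun_submodule_cyc c(1) d(1)] by blast
  qed (simp_all add: homology_lattice_def Let_def)
qed

text \<open>A $\mathbb{Z}$-basis of the lattice spans real homology because real cycles are combinations of
integral ones. For the independence, lift the basis to integral cycles: together with the
boundaries of the tree cells these are independent over $\mathbb{Z}$, hence over $\mathbb{R}$, and
the boundaries of the tree cells are a real basis of $B_k$.\<close>

lemma h_basis: "module_basis (HR k) (h k)"
proof -
  interpret R: lmod "HR k" by (rule lmod_HR)
  interpret L: lmod "HL k" by (rule submodule_along_lmod[OF HL_sub])
  interpret C: lmod "fun_module (cyc X k) :: (real, _) module" by (rule lmod_fun_module[OF fun_submodule_cyc])
  have hb: "module_basis (HL k) (h k)" using combinatorial by (simp add: combinatorial_basis_def)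
  have hL: "set (h k) \<subseteq> carrier (HL k)" by (rule L.basis_carrier[OF hb])
  then have hR: "set (h k) \<subseteq> carrier (HR k)" using HL_sub[of k] by (auto simp: submodule_along_def)
  note lc = submodule_along_lin_comb[OF HL_sub hL]
  obtain r where r: "\<And>x. x \<in> carrier (HL k) \<Longrightarrow> r x \<in> cyc X k \<and> cls k (real_chain (r x)) = x"
    unfolding HL_carrier using bchoice[of "(\<lambda>z. cls k (real_chain z)) ` cyc X k" "\<lambda>x z. z \<in> cyc X k \<and> cls k (real_chain z) = x"] by blast
  let ?z = "map r (h k)"
  have zc: "set ?z \<subseteq> cyc X k" using r hL by auto
  have rz: "set (map real_chain ?z) \<subseteq> cyc X k" using zc real_cyc by auto
  have cz: "map (cls k) (map real_chain ?z) = h k" using r hL by (auto intro!: map_idI)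
  have lcz: "lin_comb (HR k) (h k) a = cls k (\<lambda>e. \<Sum>i<length ?z. a i * (map real_chain ?z ! i) e)" for a
    using linear_map_lin_comb[OF C.lmod_axioms lmod_HR cls_linear, of "map real_chain ?z" a] rz
      lin_comb_fun_module[OF fun_submodule_cyc rz] unfolding cz by simp
  have R0: "\<zero>\<^bsub>HR k\<^esub> = bnd X k" unfolding cw_homology_eq by (rule quotient_zero[OF quotient_rules])
  have L0: "\<zero>\<^bsub>HL k\<^esub> = \<zero>\<^bsub>HR k\<^esub>" using HL_sub by (simp add: submodule_along_def)
  let ?b = "tree_bnd (Suc k) :: ('c \<Rightarrow> int) list"
  have bB: "(\<lambda>x. \<Sum>i<length (tree_bnd (Suc k) :: ('c \<Rightarrow> real) list). a i * (tree_bnd (Suc k) ! i) x) \<in> bnd X k" for a :: "nat \<Rightarrow> real"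
  proof -
    have "set (tree_bnd (Suc k) :: ('c \<Rightarrow> real) list) \<subseteq> bnd X k" using bnd_basis[of k] by (simp add: module_basis_def)
    from span_subset[OF fun_submodule_bnd this] show ?thesis by blast
  qed
  have int: "fun_indep (?b @ ?z)"
    unfolding fun_indep_def
  proof (intro allI impI)
    fix a :: "nat \<Rightarrow> int" and i
    assume a: "\<forall>e. (\<Sum>i<length (?b @ ?z). a i * ((?b @ ?z) ! i) e) = 0" and i: "i < length (?b @ ?z)"
    have a': "(\<Sum>i<length ?z. a (length ?b + i) * (?z ! i) x) = - (\<Sum>i<length ?b. a i * (?b ! i) x)" for x
      using a[rule_format, of x] unfolding sum_append by linarith
    have "(\<Sum>i<length ?z. real_of_int (a (length ?b + i)) * (map real_chain ?z ! i) x)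
       = - 1 * (\<Sum>i<length ?b. real_of_int (a i) * ((tree_bnd (Suc k) :: ('c \<Rightarrow> real) list) ! i) x)" for x
    proof -
      have "(\<Sum>i<length ?z. real_of_int (a (length ?b + i)) * (map real_chain ?z ! i) x)
         = real_of_int (\<Sum>i<length ?z. a (length ?b + i) * (?z ! i) x)" by (simp add: real_chain_def)
      also have "\<dots> = - 1 * (\<Sum>i<length ?b. real_of_int (a i) * (map real_chain ?b ! i) x)"
        unfolding a' by (simp add: real_chain_def)
      finally show ?thesis unfolding real_tree_bnd .
    qed
    then have "lin_comb (HR k) (h k) (\<lambda>i. real_of_int (a (length ?b + i)))
       = cls k (\<lambda>x. - 1 * (\<Sum>i<length ?b. real_of_int (a i) * ((tree_bnd (Suc k) :: ('c \<Rightarrow> real) list) ! i) x))"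
      unfolding lcz by simp
    also have "\<dots> = bnd X k"
      unfolding coset_eq_zero_iff[OF fun_submodule_bnd]
      by (rule fun_submodule_smult[OF fun_submodule_bnd]) (use bB in \<open>simp add: tree_bnd_def\<close>)
    finally have "lin_comb (HL k) (h k) (\<lambda>i. a (length ?b + i)) = \<zero>\<^bsub>HL k\<^esub>" unfolding lc L0 R0 .
    then have z: "\<forall>i<length (h k). a (length ?b + i) = 0" using hb unfolding L.module_basis_iff L.indep_def by blast
    then have "\<forall>x. (\<Sum>i<length ?b. a i * (?b ! i) x) = 0" using a' by simp
    then have y: "\<forall>i<length ?b. a i = 0" using tree_bnd_indep(1)[of "Suc k"] unfolding fun_indep_def by blast
    show "a i = 0" using z[rule_format, of "i - length ?b"] y[rule_format, of i] i by (cases "i < length ?b") auto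
  qed
  have "set (?b @ ?z) \<subseteq> supported (cw_cells X k)"
    using zc cyc_supported boundary_supported[of "Suc k"] by (auto simp: tree_bnd_def simp del: cw_boundary.simps)
  from real_indep_if_int_indep[OF int this finite_cells]
  have real: "fun_indep (tree_bnd (Suc k) @ map real_chain ?z)" by (simp add: real_tree_bnd)
  show ?thesis unfolding R.module_basis_iff
  proof (intro conjI ballI hR)
    show "R.indep (h k)" unfolding R.indep_def
    proof (intro allI impI)
      fix a i assume a: "lin_comb (HR k) (h k) a = \<zero>\<^bsub>HR k\<^esub>" and i: "i < length (h k)"
      have "(\<lambda>e. \<Sum>i<length ?z. a i * (map real_chain ?z ! i) e) \<in> bnd X k"
        using a unfolding lcz R0 coset_eq_zero_iff[OF fun_submodule_bnd] .
      then obtain c where c: "(\<lambda>e. \<Sum>i<length ?z. a i * (map real_chain ?z ! i) e)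
          = (\<lambda>e. \<Sum>i<length (tree_bnd (Suc k) :: ('c \<Rightarrow> real) list). c i * (tree_bnd (Suc k) ! i) e)"
        using bnd_basis[of k] unfolding fun_module_basis_iff[OF fun_submodule_bnd] by blast
      let ?l = "length (tree_bnd (Suc k) :: ('c \<Rightarrow> real) list)"
      let ?a = "\<lambda>i. if i < ?l then - c i else a (i - ?l)"
      have "(\<Sum>i<length (tree_bnd (Suc k) @ map real_chain ?z). ?a i * ((tree_bnd (Suc k) @ map real_chain ?z) ! i) x) = 0" for x
        unfolding sum_append using fun_cong[OF c, of x] by (simp add: sum_negf)
      then have "\<forall>i<length (tree_bnd (Suc k) @ map real_chain ?z). ?a i = 0"
        using real[unfolded fun_indep_def, THEN spec[of _ ?a]] by blast
      from this[rule_format, of "?l + i"] show "a i = 0" using i by simp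
    qed
    fix x assume "x \<in> carrier (HR k)"
    then obtain c where c: "c \<in> cyc X k" "x = cls k c" unfolding HR_carrier by blast
    let ?S = "{c \<in> cyc X k. \<exists>a. cls k c = lin_comb (HR k) (h k) a}"
    have "c \<in> ?S"
    proof (rule real_cycle_induct[OF T_X subset_refl])
      show "fun_submodule ?S" unfolding fun_submodule_def
      proof (intro conjI ballI allI)
        have "cls k (\<lambda>_. 0) = lin_comb (HR k) (h k) (\<lambda>_. 0)"
          using R.lin_comb_zero[OF _ hR] by (simp add: coset_zero R0)
        then show "(\<lambda>_. 0) \<in> ?S" using fun_submodule_zero[OF fun_submodule_cyc] by blast
        fix c assume "c \<in> ?S"
        then obtain a where a: "c \<in> cyc X k" "cls k c = lin_comb (HR k) (h k) a" by blast
        have "cls k (\<lambda>e. r * c e) = lin_comb (HR k) (h k) (\<lambda>i. r * a i)" for r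
          using cls_smult[OF a(1)] a(2) R.lin_comb_smult[OF hR] by simp
        then show "(\<lambda>e. r * c e) \<in> ?S" for r using fun_submodule_smult[OF fun_submodule_cyc a(1)] by blast
        fix d assume "d \<in> ?S"
        then obtain b where b: "d \<in> cyc X k" "cls k d = lin_comb (HR k) (h k) b" by blast
        have "cls k (\<lambda>e. c e + d e) = lin_comb (HR k) (h k) (\<lambda>i. a i + b i)"
          using cls_add[OF a(1) b(1)] a(2) b(2) R.lin_comb_add[OF hR] by simp
        then show "(\<lambda>e. c e + d e) \<in> ?S" using fun_submodule_add[OF fun_submodule_cyc a(1) b(1)] by blast
      qed
      fix z :: "'c \<Rightarrow> int" assume z: "z \<in> cyc X k"
      then have "cls k (real_chain z) \<in> carrier (HL k)" unfolding HL_carrier by blast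
      then obtain a where "cls k (real_chain z) = lin_comb (HL k) (h k) a" using hb unfolding L.module_basis_iff by blast
      then show "real_chain z \<in> ?S" using real_cyc[OF z] unfolding lc by blast
    qed (use c cyc_supported in auto)
    then show "\<exists>a. x = lin_comb (HR k) (h k) a" using c(2) by blast
  qed
qed

end

section \<open>One factor of the torsion as a product of indices\<close>

text \<open>Two of the multiples of \<open>x\<close> lie in the same coset.\<close>

lemma finite_index_multiple:
  fixes G K :: "('c \<Rightarrow> int) set"
  assumes G: "fun_submodule G" and K: "fun_submodule K" and fin: "sub_index G K \<noteq> 0" and x: "x \<in> G"
  obtains n :: int where "n \<noteq> 0" "(\<lambda>e. n * x e) \<in> K"
proof -
  let ?c = "\<lambda>x. {y. y - x \<in> K}"
  let ?f = "\<lambda>n::nat. ?c (\<lambda>e. int n * x e)"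
  have "finite (?c ` G)" using fin unfolding sub_index_def by (metis card.infinite)
  moreover have "range ?f \<subseteq> ?c ` G"
  proof
    fix C assume "C \<in> range ?f"
    then obtain n where "C = ?c (\<lambda>e. int n * x e)" by blast
    then show "C \<in> ?c ` G" using fun_submodule_smult[OF G x, of "int n"] by blast
  qed
  ultimately have "finite (range ?f)" by (rule finite_subset[rotated])
  then have "\<not> inj ?f" using finite_imageD infinite_UNIV_nat by blast
  then obtain m n where mn: "m \<noteq> n" "?f m = ?f n" by (auto simp: inj_def)
  then have "(\<lambda>e. int m * x e) - (\<lambda>e. int n * x e) \<in> K"
    using same_coset_iff[OF fun_submodule_add_subgroup[OF K]] by blast
  then have "(\<lambda>e. (int m - int n) * x e) \<in> K" by (simp add: fun_diff_def left_diff_distrib)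
  moreover have "int m - int n \<noteq> 0" using mn by simp
  ultimately show ?thesis using that by blast
qed

lemma sum_setI:
  "x \<in> A \<Longrightarrow> y \<in> B \<Longrightarrow> z = (\<lambda>e. x e + y e) \<Longrightarrow> z \<in> {\<lambda>e. x e + y e | x y. x \<in> A \<and> y \<in> B}"
  by blast

lemma sum_setE:
  "z \<in> {\<lambda>e. x e + y e | x y. x \<in> A \<and> y \<in> B} \<Longrightarrow>
    (\<And>x y. x \<in> A \<Longrightarrow> y \<in> B \<Longrightarrow> z = (\<lambda>e. x e + y e) \<Longrightarrow> P) \<Longrightarrow> P"
  by blast

lemma span_append:
  "fun_span (us @ ws)
   = {\<lambda>e. x e + y e | x y. x \<in> fun_span us
       \<and> y \<in> fun_span ws}"
proof (intro Set.set_eqI iffI)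
  fix z assume "z \<in> fun_span (us @ ws)"
  then obtain a where "z = (\<lambda>e. \<Sum>i<length (us @ ws). a i * ((us @ ws) ! i) e)" by blast
  then have "z = (\<lambda>e. (\<Sum>i<length us. a i * (us ! i) e) + (\<Sum>i<length ws. a (length us + i) * (ws ! i) e))"
    unfolding sum_append .
  then show "z \<in> {\<lambda>e. x e + y e | x y. x \<in> fun_span us
       \<and> y \<in> fun_span ws}"
    by (intro sum_setI[of "\<lambda>e. \<Sum>i<length us. a i * (us ! i) e" _ "\<lambda>e. \<Sum>i<length ws. a (length us + i) * (ws ! i) e"])
      (rule range_eqI[of _ _ a], simp, rule range_eqI[of _ _ "\<lambda>i. a (length us + i)"], simp, simp)
next
  fix z assume "z \<in> {\<lambda>e. x e + y e | x y. x \<in> fun_span us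
       \<and> y \<in> fun_span ws}"
  then obtain a b where z: "z = (\<lambda>e. (\<Sum>i<length us. a i * (us ! i) e) + (\<Sum>i<length ws. b i * (ws ! i) e))" by blast
  show "z \<in> fun_span (us @ ws)"
    by (rule range_eqI[of _ _ "\<lambda>i. if i < length us then a i else b (i - length us)"])
      (unfold sum_append, simp add: z)
qed

lemma det_of_int_mat: "Determinant.det (map_mat real_of_int A) = real_of_int (Determinant.det A)"
  by (rule of_int_hom.hom_det)

context truncated_cw
begin

abbreviation "CR k \<equiv> fun_module (supported (cw_cells X k)) :: (real, 'c \<Rightarrow> real) module"

lemma lmod_CR: "lmod (CR k)" by (rule lmod_fun_module[OF fun_submodule_supported])

text \<open>The integral basis of the real chains into which the determinant of degree \<open>k\<close> is
expanded: boundaries, cycles of the truncation and cells of the tree.\<close>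

definition adapted :: "nat \<Rightarrow> ('c \<Rightarrow> int) list" where
  "adapted k = tree_bnd (Suc k) @ cycle_basis k @ map basis_fun (tree k)"

lemma real_adapted:
  "map real_chain (adapted k) = tree_bnd (Suc k) @ map real_chain (cycle_basis k) @ map basis_fun (tree k)"
  by (simp add: adapted_def real_tree_bnd real_chain_basis_fun)

lemma map_boundary_tree: "map (cw_boundary X k) (map basis_fun (tree k)) = tree_bnd k"
  by (simp add: tree_bnd_def)

lemma tree_supported: "set (map basis_fun (tree k)) \<subseteq> supported (cw_cells X k)"
  using tree(2)[of k] T_X[of k] by (auto intro!: basis_fun_supported)

lemma cycle_basis_cyc: "set (map real_chain (cycle_basis k)) \<subseteq> cyc X k"
  using real_trunc_cyc_basis[OF cycle_basis, of k] by (auto simp: module_basis_def trunc_cyc_def)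

lemma adapted_basis: "module_basis (CR k) (map real_chain (adapted k))"
  unfolding real_adapted
  by (rule chain_basis[OF bnd_basis cycle_basis_cyc trunc_cyc_class_basis[OF cycle_basis] tree_supported])
    (unfold map_boundary_tree, rule tree_bnd_basis)

lemma adapted_supported: "set (adapted k) \<subseteq> supported (cw_cells X k)"
proof -
  have "set (map real_chain (adapted k)) \<subseteq> supported (cw_cells X k)"
    using adapted_basis[of k] by (simp add: module_basis_def)
  then show ?thesis by (auto simp: real_chain_supported)
qed

lemma adapted_indep: "fun_indep (adapted k)"
  unfolding fun_indep_def
proof (intro allI impI)
  fix a :: "nat \<Rightarrow> int" and i
  assume a: "\<forall>e. (\<Sum>i<length (adapted k). a i * (adapted k ! i) e) = 0" and i: "i < length (adapted k)"
  have "(\<Sum>i<length (map real_chain (adapted k)). real_of_int (a i) * (map real_chain (adapted k) ! i) e) = 0" for e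
  proof -
    have "(\<Sum>i<length (map real_chain (adapted k)). real_of_int (a i) * (map real_chain (adapted k) ! i) e)
      = real_of_int (\<Sum>i<length (adapted k). a i * (adapted k ! i) e)" by (simp add: real_chain_def)
    then show ?thesis using a by simp
  qed
  moreover have "fun_indep (map real_chain (adapted k))"
    using adapted_basis unfolding fun_module_basis_iff[OF fun_submodule_supported] by blast
  ultimately have "\<forall>i<length (map real_chain (adapted k)). real_of_int (a i) = 0"
    unfolding fun_indep_def by (elim allE[of _ "\<lambda>i. real_of_int (a i)"]) blast
  then show "a i = 0" using i by simp
qed

definition adapted_lattice :: "nat \<Rightarrow> ('c \<Rightarrow> int) set" where
  "adapted_lattice k = fun_span (adapted k)"

lemma fun_submodule_adapted_lattice: "fun_submodule (adapted_lattice k)"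
  unfolding adapted_lattice_def by (rule fun_submodule_span)

lemma adapted_lattice_subset: "adapted_lattice k \<subseteq> supported (cw_cells X k)"
  unfolding adapted_lattice_def by (rule span_subset[OF fun_submodule_supported adapted_supported])

lemma real_basis_matrix_basis_funs:
  assumes "distinct cs" "set vs \<subseteq> supported (set cs)"
  shows "basis_matrix (fun_module (supported (set cs)) :: (real, 'd \<Rightarrow> real) module) (map basis_fun cs) (map real_chain vs)
    = map_mat real_of_int (basis_matrix (fun_module (supported (set cs)) :: (int, 'd \<Rightarrow> int) module) (map basis_fun cs) vs)"
proof -
  have "set (map real_chain vs) \<subseteq> supported (set cs)" using assms(2) by (auto simp: real_chain_supported)
  from basis_matrix_basis_funs[OF assms(1) this] show ?thesis
    unfolding basis_matrix_basis_funs[OF assms] by (auto simp: real_chain_def)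
qed

lemma cells_basis: "distinct cs \<Longrightarrow> set cs = cw_cells X k \<Longrightarrow> module_basis (CR k) (map basis_fun cs)"
  using basis_funs[of cs] by auto

text \<open>The list \<open>adapted k\<close> is a basis of the lattice that it spans, and it has as many
entries as there are cells, so \<open>det_eq_index\<close> applies.\<close>

lemma adapted_index:
  assumes cs: "distinct cs" "set cs = cw_cells X k"
  shows "real (sub_index (supported (cw_cells X k)) (adapted_lattice k))
    = \<bar>Determinant.det (basis_matrix (CR k) (map basis_fun cs) (map real_chain (adapted k)))\<bar>"
    and "sub_index (supported (cw_cells X k)) (adapted_lattice k) \<noteq> 0"
proof -
  have b: "module_basis (CR k) (map basis_fun cs)" by (rule cells_basis[OF cs])
  have len: "length (adapted k) = length cs"
    using basis_length_unique[OF lmod_CR adapted_basis b] by simp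
  have lb: "module_basis (fun_module (adapted_lattice k)) (adapted k)"
    unfolding adapted_lattice_def by (rule basis_of_span[OF adapted_indep])
  have "real (sub_index (supported (set cs)) (adapted_lattice k))
    = \<bar>real_of_int (Determinant.det (basis_matrix (fun_module (supported (set cs))) (map basis_fun cs) (adapted k)))\<bar>"
    by (rule det_eq_index[OF cs(1) fun_submodule_adapted_lattice _ lb len]) (simp add: cs(2) adapted_lattice_subset)
  also have "real_of_int (Determinant.det (basis_matrix (fun_module (supported (set cs))) (map basis_fun cs) (adapted k)))
     = Determinant.det (basis_matrix (fun_module (supported (set cs))) (map basis_fun cs) (map real_chain (adapted k)))"
    by (subst real_basis_matrix_basis_funs[OF cs(1)]) (simp_all add: cs(2) adapted_supported det_of_int_mat)
  finally show 1: "real (sub_index (supported (cw_cells X k)) (adapted_lattice k))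
    = \<bar>Determinant.det (basis_matrix (CR k) (map basis_fun cs) (map real_chain (adapted k)))\<bar>" by (simp add: cs(2))
  have "Determinant.det (basis_matrix (CR k) (map basis_fun cs) (map real_chain (adapted k))) \<noteq> 0"
    using basis_det_inverse[OF lmod_CR b adapted_basis] by auto
  then show "sub_index (supported (cw_cells X k)) (adapted_lattice k) \<noteq> 0" using 1 by auto
qed

definition tree_image :: "nat \<Rightarrow> ('c \<Rightarrow> int) set" where
  "tree_image k = cw_boundary X k ` supported (T k)"

definition trunc_image :: "nat \<Rightarrow> ('c \<Rightarrow> int) set" where
  "trunc_image k = cw_boundary X k ` supported (V k)"

lemma fun_submodule_images: "fun_submodule (tree_image k)" "fun_submodule (trunc_image k)"
  unfolding tree_image_def trunc_image_def by (rule fun_submodule_boundary_image[OF fun_submodule_supported])+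

lemma tree_image_trunc_image: "tree_image k \<subseteq> trunc_image k"
  unfolding tree_image_def trunc_image_def by (rule image_mono[OF supported_mono[OF T_V]])

lemma tree_image_cyc: "tree_image (Suc k) \<subseteq> cyc X k"
  using boundary_boundary boundary_in_supported by (auto simp: tree_image_def cyc_def simp del: cw_boundary.simps)

lemma trunc_image_cyc: "trunc_image (Suc k) \<subseteq> cyc X k"
  using boundary_boundary boundary_in_supported by (auto simp: trunc_image_def cyc_def simp del: cw_boundary.simps)

definition cyc_plus_tree :: "nat \<Rightarrow> ('c \<Rightarrow> int) set" where
  "cyc_plus_tree k = {\<lambda>e. v e + u e | v u. v \<in> trunc_cyc k \<and> u \<in> supported (T k)}"

lemma adapted_lattice_eq:
  "adapted_lattice k = {\<lambda>e. p e + w e | p w. p \<in> tree_image (Suc k) \<and> w \<in> cyc_plus_tree k}"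
proof -
  have b1: "module_basis (fun_module (tree_image (Suc k))) (tree_bnd (Suc k) :: ('c \<Rightarrow> int) list)"
    unfolding tree_image_def by (rule tree_bnd_basis_gen) (rule T_inj)
  have b3: "module_basis (fun_module (supported (T k)) :: (int, _) module) (map basis_fun (tree k))"
    using basis_funs[OF tree(1)] by (simp add: tree(2))
  show ?thesis
    unfolding adapted_lattice_def adapted_def span_append basis_span[OF fun_submodule_images(1) b1]
      basis_span[OF fun_submodule_trunc_cyc cycle_basis] basis_span[OF fun_submodule_supported b3] cyc_plus_tree_def ..
qed

lemma cyc_plus_treeI: "v \<in> trunc_cyc k \<Longrightarrow> u \<in> supported (T k) \<Longrightarrow> z = (\<lambda>e. v e + u e) \<Longrightarrow> z \<in> cyc_plus_tree k"
  unfolding cyc_plus_tree_def by (rule sum_setI)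

lemma cyc_plus_treeE:
  assumes "z \<in> cyc_plus_tree k"
  obtains v u where "v \<in> trunc_cyc k" "u \<in> supported (T k)" "z = (\<lambda>e. v e + u e)"
  using assms unfolding cyc_plus_tree_def by (rule sum_setE)

lemma adapted_latticeE:
  assumes "z \<in> adapted_lattice k"
  obtains p w where "p \<in> tree_image (Suc k)" "w \<in> cyc_plus_tree k" "z = (\<lambda>e. p e + w e)"
  using assms unfolding adapted_lattice_eq by (rule sum_setE)

lemma cyc_plus_tree_supported: "cyc_plus_tree k \<subseteq> supported (V k)"
proof
  fix z assume "z \<in> cyc_plus_tree k"
  then obtain v u where z: "v \<in> trunc_cyc k" "u \<in> supported (T k)" "z = (\<lambda>e. v e + u e)" by (rule cyc_plus_treeE)
  have "v \<in> supported (V k)" "u \<in> supported (V k)"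
    using z(1,2) supported_mono[OF T_V, of k] by (auto simp: trunc_cyc_def)
  then show "z \<in> supported (V k)" unfolding z(3) by (rule fun_submodule_add[OF fun_submodule_supported])
qed

lemma zero_cyc_plus_tree: "(\<lambda>_. 0) \<in> cyc_plus_tree k"
  by (rule cyc_plus_treeI[OF fun_submodule_zero[OF fun_submodule_trunc_cyc] fun_submodule_zero[OF fun_submodule_supported]]) simp

lemma adapted_latticeI:
  "p \<in> tree_image (Suc k) \<Longrightarrow> w \<in> cyc_plus_tree k \<Longrightarrow> z = (\<lambda>e. p e + w e) \<Longrightarrow> z \<in> adapted_lattice k"
  unfolding adapted_lattice_eq by (rule sum_setI)

text \<open>Such a boundary is a cycle of the truncation, and it represents the zero class like the cycle 0.\<close>

lemma tree_image_Int_trunc: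
  assumes "p \<in> tree_image (Suc k)" "p \<in> supported (V k)" shows "p = (\<lambda>_. 0)"
proof -
  have p: "p \<in> cyc X k" using assms(1) tree_image_cyc by blast
  obtain c where c: "c \<in> supported (T (Suc k))" "p = cw_boundary X (Suc k) c" using assms(1) by (auto simp: tree_image_def)
  have "c \<in> supported (cw_cells X (Suc k))" using c(1) supported_mono[OF T_X] by blast
  then have "real_chain p \<in> (bnd X k :: ('c \<Rightarrow> real) set)"
    unfolding c(2) bnd_def boundary_real_chain[symmetric] by (intro imageI) (simp add: real_chain_supported)
  then have "cls k (real_chain p) = cls k (\<lambda>_. 0)"
    by (simp add: coset_zero coset_eq_zero_iff[OF fun_submodule_bnd])
  moreover have "real_chain p \<in> cyc X k \<inter> supported (V k)" using real_cyc[OF p] assms(2) by (simp add: real_chain_supported)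
  moreover have "(\<lambda>_. 0) \<in> cyc X k \<inter> (supported (V k) :: ('c \<Rightarrow> real) set)"
    using fun_submodule_zero[OF fun_submodule_Int[OF fun_submodule_cyc fun_submodule_supported]] .
  ultimately have "real_chain p = (\<lambda>_. 0)" using V_bij[of k] unfolding bij_betw_def by (meson inj_onD)
  then show ?thesis by (simp add: real_chain_zero_iff)
qed

text \<open>The projection of $C_k(X;\mathbb{Z})$ onto $C_k(X/V^k;\mathbb{Z})$, whose restriction to the
boundaries of $T^{k+1}$ is $q_k$.\<close>

definition quot :: "nat \<Rightarrow> ('c \<Rightarrow> int) \<Rightarrow> 'c \<Rightarrow> int" where
  "quot k c = (\<lambda>e. if e \<in> cw_cells X k - V k then c e else 0)"

definition coker_index :: "nat \<Rightarrow> nat" where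
  "coker_index k = sub_index (supported (cw_cells X k - V k)) (quot k ` tree_image (Suc k))"

text \<open>The projection sees only the first part of the adapted list. An element of the lattice in its
kernel has a first part supported in the truncation, which is therefore 0; so the kernel of the
projection on the lattice is \<open>cyc_plus_tree k\<close>.\<close>

lemma index_step_quot:
  "sub_index (supported (cw_cells X k)) (adapted_lattice k)
    = coker_index k * sub_index (supported (V k)) (cyc_plus_tree k)"
proof -
  let ?G = "supported (cw_cells X k) :: ('c \<Rightarrow> int) set" and ?L = "adapted_lattice k"
  have "sub_index ?G ?L = sub_index (quot k ` ?G) (quot k ` ?L) * sub_index {x \<in> ?G. quot k x = 0} {x \<in> ?L. quot k x = 0}"
    by (rule sub_index_hom[OF _ fun_submodule_add_subgroup[OF fun_submodule_supported]
          fun_submodule_add_subgroup[OF fun_submodule_adapted_lattice] adapted_lattice_subset])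
      (auto simp: quot_def fun_diff_def)
  moreover have "quot k ` ?G = supported (cw_cells X k - V k)"
  proof
    show "supported (cw_cells X k - V k) \<subseteq> quot k ` ?G"
    proof
      fix c :: "'c \<Rightarrow> int" assume "c \<in> supported (cw_cells X k - V k)"
      then have "c = quot k c" "c \<in> ?G" by (auto simp: quot_def supported_def)
      then show "c \<in> quot k ` ?G" by (rule image_eqI)
    qed
  qed (auto simp: quot_def supported_def)
  moreover have V0: "quot k w = (\<lambda>_. 0)" if "w \<in> supported (V k)" for w
    using that by (auto simp: quot_def supported_def)
  have add: "quot k (\<lambda>e. c e + d e) = (\<lambda>e. quot k c e + quot k d e)" for c d by (auto simp: quot_def)
  have q: "quot k (\<lambda>e. p e + w e) = quot k p" if "w \<in> cyc_plus_tree k" for p w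
    using V0 that cyc_plus_tree_supported[of k] unfolding add by auto
  have ker: "x \<in> supported (V k)" if "x \<in> ?G" "quot k x = 0" for x
  proof -
    have "x e = 0" if e: "e \<notin> V k" for e
    proof (cases "e \<in> cw_cells X k")
      case True
      have "quot k x e = 0" using \<open>quot k x = 0\<close> by simp
      then show ?thesis using True e by (simp add: quot_def)
    next
      case False
      then show ?thesis using \<open>x \<in> ?G\<close> by (simp add: supported_def)
    qed
    then show ?thesis by (simp add: supported_def)
  qed
  have "quot k ` ?L = quot k ` tree_image (Suc k)"
  proof
    show "quot k ` ?L \<subseteq> quot k ` tree_image (Suc k)"
    proof
      fix x assume "x \<in> quot k ` ?L"
      then obtain z where z: "z \<in> ?L" "x = quot k z" by blast
      from z(1) obtain p w where "p \<in> tree_image (Suc k)" "w \<in> cyc_plus_tree k" "z = (\<lambda>e. p e + w e)"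
        by (rule adapted_latticeE)
      then show "x \<in> quot k ` tree_image (Suc k)" using q z(2) by auto
    qed
    have "p \<in> ?L" if "p \<in> tree_image (Suc k)" for p
      by (rule adapted_latticeI[OF that zero_cyc_plus_tree]) simp
    then show "quot k ` tree_image (Suc k) \<subseteq> quot k ` ?L" by blast
  qed
  moreover have "{x \<in> ?G. quot k x = 0} = supported (V k)"
    using ker V0 supported_mono[OF V_X, of k] by (auto simp: zero_fun_def)
  moreover have "{x \<in> ?L. quot k x = 0} = cyc_plus_tree k"
  proof
    show "{x \<in> ?L. quot k x = 0} \<subseteq> cyc_plus_tree k"
    proof
      fix x assume x: "x \<in> {x \<in> ?L. quot k x = 0}"
      then have "x \<in> ?L" by simp
      then obtain p w where w: "p \<in> tree_image (Suc k)" "w \<in> cyc_plus_tree k" "x = (\<lambda>e. p e + w e)"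
        by (rule adapted_latticeE)
      have q0: "quot k p = 0" using x q[OF w(2)] w(3) by simp
      have "p \<in> ?G" using w(1) tree_image_cyc cyc_supported by blast
      from tree_image_Int_trunc[OF w(1) ker[OF this q0]] show "x \<in> cyc_plus_tree k" using w(2,3) by simp
    qed
    have "w \<in> ?L" if "w \<in> cyc_plus_tree k" for w
      by (rule adapted_latticeI[OF fun_submodule_zero[OF fun_submodule_images(1)] that]) simp
    then show "cyc_plus_tree k \<subseteq> {x \<in> ?L. quot k x = 0}"
      using V0 cyc_plus_tree_supported[of k] by (auto simp: zero_fun_def)
  qed
  ultimately show ?thesis by (simp add: coker_index_def)
qed

text \<open>The boundary kills the cycles of the truncation and nothing else on \<open>supported (V
k)\<close>. As they all belong to \<open>cyc_plus_tree k\<close>, the kernels contribute the index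
1.\<close>

lemma index_step_boundary:
  "sub_index (supported (V k)) (cyc_plus_tree k) = sub_index (trunc_image k) (tree_image k)"
proof -
  let ?G = "supported (V k) :: ('c \<Rightarrow> int) set" and ?f = "cw_boundary X k :: ('c \<Rightarrow> int) \<Rightarrow> _"
  let ?K = "cyc_plus_tree k"
  have K: "fun_submodule ?K"
  proof -
    have b: "module_basis (fun_module (supported (T k)) :: (int, _) module) (map basis_fun (tree k))"
      using basis_funs[OF tree(1)] by (simp add: tree(2))
    have "fun_span (cycle_basis k @ map basis_fun (tree k)) = ?K"
      unfolding span_append basis_span[OF fun_submodule_trunc_cyc cycle_basis] basis_span[OF fun_submodule_supported b] cyc_plus_tree_def ..
    then show ?thesis using fun_submodule_span[of "cycle_basis k @ map basis_fun (tree k)"] by simp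
  qed
  have fv: "?f (\<lambda>e. v e + u e) = ?f u" if "v \<in> trunc_cyc k" for v u
    using that unfolding boundary_add by (simp add: trunc_cyc_def cyc_def)
  have "sub_index ?G ?K = sub_index (?f ` ?G) (?f ` ?K) * sub_index {x \<in> ?G. ?f x = 0} {x \<in> ?K. ?f x = 0}"
    by (rule sub_index_hom[OF _ fun_submodule_add_subgroup[OF fun_submodule_supported]
          fun_submodule_add_subgroup[OF K] cyc_plus_tree_supported])
      (simp add: fun_diff_def boundary_diff)
  moreover have "?f ` ?K = tree_image k"
  proof
    show "?f ` ?K \<subseteq> tree_image k"
    proof
      fix x assume "x \<in> ?f ` ?K"
      then obtain z where z: "z \<in> ?K" "x = ?f z" by blast
      from z(1) obtain v u where "v \<in> trunc_cyc k" "u \<in> supported (T k)" "z = (\<lambda>e. v e + u e)" by (rule cyc_plus_treeE)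
      then show "x \<in> tree_image k" using fv z(2) by (auto simp: tree_image_def)
    qed
    have "u \<in> ?K" if "u \<in> supported (T k)" for u
      by (rule cyc_plus_treeI[OF fun_submodule_zero[OF fun_submodule_trunc_cyc] that]) simp
    then show "tree_image k \<subseteq> ?f ` ?K" unfolding tree_image_def by blast
  qed
  moreover have "{x \<in> ?G. ?f x = 0} = trunc_cyc k"
    using supported_mono[OF V_X, of k] by (auto simp: trunc_cyc_def cyc_def zero_fun_def)
  moreover have "{x \<in> ?K. ?f x = 0} = trunc_cyc k"
  proof
    show "{x \<in> ?K. ?f x = 0} \<subseteq> trunc_cyc k"
      using cyc_plus_tree_supported[of k] supported_mono[OF V_X, of k] by (auto simp: trunc_cyc_def cyc_def zero_fun_def)
    have "v \<in> ?K" if "v \<in> trunc_cyc k" for v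
      by (rule cyc_plus_treeI[OF that fun_submodule_zero[OF fun_submodule_supported]]) simp
    then show "trunc_cyc k \<subseteq> {x \<in> ?K. ?f x = 0}" by (auto simp: trunc_cyc_def cyc_def zero_fun_def)
  qed
  moreover have "sub_index (trunc_cyc k :: ('c \<Rightarrow> int) set) (trunc_cyc k) = 1"
    by (rule sub_index_self[OF fun_submodule_add_subgroup[OF fun_submodule_trunc_cyc]])
  ultimately show ?thesis by (simp add: trunc_image_def)
qed

theorem adapted_index_eq:
  "sub_index (supported (cw_cells X k)) (adapted_lattice k) = coker_index k * sub_index (trunc_image k) (tree_image k)"
  using index_step_quot[of k] index_step_boundary[of k] by simp

lemma adapted_index_nonzero: "sub_index (supported (cw_cells X k)) (adapted_lattice k) \<noteq> 0"
  using adapted_index(2) finite_distinct_list[OF finite_cells] by metis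

text \<open>The order of the torsion subgroup of $H_{k-1}$ of a complex whose cycles of degree \<open>k -
1\<close> are those of \<open>X\<close> and whose boundaries are \<open>B\<close>.\<close>

definition torsion_order :: "('c \<Rightarrow> int) set \<Rightarrow> nat \<Rightarrow> nat" where
  "torsion_order B k = (case k of 0 \<Rightarrow> 1 | Suc j \<Rightarrow> torsion_index (cyc X j) B)"

text \<open>The boundaries of the tree have finite index in those of the truncation, so both have the same
saturation \<open>S\<close> in the cycles of degree \<open>j = k - 1\<close>, and the indices
multiply along the tower. That \<open>S\<close> contains the boundaries of the tree with finite
index is seen one degree lower: the lattice of \<open>adapted j\<close> has finite index in all
chains and meets \<open>S\<close> in these boundaries only.\<close>

theorem torsion_order_tree:
  "torsion_order (tree_image k) k = torsion_order (trunc_image k) k * sub_index (trunc_image k) (tree_image k)"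
  "torsion_order (trunc_image k) k \<noteq> 0"
proof -
  have "torsion_order (tree_image k) k = torsion_order (trunc_image k) k * sub_index (trunc_image k) (tree_image k)
    \<and> torsion_order (trunc_image k) k \<noteq> 0"
  proof (cases k)
    case 0
    have "tree_image 0 = {\<lambda>_. 0}" "trunc_image 0 = {\<lambda>_. 0}"
      using fun_submodule_zero[OF fun_submodule_supported] by (auto simp: tree_image_def trunc_image_def image_iff)
    then show ?thesis
      using 0 sub_index_self[OF fun_submodule_add_subgroup[OF fun_submodule_images(1)], of 0] by (simp add: torsion_order_def)
  next
    case (Suc j)
    let ?T = "tree_image k" and ?V = "trunc_image k"
    let ?S = "{z \<in> cyc X j. \<exists>n. n \<noteq> 0 \<and> (\<lambda>e. n * z e) \<in> ?T}"
    have TV: "?T \<subseteq> ?V" by (rule tree_image_trunc_image)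
    have Vc: "?V \<subseteq> cyc X j" using trunc_image_cyc Suc by simp
    have fin: "sub_index ?V ?T \<noteq> 0" using adapted_index_nonzero[of k] unfolding adapted_index_eq by simp
    have S: "{z \<in> cyc X j. \<exists>n. n \<noteq> 0 \<and> (\<lambda>e. n * z e) \<in> ?V} = ?S"
    proof
      show "{z \<in> cyc X j. \<exists>n. n \<noteq> 0 \<and> (\<lambda>e. n * z e) \<in> ?V} \<subseteq> ?S"
      proof
        fix z assume "z \<in> {z \<in> cyc X j. \<exists>n. n \<noteq> 0 \<and> (\<lambda>e. n * z e) \<in> ?V}"
        then obtain n where z: "z \<in> cyc X j" and n: "n \<noteq> 0" "(\<lambda>e. n * z e) \<in> ?V" by blast
        obtain m where "m \<noteq> 0" "(\<lambda>e. m * (n * z e)) \<in> ?T"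
          by (rule finite_index_multiple[OF fun_submodule_images(2,1) fin n(2)])
        then show "z \<in> ?S" using z n(1) by (auto intro!: exI[of _ "m * n"] simp: mult.assoc)
      qed
    qed (use TV in blast)
    have subS: "fun_submodule ?S" unfolding fun_submodule_def
    proof (intro conjI ballI allI)
      show "(\<lambda>_. 0) \<in> ?S"
        using fun_submodule_zero[OF fun_submodule_cyc] fun_submodule_zero[OF fun_submodule_images(1)] by (auto intro!: exI[of _ 1])
      fix c assume "c \<in> ?S"
      then obtain n where c: "c \<in> cyc X j" and n: "n \<noteq> 0" "(\<lambda>e. n * c e) \<in> ?T" by blast
      show "(\<lambda>e. r * c e) \<in> ?S" for r
        using fun_submodule_smult[OF fun_submodule_cyc c, of r] fun_submodule_smult[OF fun_submodule_images(1) n(2), of r] n(1)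
        by (auto intro!: exI[of _ n] simp: ac_simps)
      fix d assume "d \<in> ?S"
      then obtain m where d: "d \<in> cyc X j" and m: "m \<noteq> 0" "(\<lambda>e. m * d e) \<in> ?T" by blast
      have "(\<lambda>e. m * (n * c e) + n * (m * d e)) \<in> ?T"
        by (rule fun_submodule_add[OF fun_submodule_images(1) fun_submodule_smult[OF fun_submodule_images(1) n(2)]
              fun_submodule_smult[OF fun_submodule_images(1) m(2)]])
      then have "(\<lambda>e. (m * n) * (c e + d e)) \<in> ?T" by (simp add: algebra_simps)
      then show "(\<lambda>e. c e + d e) \<in> ?S"
        using fun_submodule_add[OF fun_submodule_cyc c d] n(1) m(1) by (auto intro!: exI[of _ "m * n"])
    qed
    have VS: "?V \<subseteq> ?S" using Vc by (subst S[symmetric]) (auto intro!: exI[of _ 1])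
    have tower: "sub_index ?S ?T = sub_index ?S ?V * sub_index ?V ?T"
      using subS VS TV fun_submodule_images by (intro sub_index_tower) (auto intro: fun_submodule_add_subgroup)
    have "sub_index ?S ?T \<noteq> 0"
    proof (rule sub_index_Int_nonzero[OF adapted_index_nonzero[of j]])
      show "?S \<subseteq> supported (cw_cells X j)" using cyc_supported by blast
      show "?S \<noteq> {}" using fun_submodule_zero[OF subS] by blast
      show "?T \<subseteq> adapted_lattice j"
      proof
        fix p assume "p \<in> ?T"
        then show "p \<in> adapted_lattice j"
          unfolding Suc by (rule adapted_latticeI[OF _ zero_cyc_plus_tree]) simp
      qed
      fix x y assume "x \<in> ?S" "y \<in> ?S" and xy: "x - y \<in> adapted_lattice j"
      then have "x - y \<in> ?S" using fun_submodule_add_subgroup[OF subS] by (intro add_subgroup_diff)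
      then obtain n where c: "x - y \<in> cyc X j" and n: "n \<noteq> 0" "(\<lambda>e. n * (x - y) e) \<in> ?T" by blast
      obtain p w' where w': "p \<in> tree_image (Suc j)" "w' \<in> cyc_plus_tree j" "x - y = (\<lambda>e. p e + w' e)"
        using xy by (rule adapted_latticeE)
      obtain v u where vu: "v \<in> trunc_cyc j" "u \<in> supported (T j)" "w' = (\<lambda>e. v e + u e)"
        using w'(2) by (rule cyc_plus_treeE)
      have w: "x - y = (\<lambda>e. p e + (v e + u e))" "p \<in> ?T" "v \<in> trunc_cyc j" "u \<in> supported (T j)"
        using w' vu Suc by simp_all
      have p: "p \<in> cyc X j" using w(2) TV Vc by blast
      \<comment> \<open>the part on the tree is a cycle and the part on the truncation is torsion, so both vanish\<close>
      have "cw_boundary X j (x - y) = cw_boundary X j u"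
        unfolding w(1) boundary_add using p w(3) by (simp add: cyc_def trunc_cyc_def)
      then have "cw_boundary X j u = (\<lambda>_. 0)" using c by (simp add: cyc_def)
      then have "u = (\<lambda>_. 0)" by (rule T_inj[OF w(4)])
      then have xyv: "x - y = (\<lambda>e. p e + v e)" using w(1) by simp
      have "(\<lambda>e. n * (x - y) e - n * p e) \<in> ?T"
        by (rule fun_submodule_diff[OF fun_submodule_images(1) n(2) fun_submodule_smult[OF fun_submodule_images(1) w(2)]])
      then have "(\<lambda>e. n * v e) \<in> ?T" unfolding xyv by (simp add: algebra_simps)
      moreover have "(\<lambda>e. n * v e) \<in> supported (V j)" using w(3) by (auto simp: trunc_cyc_def supported_def)
      ultimately have "(\<lambda>e. n * v e) = (\<lambda>_. 0)" using tree_image_Int_trunc Suc by blast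
      then have "v = (\<lambda>_. 0)" using n(1) by (simp add: fun_eq_iff)
      then show "x - y \<in> ?T" using xyv w(2) by simp
    qed (use fun_submodule_images fun_submodule_adapted_lattice in \<open>auto intro: fun_submodule_add_subgroup\<close>)
    moreover have "torsion_order ?V k = sub_index ?S ?V"
      unfolding S[symmetric] using Suc by (simp add: torsion_order_def torsion_index_def)
    moreover have "torsion_order ?T k = sub_index ?S ?T"
      using Suc by (simp add: torsion_order_def torsion_index_def)
    ultimately show ?thesis using tower by simp
  qed
  then show "torsion_order (tree_image k) k = torsion_order (trunc_image k) k * sub_index (trunc_image k) (tree_image k)"
    "torsion_order (trunc_image k) k \<noteq> 0" by auto
qed

end

section \<open>The torsion for a choice of bases\<close>

lemma unit_chain_eq: "unit_chain = basis_fun"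
  by (simp add: unit_chain_def basis_fun_def fun_eq_iff)

context truncated_cw
begin

text \<open>A complex \<open>Y\<close> without cells of degree \<open>k + 1\<close> has its cycles as
homology. Another basis of them changes the determinant by a unit of $\mathbb{Z}$, which the
square does not notice.\<close>

lemma chi_eq:
  assumes Y: "cyc Y k = (trunc_cyc k :: ('c \<Rightarrow> int) set)" "bnd Y k = {\<lambda>_. 0 :: int}"
  shows "chi X h Y k = (Determinant.det (basis_matrix (HR k) (h k) (map (cls k) (map real_chain (cycle_basis k)))))\<^sup>2"
proof -
  let ?Z = "fun_module (trunc_cyc k) :: (int, 'c \<Rightarrow> int) module" and ?H = "cw_homology Y k :: (int, ('c \<Rightarrow> int) set) module"
  let ?c = "coset {\<lambda>_. 0 :: int} :: ('c \<Rightarrow> int) \<Rightarrow> _" and ?F = "homology_map X k real_chain"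
  have H: "?H = quotient_module ?Z {\<lambda>_. 0}" by (simp add: cw_homology_eq Y)
  have zero: "fun_submodule {\<lambda>_::'c. 0 :: int}" by (simp add: fun_submodule_def)
  have zs: "{\<lambda>_. 0} \<subseteq> (trunc_cyc k :: ('c \<Rightarrow> int) set)" using fun_submodule_zero[OF fun_submodule_trunc_cyc] by simp
  note q = fun_submodule_trunc_cyc[of k] zero zs
  have Z: "lmod ?Z" by (rule lmod_fun_module[OF fun_submodule_trunc_cyc])
  interpret Z: lmod ?Z by (rule Z)
  interpret R: lmod "HR k" by (rule lmod_HR)
  have Hm: "lmod ?H" unfolding H by (rule lmod_quotient[OF q])
  have iso: "linear_iso ?Z ?H ?c"
  proof -
    have "inj_on ?c (trunc_cyc k)"
      by (rule inj_onI) (simp add: coset_eq_iff[OF zero] fun_eq_iff)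
    then show ?thesis
      unfolding linear_iso_def H using coset_linear[OF q] quotient_carrier[OF q] by (simp add: bij_betw_def)
  qed
  have F: "map ?F (map ?c z) = map (cls k) (map real_chain z)" if "set z \<subseteq> trunc_cyc k" for z
  proof -
    have "?F (?c x) = cls k (real_chain x)" if "x \<in> trunc_cyc k" for x
      using that fun_submodule_zero[OF fun_submodule_bnd[of X k]] by (intro homology_map_coset) (auto simp: trunc_cyc_def)
    then show ?thesis using that by auto
  qed
  let ?D = "\<lambda>z. Determinant.det (basis_matrix (HR k) (h k) (map (cls k) (map real_chain z)))"
  have main: "(?D z)\<^sup>2 = (?D (cycle_basis k))\<^sup>2" if z: "module_basis ?Z z" for z
  proof -
    let ?P = "basis_matrix ?Z (cycle_basis k) z"
    have zZ: "set z \<subseteq> trunc_cyc k" using Z.basis_carrier[OF z] by simp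
    have zbZ: "set (cycle_basis k) \<subseteq> trunc_cyc k" using Z.basis_carrier[OF cycle_basis] by simp
    have rb: "module_basis (fun_module (trunc_cyc k)) (map real_chain (cycle_basis k))" by (rule real_trunc_cyc_basis[OF cycle_basis])
    have rbs: "set (map real_chain (cycle_basis k)) \<subseteq> trunc_cyc k" using rb by (simp add: module_basis_def)
    have len: "length (cycle_basis k) = length (h k)" "length z = length (h k)"
      using basis_length_unique[OF lmod_HR h_basis trunc_cyc_class_basis[OF cycle_basis]]
        basis_length_unique[OF lmod_HR h_basis trunc_cyc_class_basis[OF z]] by simp_all
    have "basis_matrix (HR k) (h k) (map (cls k) (map real_chain z))
       = basis_matrix (HR k) (h k) (map (cls k) (map real_chain (cycle_basis k))) * map_mat real_of_int ?P"
    proof (rule R.basis_matrix_lin_comb[OF h_basis])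
      show "set (map (cls k) (map real_chain (cycle_basis k))) \<subseteq> carrier (HR k)"
        using R.basis_carrier[OF trunc_cyc_class_basis[OF cycle_basis]] .
      show "map_mat real_of_int ?P \<in> carrier_mat (length (map (cls k) (map real_chain (cycle_basis k)))) (length (map (cls k) (map real_chain z)))"
        by (simp add: basis_matrix_def)
      fix j assume "j < length (map (cls k) (map real_chain z))"
      then have j: "j < length z" by simp
      have "z ! j = lin_comb ?Z (cycle_basis k) (coords ?Z (cycle_basis k) (z ! j))"
        using Z.lin_comb_coords[OF cycle_basis, of "z ! j"] zZ j nth_mem by (simp add: subset_iff)
      also have "\<dots> = (\<lambda>e. \<Sum>i<length (cycle_basis k). coords ?Z (cycle_basis k) (z ! j) i * (cycle_basis k ! i) e)"
        by (rule lin_comb_fun_module[OF fun_submodule_trunc_cyc zbZ])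
      finally have zj: "z ! j = (\<lambda>e. \<Sum>i<length (cycle_basis k). ?P $$ (i, j) * (cycle_basis k ! i) e)"
        using j by (simp add: basis_matrix_def)
      have "real_chain (z ! j) = (\<lambda>e. \<Sum>i<length (map real_chain (cycle_basis k)). real_of_int (?P $$ (i, j)) * (map real_chain (cycle_basis k) ! i) e)"
        unfolding zj by (simp add: real_chain_def)
      also have "\<dots> = lin_comb (fun_module (trunc_cyc k)) (map real_chain (cycle_basis k)) (\<lambda>i. real_of_int (?P $$ (i, j)))"
        by (rule lin_comb_fun_module[OF fun_submodule_trunc_cyc rbs, symmetric])
      finally have "cls k (real_chain (z ! j)) = cls k (lin_comb (fun_module (trunc_cyc k)) (map real_chain (cycle_basis k)) (\<lambda>i. real_of_int (?P $$ (i, j))))"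
        by simp
      also have "\<dots> = lin_comb (HR k) (map (cls k) (map real_chain (cycle_basis k))) (\<lambda>i. real_of_int (?P $$ (i, j)))"
        by (rule linear_map_lin_comb[OF lmod_fun_module[OF fun_submodule_trunc_cyc] lmod_HR])
          (use trunc_cyc_iso rbs in \<open>simp_all add: linear_iso_def\<close>)
      also have "\<dots> = lin_comb (HR k) (map (cls k) (map real_chain (cycle_basis k))) (\<lambda>i. map_mat real_of_int ?P $$ (i, j))"
        by (rule R.lin_comb_cong) (use j R.basis_carrier[OF trunc_cyc_class_basis[OF cycle_basis]] in \<open>auto simp: basis_matrix_def\<close>)
      finally show "map (cls k) (map real_chain z) ! j = lin_comb (HR k) (map (cls k) (map real_chain (cycle_basis k))) (\<lambda>i. map_mat real_of_int ?P $$ (i, j))"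
        using j by simp
    qed
    moreover have "basis_matrix (HR k) (h k) (map (cls k) (map real_chain (cycle_basis k))) \<in> carrier_mat (length (h k)) (length (h k))"
      "map_mat real_of_int ?P \<in> carrier_mat (length (h k)) (length (h k))"
      using len by (simp_all add: basis_matrix_def)
    ultimately have "?D z = ?D (cycle_basis k) * Determinant.det (map_mat real_of_int ?P)"
      by (simp only: det_mult)
    moreover have "(Determinant.det ?P)\<^sup>2 = 1"
      using abs_basis_det[OF Z cycle_basis z] by (metis power2_abs power_one)
    then have "(real_of_int (Determinant.det ?P))\<^sup>2 = 1" by (metis of_int_1 of_int_power)
    ultimately show ?thesis by (simp add: det_of_int_mat power_mult_distrib)
  qed
  show ?thesis unfolding chi_def
  proof (rule the_equality)
    have "module_basis ?H (map ?c (cycle_basis k))" by (rule linear_iso_basis[OF Z Hm iso cycle_basis])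
    moreover have "set (cycle_basis k) \<subseteq> trunc_cyc k" using Z.basis_carrier[OF cycle_basis] by simp
    ultimately show "\<exists>vs. module_basis ?H vs \<and> (?D (cycle_basis k))\<^sup>2 = (Determinant.det (basis_matrix (HR k) (h k) (map ?F vs)))\<^sup>2"
      using F by metis
    fix x assume "\<exists>vs. module_basis ?H vs \<and> x = (Determinant.det (basis_matrix (HR k) (h k) (map ?F vs)))\<^sup>2"
    then obtain vs where vs: "module_basis ?H vs" "x = (Determinant.det (basis_matrix (HR k) (h k) (map ?F vs)))\<^sup>2" by blast
    let ?g = "inv_into (carrier ?Z) ?c"
    have z: "module_basis ?Z (map ?g vs)"
      by (rule linear_iso_basis[OF Hm Z linear_iso_inv[OF Z Hm iso] vs(1)])
    have "set vs \<subseteq> ?c ` trunc_cyc k" using vs(1) quotient_carrier[OF q] unfolding H by (simp add: module_basis_def)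
    then have "map ?c (map ?g vs) = vs" by (auto simp: f_inv_into_f subset_iff intro!: map_idI)
    then have e: "map ?F vs = map (cls k) (map real_chain (map ?g vs))"
      using F[of "map ?g vs"] Z.basis_carrier[OF z] by simp
    show "x = (?D (cycle_basis k))\<^sup>2" unfolding vs(2) e by (rule main[OF z])
  qed
qed

subsection \<open>The adapted choice\<close>

definition cell_list :: "nat \<Rightarrow> 'c list" where
  "cell_list k = enumeration (cw_cells X k)"

lemma cell_list: "distinct (cell_list k)" "set (cell_list k) = cw_cells X k"
  unfolding cell_list_def by (rule enumeration[OF finite_cells])+

text \<open>The chain of the tree with a given boundary.\<close>

definition split_s :: "nat \<Rightarrow> ('c \<Rightarrow> real) \<Rightarrow> 'c \<Rightarrow> real" where
  "split_s k = inv_into (supported (T (Suc k))) (cw_boundary X (Suc k))"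

text \<open>The cycle of the truncation in a given homology class.\<close>

definition split_t :: "nat \<Rightarrow> ('c \<Rightarrow> real) set \<Rightarrow> 'c \<Rightarrow> real" where
  "split_t k = inv_into (trunc_cyc k) (cls k)"

lemma adapted_choices: "torsion_choices X cell_list (\<lambda>k. tree_bnd (Suc k)) split_s split_t"
  unfolding torsion_choices_def
proof (intro allI conjI ballI)
  fix k
  show "distinct (cell_list k)" "set (cell_list k) = cw_cells X k" by (rule cell_list)+
  show "module_basis (cw_boundaries X k) (tree_bnd (Suc k) :: ('c \<Rightarrow> real) list)"
    unfolding cw_boundaries_eq by (rule bnd_basis)
  have iso: "linear_iso (fun_module (supported (T (Suc k)))) (fun_module (bnd X k) :: (real, _) module) (cw_boundary X (Suc k))"
  proof -
    have "linear_iso (fun_module (supported (T (Suc k)))) (fun_module (cw_boundary X (Suc k) ` supported (T (Suc k)) :: ('c \<Rightarrow> real) set)) (cw_boundary X (Suc k))"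
      by (rule tree_iso) (rule T_inj_real)
    then show ?thesis unfolding T_bnd .
  qed
  from linear_iso_inv[OF lmod_fun_module[OF fun_submodule_supported] lmod_fun_module[OF fun_submodule_bnd] iso]
  have "linear_map (fun_module (bnd X k)) (fun_module (supported (T (Suc k)))) (split_s k)"
    by (simp add: linear_iso_def split_s_def)
  then show "linear_map (cw_boundaries X k) (cw_chains X (Suc k)) (split_s k)"
    unfolding cw_boundaries_eq cw_chains_eq using supported_mono[OF T_X[of "Suc k"]] by (auto simp: linear_map_def)
  fix x :: "'c \<Rightarrow> real" assume "x \<in> carrier (cw_boundaries X k)"
  then have "x \<in> cw_boundary X (Suc k) ` supported (T (Suc k))" unfolding cw_boundaries_eq T_bnd by simp
  then show "cw_boundary X (Suc k) (split_s k x) = x" unfolding split_s_def by (rule f_inv_into_f)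
next
  fix k
  from linear_iso_inv[OF lmod_fun_module[OF fun_submodule_trunc_cyc] lmod_HR trunc_cyc_iso, of k]
  have "linear_map (HR k) (fun_module (trunc_cyc k)) (split_t k)"
    by (simp add: linear_iso_def split_t_def)
  then show "linear_map (HR k) (cw_cycles X k) (split_t k)"
    unfolding cw_cycles_eq by (auto simp: linear_map_def trunc_cyc_def)
  fix y assume "y \<in> carrier (HR k)"
  then have "y \<in> cls k ` trunc_cyc k" using trunc_cyc_iso[of k] by (simp add: linear_iso_def bij_betw_def)
  then have "cls k (split_t k y) = y" unfolding split_t_def by (rule f_inv_into_f)
  then show "carrier (cw_boundaries X k) +>\<^bsub>cw_cycles X k\<^esub> split_t k y = y"
    by (simp add: cw_boundaries_eq cw_cycles_eq a_r_coset_eq)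
qed

subsection \<open>Independence of the choices\<close>

text \<open>The block of lifted boundaries in the basis of degree \<open>k\<close>; it is empty in degree 0,
where $B_{-1} = 0$.\<close>

definition lift_b :: "(nat \<Rightarrow> ('c \<Rightarrow> real) list) \<Rightarrow> (nat \<Rightarrow> ('c \<Rightarrow> real) \<Rightarrow> 'c \<Rightarrow> real) \<Rightarrow> nat \<Rightarrow> ('c \<Rightarrow> real) list" where
  "lift_b b s k = (case k of 0 \<Rightarrow> [] | Suc j \<Rightarrow> map (s j) (b j))"

definition below_b :: "(nat \<Rightarrow> ('c \<Rightarrow> real) list) \<Rightarrow> nat \<Rightarrow> ('c \<Rightarrow> real) list" where
  "below_b b k = (case k of 0 \<Rightarrow> [] | Suc j \<Rightarrow> b j)"

lemma image_boundary_0: "cw_boundary X 0 ` supported (cw_cells X 0) = {\<lambda>_. 0 :: real}"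
  using fun_submodule_zero[OF fun_submodule_supported] by (auto simp: image_iff)

context
  fixes c b s t
  assumes ch: "torsion_choices X c b s t"
begin

lemma choice_c: "distinct (c k)" "set (c k) = cw_cells X k"
  and choice_b: "module_basis (fun_module (bnd X k)) (b k)"
  and choice_s: "linear_map (fun_module (bnd X k)) (CR (Suc k)) (s k)" "x \<in> bnd X k \<Longrightarrow> cw_boundary X (Suc k) (s k x) = x"
  and choice_t: "linear_map (HR k) (fun_module (cyc X k)) (t k)" "y \<in> carrier (HR k) \<Longrightarrow> cls k (t k y) = y"
  using ch unfolding torsion_choices_def cw_boundaries_eq cw_chains_eq cw_cycles_eq
  by (simp_all add: a_r_coset_eq)

lemma choice_b_subset: "set (b k) \<subseteq> bnd X k"
  using choice_b[of k] by (simp add: module_basis_def)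

lemma h_carrier: "set (h k) \<subseteq> carrier (HR k)"
  using h_basis[of k] by (simp add: module_basis_def)

lemma choice_th: "set (map (t k) (h k)) \<subseteq> cyc X k" "map (cls k) (map (t k) (h k)) = h k"
  using choice_t(1)[of k] choice_t(2)[of _ k] h_carrier[of k] by (auto simp: linear_map_def Pi_iff subset_iff intro!: map_idI)

lemma choice_lift: "set (lift_b b s k) \<subseteq> supported (cw_cells X k)" "map (cw_boundary X k) (lift_b b s k) = below_b b k"
  using choice_s choice_b_subset
  by (auto simp: lift_b_def below_b_def linear_map_def Pi_iff subset_iff simp del: cw_boundary.simps split: nat.splits intro!: map_idI)

lemma choice_below: "module_basis (fun_module (cw_boundary X k ` supported (cw_cells X k))) (below_b b k)"
proof (cases k)
  case 0
  interpret lmod "fun_module {\<lambda>_. 0} :: (real, 'c \<Rightarrow> real) module"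
    by (rule lmod_fun_module) (simp add: fun_submodule_def)
  have "module_basis (fun_module {\<lambda>_. 0} :: (real, 'c \<Rightarrow> real) module) []"
    unfolding module_basis_iff indep_def by simp
  then show ?thesis by (simp only: 0 below_b_def nat.case image_boundary_0)
next
  case (Suc j)
  then show ?thesis using choice_b[of j] by (simp add: below_b_def bnd_def del: cw_boundary.simps)
qed

definition choice_list :: "nat \<Rightarrow> ('c \<Rightarrow> real) list" where
  "choice_list k = b k @ map (t k) (h k) @ lift_b b s k"

lemma choice_list_basis: "module_basis (CR k) (choice_list k)"
  unfolding choice_list_def
  by (rule chain_basis[OF choice_b choice_th(1) _ choice_lift(1)])
    (simp_all only: choice_th(2) choice_lift(2) h_basis choice_below)

lemma torsion_matrix_eq: "torsion_matrix X h c b s t k = basis_matrix (CR k) (map basis_fun (c k)) (choice_list k)"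
  by (simp add: torsion_matrix_def cw_chains_eq unit_chain_eq choice_list_def lift_b_def)

lemma torsion_matrix_high:
  assumes "cw_cells X k = {}" shows "Determinant.det (torsion_matrix X h c b s t k) = 1"
proof -
  have "c k = []" using choice_c(2)[of k] assms by simp
  moreover have "length (choice_list k) = 0"
    using basis_length_unique[OF lmod_CR cells_basis[OF choice_c] choice_list_basis, of k] \<open>c k = []\<close> by simp
  ultimately have "torsion_matrix X h c b s t k \<in> carrier_mat 0 0" unfolding torsion_matrix_eq by (simp add: basis_matrix_def)
  then show ?thesis by (rule det_dim_zero)
qed

end

lemma cell_order_sign:
  assumes "distinct c" "set c = cw_cells X k" "distinct c'" "set c' = cw_cells X k"
  shows "(Determinant.det (basis_matrix (CR k) (map basis_fun c) (map basis_fun c')))\<^sup>2 = 1"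
proof -
  let ?M = "fun_module (supported (set c)) :: (int, _) module"
  have M: "lmod ?M" by (rule lmod_fun_module[OF fun_submodule_supported])
  have b: "module_basis ?M (map basis_fun c)" "module_basis ?M (map basis_fun c')"
    using basis_funs[OF assms(1)] basis_funs[OF assms(3)] assms(2,4) by simp_all
  have "basis_matrix (CR k) (map basis_fun c) (map basis_fun c') = map_mat real_of_int (basis_matrix ?M (map basis_fun c) (map basis_fun c'))"
    using real_basis_matrix_basis_funs[OF assms(1), of "map basis_fun c'"] b(2) assms(2)
    by (simp add: module_basis_def real_chain_basis_fun o_def)
  moreover have "(Determinant.det (basis_matrix ?M (map basis_fun c) (map basis_fun c')))\<^sup>2 = 1"
    using abs_basis_det[OF M b] by (metis power2_abs power_one)
  ultimately show ?thesis by (simp add: det_of_int_mat) (metis of_int_1 of_int_power)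
qed

text \<open>The two bases of the chains are compared by \<open>chain_det\<close>. The block of homology is an
identity matrix, as both splittings lift the same classes; the other two blocks compare the bases
of $B_k$ and of $B_{k-1}$. Reordering the cells costs a sign.\<close>

lemma torsion_matrix_change:
  assumes ch: "torsion_choices X c b s t" and ch': "torsion_choices X c' b' s' t'"
  shows "(Determinant.det (torsion_matrix X h c' b' s' t' k))\<^sup>2 = (Determinant.det (torsion_matrix X h c b s t k))\<^sup>2
    * ((Determinant.det (basis_matrix (fun_module (bnd X k)) (b k) (b' k)))\<^sup>2
    * (case k of 0 \<Rightarrow> 1 | Suc j \<Rightarrow> (Determinant.det (basis_matrix (fun_module (bnd X j)) (b j) (b' j)))\<^sup>2))"
proof -
  let ?u = "map basis_fun (c k) :: ('c \<Rightarrow> real) list" and ?u' = "map basis_fun (c' k) :: ('c \<Rightarrow> real) list"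
  let ?W = "choice_list b s t k" and ?W' = "choice_list b' s' t' k"
  have u: "module_basis (CR k) ?u" and u': "module_basis (CR k) ?u'"
    by (rule cells_basis[OF choice_c[OF ch]], rule cells_basis[OF choice_c[OF ch']])
  have W: "module_basis (CR k) ?W" and W': "module_basis (CR k) ?W'"
    by (rule choice_list_basis[OF ch], rule choice_list_basis[OF ch'])
  have W's: "set ?W' \<subseteq> carrier (CR k)" using W' by (simp add: module_basis_def)
  have len: "length ?W' = length ?u" "length ?W' = length ?u'"
    using basis_length_unique[OF lmod_CR W' u] basis_length_unique[OF lmod_CR W' u'] .
  have lb: "length (b' j) = length (b j)" for j
    by (rule basis_length_unique[OF lmod_fun_module[OF fun_submodule_bnd] choice_b[OF ch'] choice_b[OF ch]])
  have "Determinant.det (torsion_matrix X h c' b' s' t' k)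
     = Determinant.det (basis_matrix (CR k) ?u' ?u) * (Determinant.det (basis_matrix (CR k) ?u ?W) * Determinant.det (basis_matrix (CR k) ?W ?W'))"
    unfolding torsion_matrix_eq[OF ch'] basis_det_change[OF lmod_CR u' u W's len(2)] basis_det_change[OF lmod_CR u W W's len(1)] ..
  also have "Determinant.det (basis_matrix (CR k) ?W ?W')
     = Determinant.det (basis_matrix (fun_module (bnd X k)) (b k) (b' k))
      * Determinant.det (basis_matrix (HR k) (map (cls k) (map (t k) (h k))) (map (cls k) (map (t' k) (h k))))
      * Determinant.det (basis_matrix (fun_module (cw_boundary X k ` supported (cw_cells X k)))
          (map (cw_boundary X k) (lift_b b s k)) (map (cw_boundary X k) (lift_b b' s' k)))"
    unfolding choice_list_def[OF ch] choice_list_def[OF ch']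
  proof (rule chain_det[OF choice_b[OF ch] choice_th(1)[OF ch] _ choice_lift(1)[OF ch] _ choice_b_subset[OF ch'] lb choice_th(1)[OF ch'] _ choice_lift(1)[OF ch']])
    show "module_basis (HR k) (map (cls k) (map (t k) (h k)))" by (simp only: choice_th(2)[OF ch] h_basis)
    show "module_basis (fun_module (cw_boundary X k ` supported (cw_cells X k))) (map (cw_boundary X k) (lift_b b s k))"
      by (simp only: choice_lift(2)[OF ch] choice_below[OF ch])
    show "length (lift_b b' s' k) = length (lift_b b s k)" by (simp add: lift_b_def lb split: nat.splits)
  qed simp
  also have "Determinant.det (basis_matrix (HR k) (map (cls k) (map (t k) (h k))) (map (cls k) (map (t' k) (h k)))) = 1"
    unfolding choice_th(2)[OF ch] choice_th(2)[OF ch'] using lmod.basis_matrix_self[OF lmod_HR h_basis] by simp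
  also have "(Determinant.det (basis_matrix (fun_module (cw_boundary X k ` supported (cw_cells X k)))
          (map (cw_boundary X k) (lift_b b s k)) (map (cw_boundary X k) (lift_b b' s' k))))
      = (case k of 0 \<Rightarrow> 1 | Suc j \<Rightarrow> Determinant.det (basis_matrix (fun_module (bnd X j)) (b j) (b' j)))"
    unfolding choice_lift(2)[OF ch] choice_lift(2)[OF ch']
  proof (cases k)
    case 0
    have "basis_matrix M [] [] \<in> carrier_mat 0 0" for M :: "(real, 'c \<Rightarrow> real) module" by (simp add: basis_matrix_def)
    then show "Determinant.det (basis_matrix (fun_module (cw_boundary X k ` supported (cw_cells X k))) (below_b b k) (below_b b' k))
      = (case k of 0 \<Rightarrow> 1 | Suc j \<Rightarrow> Determinant.det (basis_matrix (fun_module (bnd X j)) (b j) (b' j)))"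
      using 0 by (simp add: below_b_def det_dim_zero)
  next
    case (Suc j)
    then show "Determinant.det (basis_matrix (fun_module (cw_boundary X k ` supported (cw_cells X k))) (below_b b k) (below_b b' k))
      = (case k of 0 \<Rightarrow> 1 | Suc j \<Rightarrow> Determinant.det (basis_matrix (fun_module (bnd X j)) (b j) (b' j)))"
      by (simp add: below_b_def bnd_def del: cw_boundary.simps)
  qed
  finally show ?thesis
    unfolding torsion_matrix_eq[OF ch]
    using cell_order_sign[OF choice_c[OF ch'] choice_c[OF ch], of k]
    by (cases k) (simp_all add: power_mult_distrib)
qed

text \<open>Each \<open>g j\<close> occurs in the factors with the numbers \<open>j\<close> and \<open>j +
1\<close>, with opposite exponents.\<close>

lemma telescope:
  fixes g :: "nat \<Rightarrow> real"
  assumes "\<And>k. g k \<noteq> 0"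
  shows "(\<Prod>k<n. (g k * (case k of 0 \<Rightarrow> 1 | Suc j \<Rightarrow> g j)) powi ((-1) ^ k))
    = (case n of 0 \<Rightarrow> 1 | Suc j \<Rightarrow> g j powi ((-1) ^ j))"
proof (induction n)
  case (Suc n)
  show ?case
  proof (cases n)
    case (Suc j)
    have "g j powi (- 1) ^ j * g j powi (- ((- 1) ^ j)) = 1"
      using assms[of j] by (simp add: power_int_minus)
    then show ?thesis unfolding prod.lessThan_Suc Suc.IH unfolding Suc
      by (simp add: power_int_mult_distrib mult.left_commute[of "g j powi (- 1) ^ j"])
  qed simp
qed simp

lemma torsion_sq_eq:
  assumes ch: "torsion_choices X c b s t" and N: "\<forall>k\<ge>N. cw_cells X k = {}"
  shows "(torsion_for X h c b s t)\<^sup>2 = (\<Prod>k<N. ((Determinant.det (torsion_matrix X h c b s t k))\<^sup>2) powi ((-1) ^ k))"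
proof -
  let ?d = "\<lambda>k. Determinant.det (torsion_matrix X h c b s t k)"
  have "torsion_for X h c b s t = (\<Prod>k<N. ?d k powi ((-1) ^ k))"
    unfolding torsion_for_def
  proof (rule Prod_any.expand_superset)
    show "{k. ?d k powi (- 1) ^ k \<noteq> 1} \<subseteq> {..<N}"
    proof
      fix k assume "k \<in> {k. ?d k powi (- 1) ^ k \<noteq> 1}"
      then show "k \<in> {..<N}" using torsion_matrix_high[OF ch, of k] N by (cases "N \<le> k") auto
    qed
  qed simp
  then show ?thesis by (simp add: power2_eq_square power_int_mult_distrib flip: prod.distrib)
qed

text \<open>In the telescoping product only the comparison of the bases of $B_k$ in the top degree
\<open>k\<close> survives, and there $B_k$ is 0.\<close>

lemma torsion_sq_unique:
  assumes ch: "torsion_choices X c b s t" and ch': "torsion_choices X c' b' s' t'"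
  shows "(torsion_for X h c' b' s' t')\<^sup>2 = (torsion_for X h c b s t)\<^sup>2"
proof -
  obtain N0 where N0: "\<And>k. cw_cells X k \<noteq> {} \<Longrightarrow> k \<le> N0"
    using finite_nonempty_dimensions finite_nat_set_iff_bounded_le by auto
  define N where "N = Suc N0"
  have N: "\<forall>k\<ge>N. cw_cells X k = {}" using N0 by (force simp: N_def)
  define g where "g k = (Determinant.det (basis_matrix (fun_module (bnd X k)) (b k) (b' k)))\<^sup>2" for k
  have B: "lmod (fun_module (bnd X k) :: (real, 'c \<Rightarrow> real) module)" for k by (rule lmod_fun_module[OF fun_submodule_bnd])
  have g0: "g k \<noteq> 0" for k
    using basis_det_inverse[OF B choice_b[OF ch, of k] choice_b[OF ch', of k]] by (auto simp: g_def)
  have "g N0 = 1"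
  proof -
    have "tree (Suc N0) = []" using tree(2)[of "Suc N0"] T_X[of "Suc N0"] N[THEN spec, of "Suc N0"] by (simp add: N_def)
    then have "length (b N0) = 0" "length (b' N0) = 0"
      using basis_length_unique[OF B choice_b[OF ch, of N0] bnd_basis] basis_length_unique[OF B choice_b[OF ch', of N0] bnd_basis]
      by simp_all
    then have "basis_matrix (fun_module (bnd X N0)) (b N0) (b' N0) \<in> carrier_mat 0 0" by (simp add: basis_matrix_def)
    then show ?thesis by (simp add: g_def det_dim_zero)
  qed
  have "(torsion_for X h c' b' s' t')\<^sup>2
     = (\<Prod>k<N. ((Determinant.det (torsion_matrix X h c b s t k))\<^sup>2 * (g k * (case k of 0 \<Rightarrow> 1 | Suc j \<Rightarrow> g j))) powi ((-1) ^ k))"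
    unfolding torsion_sq_eq[OF ch' N] torsion_matrix_change[OF ch ch'] g_def ..
  also have "\<dots> = (\<Prod>k<N. ((Determinant.det (torsion_matrix X h c b s t k))\<^sup>2) powi ((-1) ^ k))
      * (\<Prod>k<N. (g k * (case k of 0 \<Rightarrow> 1 | Suc j \<Rightarrow> g j)) powi ((-1) ^ k))"
    unfolding power_int_mult_distrib prod.distrib ..
  also have "(\<Prod>k<N. (g k * (case k of 0 \<Rightarrow> 1 | Suc j \<Rightarrow> g j)) powi ((-1) ^ k)) = 1"
    unfolding telescope[of g, OF g0] by (simp add: N_def \<open>g N0 = 1\<close>)
  finally show ?thesis unfolding torsion_sq_eq[OF ch N] by simp
qed

theorem reidemeister_torsion_sq_eq:
  "reidemeister_torsion_sq X h = (torsion_for X h cell_list (\<lambda>k. tree_bnd (Suc k)) split_s split_t)\<^sup>2"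
  unfolding reidemeister_torsion_sq_def
  using adapted_choices torsion_sq_unique[OF adapted_choices] by (intro the_equality) blast+

subsection \<open>The adapted determinant\<close>

abbreviation "adapted_det k \<equiv> Determinant.det (torsion_matrix X h cell_list (\<lambda>k. tree_bnd (Suc k)) split_s split_t k)"

lemma tree_0: "tree 0 = []"
proof -
  have "e \<notin> T 0" for e
  proof
    assume "e \<in> T 0"
    then have "(basis_fun e :: 'c \<Rightarrow> int) = (\<lambda>_. 0)" by (rule T_inj[of _ 0, OF basis_fun_supported]) simp
    then have "(basis_fun e :: 'c \<Rightarrow> int) e = 0" by simp
    then show False by (simp add: basis_fun_def)
  qed
  then have "T 0 = {}" by blast
  then show ?thesis using tree(2)[of 0] by simp
qed

lemma adapted_lift: "lift_b (\<lambda>k. tree_bnd (Suc k)) split_s k = map basis_fun (tree k)"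
proof (cases k)
  case (Suc j)
  have "inj_on (cw_boundary X (Suc j)) (supported (T (Suc j)) :: ('c \<Rightarrow> real) set)"
    using tree_iso[of "Suc j", OF T_inj_real] by (auto simp: linear_iso_def bij_betw_def simp del: cw_boundary.simps)
  then have "split_s j (cw_boundary X (Suc j) (basis_fun e)) = basis_fun e" if "e \<in> set (tree (Suc j))" for e
    unfolding split_s_def using that tree(2)[of "Suc j"] by (intro inv_into_f_f basis_fun_supported) auto
  then show ?thesis by (simp add: lift_b_def Suc tree_bnd_def del: cw_boundary.simps)
qed (simp add: lift_b_def tree_0)

text \<open>The determinant of the adapted list is an index by \<open>adapted_index\<close>. By
\<open>chain_det\<close> it differs from the determinant for the adapted choices only by the block
of homology, where the cycles of the truncation take the place of \<open>h k\<close>; the square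
of that block is \<open>chi\<close>.\<close>

theorem adapted_det_sq:
  assumes Y: "cyc Y k = (trunc_cyc k :: ('c \<Rightarrow> int) set)" "bnd Y k = {\<lambda>_. 0 :: int}"
  shows "(adapted_det k)\<^sup>2 = (real (torsion_order (tree_image k) k))\<^sup>2 * (real (coker_index k))\<^sup>2
     / ((real (torsion_order (trunc_image k) k))\<^sup>2 * chi X h Y k)"
proof -
  note ch = adapted_choices
  let ?u = "map basis_fun (cell_list k) :: ('c \<Rightarrow> real) list"
  let ?W = "choice_list (\<lambda>k. tree_bnd (Suc k)) split_s split_t k" and ?A = "map real_chain (adapted k)"
  let ?z = "map real_chain (cycle_basis k)"
  have u: "module_basis (CR k) ?u" by (rule cells_basis[OF cell_list])
  have W: "module_basis (CR k) ?W" by (rule choice_list_basis[OF ch])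
  have A: "set ?A \<subseteq> carrier (CR k)" using adapted_basis[of k] by (simp add: module_basis_def)
  have len: "length ?A = length ?u" by (rule basis_length_unique[OF lmod_CR adapted_basis u])
  have lz: "length ?z = length (h k)"
    using basis_length_unique[OF lmod_HR trunc_cyc_class_basis[OF cycle_basis] h_basis] by simp
  have "Determinant.det (basis_matrix (CR k) ?u ?A) = adapted_det k * Determinant.det (basis_matrix (CR k) ?W ?A)"
    unfolding torsion_matrix_eq[OF ch] by (rule basis_det_change[OF lmod_CR u W A len])
  also have "Determinant.det (basis_matrix (CR k) ?W ?A)
     = Determinant.det (basis_matrix (fun_module (bnd X k) :: (real, _) module) (tree_bnd (Suc k)) (tree_bnd (Suc k)))
      * Determinant.det (basis_matrix (HR k) (map (cls k) (map (split_t k) (h k))) (map (cls k) ?z))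
      * Determinant.det (basis_matrix (fun_module (cw_boundary X k ` supported (cw_cells X k)))
          (map (cw_boundary X k) (map basis_fun (tree k))) (map (cw_boundary X k) (map basis_fun (tree k) :: ('c \<Rightarrow> real) list)))"
    unfolding choice_list_def[OF ch] adapted_lift real_adapted
  proof (rule chain_det[OF bnd_basis choice_th(1)[OF ch] _ tree_supported _ _ refl cycle_basis_cyc _ tree_supported refl])
    show "module_basis (HR k) (map (cls k) (map (split_t k) (h k)))" by (simp only: choice_th(2)[OF ch] h_basis)
    show "module_basis (fun_module (cw_boundary X k ` supported (cw_cells X k))) (map (cw_boundary X k) (map basis_fun (tree k) :: ('c \<Rightarrow> real) list))"
      unfolding map_boundary_tree by (rule tree_bnd_basis)
    show "set (tree_bnd (Suc k)) \<subseteq> (bnd X k :: ('c \<Rightarrow> real) set)" using bnd_basis[of k] by (simp add: module_basis_def)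
  qed (use lz in simp)
  also have "basis_matrix (fun_module (bnd X k) :: (real, _) module) (tree_bnd (Suc k)) (tree_bnd (Suc k)) = 1\<^sub>m (length (tree (Suc k)))"
    using lmod.basis_matrix_self[OF lmod_fun_module[OF fun_submodule_bnd] bnd_basis, of k] by simp
  also have "basis_matrix (fun_module (cw_boundary X k ` supported (cw_cells X k)))
          (map (cw_boundary X k) (map basis_fun (tree k))) (map (cw_boundary X k) (map basis_fun (tree k) :: ('c \<Rightarrow> real) list)) = 1\<^sub>m (length (tree k))"
    unfolding map_boundary_tree
    using lmod.basis_matrix_self[OF lmod_fun_module[OF fun_submodule_boundary_image[OF fun_submodule_supported]] tree_bnd_basis, of k] by simp
  finally have "Determinant.det (basis_matrix (CR k) ?u ?A) = adapted_det k * Determinant.det (basis_matrix (HR k) (h k) (map (cls k) ?z))"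
    by (simp only: choice_th(2)[OF ch] det_one mult_1_left mult_1_right)
  then have eq: "(real (sub_index (supported (cw_cells X k)) (adapted_lattice k)))\<^sup>2 = (adapted_det k)\<^sup>2 * chi X h Y k"
    using adapted_index(1)[OF cell_list, of k] by (simp add: chi_eq[OF Y] power_mult_distrib)
  have nz: "sub_index (supported (cw_cells X k)) (adapted_lattice k) \<noteq> 0" by (rule adapted_index_nonzero)
  then have chi0: "chi X h Y k \<noteq> 0" using eq by auto
  have "real (torsion_order (tree_image k) k) * real (coker_index k)
     = real (torsion_order (trunc_image k) k) * real (sub_index (supported (cw_cells X k)) (adapted_lattice k))"
    unfolding torsion_order_tree(1)[of k] adapted_index_eq by simp
  then have "(real (torsion_order (tree_image k) k))\<^sup>2 * (real (coker_index k))\<^sup>2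
     = (real (torsion_order (trunc_image k) k))\<^sup>2 * ((adapted_det k)\<^sup>2 * chi X h Y k)"
    unfolding eq[symmetric] by (simp flip: power_mult_distrib)
  then show ?thesis using chi0 torsion_order_tree(2)[of k] by (simp add: field_simps)
qed

theorem torsion_formula:
  assumes Y: "\<And>k. cyc (Y k) k = (trunc_cyc k :: ('c \<Rightarrow> int) set)" "\<And>k. bnd (Y k) k = {\<lambda>_. 0 :: int}"
  shows "reidemeister_torsion_sq X h = Prod_any (\<lambda>k.
     ((real (torsion_order (tree_image k) k))\<^sup>2 * (real (coker_index k))\<^sup>2
     / ((real (torsion_order (trunc_image k) k))\<^sup>2 * chi X h (Y k) k)) powi ((-1) ^ k))"
proof -
  obtain N0 where N0: "\<And>k. cw_cells X k \<noteq> {} \<Longrightarrow> k \<le> N0"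
    using finite_nonempty_dimensions finite_nat_set_iff_bounded_le by auto
  have N: "\<forall>k\<ge>Suc N0. cw_cells X k = {}" using N0 by force
  have "Prod_any (\<lambda>k. ((adapted_det k)\<^sup>2) powi ((-1) ^ k)) = (\<Prod>k<Suc N0. ((adapted_det k)\<^sup>2) powi ((-1) ^ k))"
  proof (rule Prod_any.expand_superset)
    show "{k. (adapted_det k)\<^sup>2 powi (- 1) ^ k \<noteq> 1} \<subseteq> {..<Suc N0}"
    proof
      fix k assume "k \<in> {k. (adapted_det k)\<^sup>2 powi (- 1) ^ k \<noteq> 1}"
      then show "k \<in> {..<Suc N0}" using torsion_matrix_high[OF adapted_choices, of k] N by (cases "Suc N0 \<le> k") auto
    qed
  qed simp
  then show ?thesis
    unfolding reidemeister_torsion_sq_eq torsion_sq_eq[OF adapted_choices N] adapted_det_sq[OF Y, symmetric] by simp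
qed

end

section \<open>Spanning trees and truncations\<close>

lemma coset_zero_set: "coset {\<lambda>_. 0} z = {z}"
  by (simp add: coset_def)

lemma homology_map_singleton:
  fixes z :: "'c \<Rightarrow> 'r::comm_ring_1"
  shows "homology_map X k id {z} = coset (bnd X k) z"
  by (simp add: homology_map_def cw_boundaries_eq cw_chains_eq a_r_coset_eq)

lemma supported_empty: "supported {} = {\<lambda>_. 0}"
  by (auto simp: supported_def)

lemma image_boundary_empty: "cw_boundary Y k ` supported {} = {\<lambda>_. 0}"
  by (simp add: supported_empty boundary_zero)

locale spanning_data = finite_cw X for X :: "('a, 'c) cw" +
  fixes h :: "nat \<Rightarrow> ('c \<Rightarrow> real) set list" and T V :: "nat \<Rightarrow> ('a, 'c) cw"
  assumes basis: "combinatorial_basis X h"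
    and trees: "spanning_tree_data X T"
    and truncations: "homology_truncation_data X T V"
begin

lemma tree_subcomplex: "subcomplex (T k) X"
proof (cases k)
  case (Suc j)
  then have "subcomplex (T k) (skeleton X k)" using trees by (simp add: spanning_tree_data_def spanning_tree_def)
  then show ?thesis by (rule subcomplex_trans[OF _ skeleton_subcomplex])
qed (use trees in \<open>simp add: spanning_tree_data_def\<close>)

lemma trunc_props:
  "subcomplex (V k) (skeleton X k)" "subcomplex (T k) (V k)"
  "linear_iso (cw_homology (V k) k :: (real, ('c \<Rightarrow> real) set) module) (cw_homology X k) (homology_map X k id)"
  using truncations by (auto simp: homology_truncation_data_def homology_truncation_def)

lemma tree_props:
  "subcomplex (T (Suc k)) (skeleton X (Suc k))"
  "carrier (cw_homology (T (Suc k)) (Suc k) :: (int, ('c \<Rightarrow> int) set) module)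
     = {\<zero>\<^bsub>cw_homology (T (Suc k)) (Suc k) :: (int, ('c \<Rightarrow> int) set) module\<^esub>}"
  "betti (T (Suc k)) k = betti (skeleton X (Suc k)) k"
  "subcomplex (skeleton X k) (T (Suc k))"
  using trees unfolding spanning_tree_data_def spanning_tree_def
  by (metis One_nat_def Suc_le_mono diff_Suc_1 le0)+

lemma tree_0_cells: "cw_cells (T 0) j = {}"
  using trees by (simp add: spanning_tree_data_def)

lemma trunc_subcomplex: "subcomplex (V k) X"
  by (rule subcomplex_trans[OF trunc_props(1) skeleton_subcomplex])

lemma finite_cw_subcomplexes:
  "finite_cw_subcomplex X (T k)" "finite_cw_subcomplex X (V k)" "finite_cw_subcomplex X (skeleton X k)"
  by (unfold_locales; rule tree_subcomplex trunc_subcomplex skeleton_subcomplex)+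

lemma cells_subset_of: "subcomplex Y Y' \<Longrightarrow> cw_cells Y k \<subseteq> cw_cells Y' k"
  by (simp add: subcomplex_def)

lemma skeleton_cells: "cw_cells (skeleton X k) j = (if j \<le> k then cw_cells X j else {})"
  by (simp add: skeleton_def)

lemma tree_cells_top: "cw_cells (T k) (Suc k) = {}"
proof (cases k)
  case (Suc j)
  then show ?thesis using cells_subset_of[OF tree_props(1)[of j], of "Suc k"] by (simp add: skeleton_cells)
qed (simp add: tree_0_cells)

lemma tree_cells_below: "cw_cells (T (Suc k)) k = cw_cells X k"
  using cells_subset_of[OF tree_props(4)[of k], of k] cells_subset_of[OF tree_subcomplex, of "Suc k" k]
  by (auto simp: skeleton_cells)

lemma trunc_cells_top: "cw_cells (V k) (Suc k) = {}"
  using cells_subset_of[OF trunc_props(1)[of k], of "Suc k"] by (simp add: skeleton_cells)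

lemma trunc_cells_below: "cw_cells (V (Suc k)) k = cw_cells X k"
  using cells_subset_of[OF trunc_props(2)[of "Suc k"], of k] cells_subset_of[OF trunc_subcomplex, of "Suc k" k]
    tree_cells_below[of k] by auto

lemma bnd_top: "bnd (T k) k = {\<lambda>_. 0}" "bnd (V k) k = {\<lambda>_. 0}"
  by (simp_all only: bnd_def tree_cells_top trunc_cells_top image_boundary_empty)

lemma cyc_below: "cyc (T (Suc k)) k = cyc X k" "cyc (V (Suc k)) k = cyc X k" "cyc (skeleton X (Suc k)) k = cyc X k"
  by (simp_all add: finite_cw_subcomplex.cyc_sub[OF finite_cw_subcomplexes(1)]
    finite_cw_subcomplex.cyc_sub[OF finite_cw_subcomplexes(2)] finite_cw_subcomplex.cyc_sub[OF finite_cw_subcomplexes(3)]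
    tree_cells_below trunc_cells_below skeleton_cells inf.absorb1 cyc_supported)

lemma bnd_skeleton: "bnd (skeleton X (Suc k)) k = bnd X k"
  unfolding finite_cw_subcomplex.bnd_sub[OF finite_cw_subcomplexes(3)] by (simp add: skeleton_cells bnd_def)

text \<open>In the absence of \<open>(k + 1)\<close>-cells, vanishing homology means that there are no cycles.\<close>

lemma tree_cycles: "cyc (T k) k = {\<lambda>_::'c. 0 :: int}"
proof (cases k)
  case 0
  have "cyc (T k) k \<subseteq> {\<lambda>_::'c. 0 :: int}" using cyc_supported[of "T k" k] by (simp only: 0 tree_0_cells supported_empty)
  then show ?thesis using fun_submodule_zero[OF fun_submodule_cyc[of "T k" k]] by blast
next
  case (Suc j)
  have sub: "{\<lambda>_. 0} \<subseteq> (cyc (T k) k :: ('c \<Rightarrow> int) set)" using fun_submodule_zero[OF fun_submodule_cyc] by simp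
  note q = fun_submodule_cyc[of "T k" k] fun_submodule_trivial sub
  have "coset {\<lambda>_. 0} ` (cyc (T k) k :: ('c \<Rightarrow> int) set) = {{\<lambda>_. 0}}"
    using tree_props(2)[of j] unfolding Suc[symmetric] cw_homology_eq bnd_top quotient_carrier[OF q] quotient_zero[OF q] .
  then show ?thesis by (auto simp: coset_zero_set)
qed

text \<open>The tree has the same cycles of degree \<open>k\<close> as the skeleton, boundaries among those of
the skeleton, and the same Betti number.\<close>

lemma tree_boundaries: "bnd (T (Suc k)) k = (bnd X k :: ('c \<Rightarrow> real) set)"
proof (rule equal_rank_imp_eq)
  show "bnd (T (Suc k)) k \<subseteq> (bnd X k :: ('c \<Rightarrow> real) set)"
    unfolding finite_cw_subcomplex.bnd_sub[OF finite_cw_subcomplexes(1)] unfolding bnd_def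
    by (rule image_mono[OF supported_mono[OF cells_subset_of[OF tree_subcomplex]]])
  show "module_rank (quotient_module (fun_module (cyc X k)) (bnd X k :: ('c \<Rightarrow> real) set)) = module_rank (quotient_module (fun_module (cyc X k)) (bnd (T (Suc k)) k :: ('c \<Rightarrow> real) set))"
    using tree_props(3)[of k] by (simp add: betti_def cw_homology_eq cyc_below bnd_skeleton)
qed (rule fun_submodule_cyc fun_submodule_bnd bnd_subset_cyc cyc_supported finite_cells)+

sublocale truncated: truncated_cw X h "\<lambda>k. cw_cells (T k) k" "\<lambda>k. cw_cells (V k) k"
proof
  fix k
  show "cw_cells (T k) k \<subseteq> cw_cells (V k) k" by (rule cells_subset_of[OF trunc_props(2)])
  show "cw_cells (V k) k \<subseteq> cw_cells X k" by (rule cells_subset_of[OF trunc_subcomplex])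
  show "cw_boundary X (Suc k) ` supported (cw_cells (T (Suc k)) (Suc k)) = (bnd X k :: ('c \<Rightarrow> real) set)"
    using tree_boundaries[of k] unfolding finite_cw_subcomplex.bnd_sub[OF finite_cw_subcomplexes(1)] .
  show "c = (\<lambda>_. 0)" if "c \<in> supported (cw_cells (T k) k)" "cw_boundary X k c = (\<lambda>_. 0 :: int)" for c
  proof -
    have "c \<in> cyc (T k) k"
      using that finite_cw_subcomplex.boundary_sub[OF finite_cw_subcomplexes(1) that(1)] by (simp add: cyc_def)
    then show ?thesis by (simp add: tree_cycles)
  qed
  let ?Z = "cyc (V k) k :: ('c \<Rightarrow> real) set"
  have sub: "{\<lambda>_. 0} \<subseteq> ?Z" using fun_submodule_zero[OF fun_submodule_cyc] by simp
  note q = fun_submodule_cyc[of "V k" k] fun_submodule_trivial sub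
  have "bij_betw (homology_map X k id) (coset {\<lambda>_. 0} ` ?Z) (coset (bnd X k) ` cyc X k)"
    using trunc_props(3)[of k] unfolding linear_iso_def cw_homology_eq bnd_top quotient_carrier[OF q]
      quotient_carrier[OF fun_submodule_cyc fun_submodule_bnd bnd_subset_cyc] by simp
  moreover have "bij_betw (coset {\<lambda>_. 0}) ?Z (coset {\<lambda>_. 0} ` ?Z)"
    by (simp add: bij_betw_def inj_on_def coset_zero_set)
  ultimately have "bij_betw (homology_map X k id \<circ> coset {\<lambda>_. 0}) ?Z (coset (bnd X k) ` cyc X k)"
    by (rule bij_betw_trans[rotated])
  then show "bij_betw (coset (bnd X k)) (cyc X k \<inter> supported (cw_cells (V k) k)) (coset (bnd X k) ` (cyc X k :: ('c \<Rightarrow> real) set))"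
    unfolding finite_cw_subcomplex.cyc_sub[OF finite_cw_subcomplexes(2), symmetric]
    by (simp add: comp_def coset_zero_set homology_map_singleton)
qed (rule basis)

text \<open>The subcomplex has the same cycles of degree \<open>k - 1\<close> as \<open>X\<close>, so only its
boundaries matter.\<close>

lemma theta_eq:
  assumes Y: "subcomplex Y X" and cells: "\<And>j. k = Suc j \<Longrightarrow> cw_cells Y j = cw_cells X j"
  shows "theta Y k = truncated.torsion_order (cw_boundary X k ` supported (cw_cells Y k)) k"
proof (cases k)
  case (Suc j)
  interpret Y: finite_cw_subcomplex X Y by unfold_locales (rule Y)
  have cyc: "cyc Y j = (cyc X j :: ('c \<Rightarrow> int) set)"
    by (simp add: Y.cyc_sub cells[OF Suc] inf.absorb1 cyc_supported)
  have "card (torsion_elements (cw_homology Y j :: (int, ('c \<Rightarrow> int) set) module)) = torsion_index (cyc X j) (bnd Y j)"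
    unfolding cw_homology_eq cyc[symmetric] by (rule card_torsion_elements[OF fun_submodule_cyc fun_submodule_bnd Y.Y.bnd_subset_cyc])
  then show ?thesis by (simp only: theta_def truncated.torsion_order_def Suc nat.case Y.bnd_sub)
qed (simp add: theta_def truncated.torsion_order_def)

lemma theta_tree: "theta (T k) k = truncated.torsion_order (truncated.tree_image k) k"
  unfolding truncated.tree_image_def by (rule theta_eq[OF tree_subcomplex]) (simp add: tree_cells_below)

lemma theta_trunc: "theta (V k) k = truncated.torsion_order (truncated.trunc_image k) k"
  unfolding truncated.trunc_image_def by (rule theta_eq[OF trunc_subcomplex]) (simp add: trunc_cells_below)

lemma coker_order_index: "coker_order X (T (Suc k)) (V k) k = truncated.coker_index k"
proof -
  have "q_map X (V k) k = truncated.quot k" by (intro ext) (simp add: q_map_def truncated.quot_def)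
  then show ?thesis
    unfolding coker_order_eq[OF fun_submodule_bnd] truncated.coker_index_def truncated.tree_image_def
      finite_cw_subcomplex.bnd_sub[OF finite_cw_subcomplexes(1)] by simp
qed

lemma torsion_eq:
  "reidemeister_torsion_sq X h =
    Prod_any (\<lambda>k.
      ((real (theta (T k) k))\<^sup>2 * (real (coker_order X (T (Suc k)) (V k) k))\<^sup>2
        / ((real (theta (V k) k))\<^sup>2 * chi X h (V k) k)) powi ((-1) ^ k))"
  unfolding theta_tree theta_trunc coker_order_index
  by (rule truncated.torsion_formula)
    (simp_all only: truncated.trunc_cyc_def finite_cw_subcomplex.cyc_sub[OF finite_cw_subcomplexes(2)] bnd_top)

end

theorem theorem7p11:
  fixes X :: "('a, 'c) cw"
    and h :: "nat \<Rightarrow> ('c \<Rightarrow> real) set list"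
    and T V :: "nat \<Rightarrow> ('a, 'c) cw"
  assumes "finite_cw_complex X"
    and "connected_space (cw_space X)"
    and "combinatorial_basis X h"
    and "spanning_tree_data X T"
    and "homology_truncation_data X T V"
  shows "reidemeister_torsion_sq X h =
    Prod_any (\<lambda>k.
      ((real (theta (T k) k))\<^sup>2 * (real (coker_order X (T (Suc k)) (V k) k))\<^sup>2
        / ((real (theta (V k) k))\<^sup>2 * chi X h (V k) k)) powi ((-1) ^ k))"
proof -
  interpret spanning_data X h T V using assms by unfold_locales
  show ?thesis by (rule torsion_eq)
qed

end
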